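(* Let $\mathrm{char}\,\Bbbk=5$, $G=\mathrm{Sp}_4$ and $\mathfrak{g}=\mathrm{Lie}(G)$. Then $$\dim\mathrm{Hom}_G(\mathrm{Sym}_2(L(\omega_1+\omega_2)),L(2\omega_1))=\dim\mathrm{Hom}_{\mathfrak{g}}(\mathrm{Sym}_2(L(\omega_1+\omega_2)),L(2\omega_1))=1.$$ In particular, $$\mathrm{Hom}_G(\mathrm{Sym}_2(L(\omega_1+\omega_2)),L(2\omega_1))=\mathrm{Hom}_{\mathfrak{g}}(\mathrm{Sym}_2(L(\omega_1+\omega_2)),L(2\omega_1)).$$
   Context: $\Bbbk$ is an algebraically closed field. $\mathrm{Sp}_4$ is the group of matrices $\begin{pmatrix}A&B\\C&D\end{pmatrix}$ with $2\times2$ blocks satisfying $A^tC-C^tA=0$, $A^tD-C^tB=I_2$, $B^tD-D^tB=0$. Its maximal torus consists of the matrices $\mathrm{diag}(t_1,t_2,t_1^{-1},t_2^{-1})$, with characters $\epsilon_1,\epsilon_2$; positive roots are $2\epsilon_1,2\epsilon_2,\epsilon_1\pm\epsilon_2$; the fundamental weights are $\omega_1=\epsilon_1$, $\omega_2=\epsilon_1+\epsilon_2$. $L(\lambda)$ is the irreducible $G$-module of highest weight $\lambda$; $\mathfrak{g}$ with the adjoint action is isomorphic to $L(2\omega_1)$. $\mathrm{Sym}_2$ denotes the symmetric square, and $\mathfrak{g}$ acts on $G$-modules by the differentiated action. *)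

theory Defs
  imports
    "HOL-Analysis.Analysis"
    "HOL-Library.Function_Algebras"
    "HOL-Computational_Algebra.Polynomial"
begin

section \<open>The group \<open>Sp\<^sub>4\<close>, its torus and its weights\<close>

text \<open>
  The index type \<^typ>\<open>2 + 2\<close> splits a \<open>4 \<times> 4\<close> matrix into \<open>2 \<times> 2\<close> blocks, the upper left block
  having indices \<open>Inl _\<close>.
\<close>

type_synonym 'k mat4 = "'k ^ (2 + 2) ^ (2 + 2)"

definition Sp4 :: "('k::field) mat4 set" where
  "Sp4 = {M.
     let A = (\<chi> i j. M $ Inl i $ Inl j) :: 'k ^ 2 ^ 2;
         B = (\<chi> i j. M $ Inl i $ Inr j) :: 'k ^ 2 ^ 2;
         C = (\<chi> i j. M $ Inr i $ Inl j) :: 'k ^ 2 ^ 2;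
         D = (\<chi> i j. M $ Inr i $ Inr j) :: 'k ^ 2 ^ 2
     in transpose A ** C - transpose C ** A = 0
        \<and> transpose A ** D - transpose C ** B = mat 1
        \<and> transpose B ** D - transpose D ** B = 0}"

definition torus_elt :: "'k::field \<Rightarrow> 'k \<Rightarrow> 'k mat4" where
  "torus_elt t1 t2 = (\<chi> i j. if i = j then
      (case i of Inl a \<Rightarrow> (vector [t1, t2] :: 'k ^ 2) $ a
               | Inr a \<Rightarrow> (vector [inverse t1, inverse t2] :: 'k ^ 2) $ a) else 0)"

text \<open>Weights are written in the basis \<open>\<epsilon>\<^sub>1, \<epsilon>\<^sub>2\<close> of the character lattice of the torus.\<close>

type_synonym weight = "int ^ 2"

definition eps1 :: weight where "eps1 = axis 1 1"
definition eps2 :: weight where "eps2 = axis 2 1"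

definition char_at :: "weight \<Rightarrow> 'k::field \<Rightarrow> 'k \<Rightarrow> 'k" where
  "char_at \<mu> t1 t2 = t1 powi (\<mu> $ 1) * t2 powi (\<mu> $ 2)"

definition pos_roots :: "weight set" where
  "pos_roots = {2 *s eps1, 2 *s eps2, eps1 + eps2, eps1 - eps2}"

definition omega1 :: weight where "omega1 = eps1"
definition omega2 :: weight where "omega2 = eps1 + eps2"

definition weight_le :: "weight \<Rightarrow> weight \<Rightarrow> bool" where
  "weight_le \<mu> \<nu> \<longleftrightarrow> (\<exists>c :: weight \<Rightarrow> nat. \<nu> - \<mu> = (\<Sum>\<alpha>\<in>pos_roots. int (c \<alpha>) *s \<alpha>))"


section \<open>Rational modules\<close>

inductive polyfun :: "(('k::field) mat4 \<Rightarrow> 'k) \<Rightarrow> bool" where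
  const: "polyfun (\<lambda>_. c)"
| entry: "polyfun (\<lambda>M. M $ i $ j)"
| add: "polyfun f \<Longrightarrow> polyfun g \<Longrightarrow> polyfun (\<lambda>M. f M + g M)"
| mult: "polyfun f \<Longrightarrow> polyfun g \<Longrightarrow> polyfun (\<lambda>M. f M * g M)"

text \<open>
  A \<open>G\<close>-module structure on a vector space (with scalar multiplication \<open>sc\<close>) is a map
  \<open>\<rho>\<close> giving the action of each group element; values outside \<^term>\<open>Sp4\<close> are irrelevant.
  \<open>Sp\<^sub>4\<close> is closed in the affine space of all \<open>4 \<times> 4\<close> matrices, so its regular functions are the
  restrictions of polynomial functions in the matrix entries; a module is rational iff its
  matrix coefficients are regular.
\<close>

definition rational_module ::
  "('k::field \<Rightarrow> 'v::ab_group_add \<Rightarrow> 'v) \<Rightarrow> ('k mat4 \<Rightarrow> 'v \<Rightarrow> 'v) \<Rightarrow> bool" where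
  "rational_module sc \<rho> \<longleftrightarrow>
     vector_space sc \<and> (\<exists>B. finite B \<and> module.span sc B = UNIV)
     \<and> (\<forall>g\<in>Sp4. Vector_Spaces.linear sc sc (\<rho> g))
     \<and> \<rho> (mat 1) = id
     \<and> (\<forall>g\<in>Sp4. \<forall>h\<in>Sp4. \<rho> (g ** h) = \<rho> g \<circ> \<rho> h)
     \<and> (\<forall>\<phi> v. Vector_Spaces.linear sc (*) \<phi> \<longrightarrow>
           (\<exists>f. polyfun f \<and> (\<forall>g\<in>Sp4. \<phi> (\<rho> g v) = f g)))"

definition irreducible_module ::
  "('k::field \<Rightarrow> 'v::ab_group_add \<Rightarrow> 'v) \<Rightarrow> ('k mat4 \<Rightarrow> 'v \<Rightarrow> 'v) \<Rightarrow> bool" where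
  "irreducible_module sc \<rho> \<longleftrightarrow>
     rational_module sc \<rho> \<and> (UNIV :: 'v set) \<noteq> {0}
     \<and> (\<forall>U. module.subspace sc U \<and> (\<forall>g\<in>Sp4. \<rho> g ` U \<subseteq> U) \<longrightarrow> U = {0} \<or> U = UNIV)"

definition weight_space ::
  "('k::field \<Rightarrow> 'v::ab_group_add \<Rightarrow> 'v) \<Rightarrow> ('k mat4 \<Rightarrow> 'v \<Rightarrow> 'v) \<Rightarrow> weight \<Rightarrow> 'v set" where
  "weight_space sc \<rho> \<mu> =
     {v. \<forall>t1 t2. t1 \<noteq> 0 \<longrightarrow> t2 \<noteq> 0 \<longrightarrow> \<rho> (torus_elt t1 t2) v = sc (char_at \<mu> t1 t2) v}"

definition has_highest_weight ::
  "('k::field \<Rightarrow> 'v::ab_group_add \<Rightarrow> 'v) \<Rightarrow> ('k mat4 \<Rightarrow> 'v \<Rightarrow> 'v) \<Rightarrow> weight \<Rightarrow> bool" where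
  "has_highest_weight sc \<rho> \<nu> \<longleftrightarrow>
     weight_space sc \<rho> \<nu> \<noteq> {0}
     \<and> (\<forall>\<mu>. weight_space sc \<rho> \<mu> \<noteq> {0} \<longrightarrow> weight_le \<mu> \<nu>)"

text \<open>\<open>is_L sc \<rho> \<nu>\<close>: the module is a model of \<open>L(\<nu>)\<close>, which is unique up to isomorphism.\<close>

definition is_L ::
  "('k::field \<Rightarrow> 'v::ab_group_add \<Rightarrow> 'v) \<Rightarrow> ('k mat4 \<Rightarrow> 'v \<Rightarrow> 'v) \<Rightarrow> weight \<Rightarrow> bool" where
  "is_L sc \<rho> \<nu> \<longleftrightarrow> irreducible_module sc \<rho> \<and> has_highest_weight sc \<rho> \<nu>"


section \<open>The Lie algebra and the differentiated action\<close>

text \<open>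
  Over an infinite field a function \<open>t \<mapsto> f (1 + t X)\<close> with \<open>f\<close> polynomial is given by a unique
  univariate polynomial; its linear coefficient is the derivative \<open>df\<^sub>1(X)\<close> in any characteristic.
\<close>

definition deriv_at_one :: "(('k::field) mat4 \<Rightarrow> 'k) \<Rightarrow> 'k mat4 \<Rightarrow> 'k" where
  "deriv_at_one f X =
     coeff (THE p. \<forall>t. poly p t = f (\<chi> i j. mat 1 $ i $ j + t * X $ i $ j)) 1"

text \<open>\<open>Lie(G)\<close> is the tangent space of \<open>G\<close> at the identity, as a subspace of all matrices.\<close>

definition lie_Sp4 :: "('k::field) mat4 set" where
  "lie_Sp4 = {X. \<forall>f. polyfun f \<and> (\<forall>g\<in>Sp4. f g = 0) \<longrightarrow> deriv_at_one f X = 0}"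

text \<open>
  \<open>differential sc \<rho> X v\<close> is the derivative at \<open>1\<close>, in direction \<open>X\<close>, of the orbit map
  \<open>g \<mapsto> \<rho> g v\<close>, determined by testing against linear functionals \<open>\<phi>\<close>. For \<open>X\<close> in the Lie algebra the
  value \<^term>\<open>deriv_at_one f X\<close> depends only on the restriction of \<open>f\<close> to the group.
\<close>

definition differential ::
  "('k::field \<Rightarrow> 'v::ab_group_add \<Rightarrow> 'v) \<Rightarrow> ('k mat4 \<Rightarrow> 'v \<Rightarrow> 'v) \<Rightarrow> 'k mat4 \<Rightarrow> 'v \<Rightarrow> 'v" where
  "differential sc \<rho> X v = (THE u. \<forall>\<phi> f.
     Vector_Spaces.linear sc (*) \<phi> \<and> polyfun f \<and> (\<forall>g\<in>Sp4. \<phi> (\<rho> g v) = f g)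
       \<longrightarrow> \<phi> u = deriv_at_one f X)"


section \<open>Homomorphism spaces\<close>

definition Hom_G ::
  "('k::field \<Rightarrow> 'v::ab_group_add \<Rightarrow> 'v) \<Rightarrow> ('k mat4 \<Rightarrow> 'v \<Rightarrow> 'v) \<Rightarrow>
   ('k \<Rightarrow> 'w::ab_group_add \<Rightarrow> 'w) \<Rightarrow> ('k mat4 \<Rightarrow> 'w \<Rightarrow> 'w) \<Rightarrow> ('v \<Rightarrow> 'w) set" where
  "Hom_G sc \<rho> sc' \<rho>' =
     {f. Vector_Spaces.linear sc sc' f \<and> (\<forall>g\<in>Sp4. \<forall>v. f (\<rho> g v) = \<rho>' g (f v))}"

definition Hom_Lie ::
  "('k::field \<Rightarrow> 'v::ab_group_add \<Rightarrow> 'v) \<Rightarrow> ('k mat4 \<Rightarrow> 'v \<Rightarrow> 'v) \<Rightarrow>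
   ('k \<Rightarrow> 'w::ab_group_add \<Rightarrow> 'w) \<Rightarrow> ('k mat4 \<Rightarrow> 'w \<Rightarrow> 'w) \<Rightarrow> ('v \<Rightarrow> 'w) set" where
  "Hom_Lie sc \<rho> sc' \<rho>' =
     {f. Vector_Spaces.linear sc sc' f
         \<and> (\<forall>X\<in>lie_Sp4. \<forall>v. f (differential sc \<rho> X v) = differential sc' \<rho>' X (f v))}"

text \<open>Dimension of a space of maps into a vector space, with pointwise scalar multiplication.\<close>

definition dim_maps :: "('k::field \<Rightarrow> 'w::ab_group_add \<Rightarrow> 'w) \<Rightarrow> ('v \<Rightarrow> 'w) set \<Rightarrow> nat" where
  "dim_maps sc H = vector_space.dim (\<lambda>c f v. sc c (f v)) H"


section \<open>The symmetric square\<close>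

text \<open>
  For \<open>V = k\<^sup>n\<close>, the tensor square is realised on \<open>k\<^bsup>n \<times> n\<^esup>\<close>, and the symmetric square is its
  quotient by the span of all \<open>v \<otimes> w - w \<otimes> v\<close>.
\<close>

definition tensor :: "'k::field ^ 'n \<Rightarrow> 'k ^ 'n \<Rightarrow> 'k ^ ('n::finite \<times> 'n)" where
  "tensor v w = (\<chi> p. v $ fst p * w $ snd p)"

definition tensor_map ::
  "('k::field ^ 'n \<Rightarrow> 'k ^ 'n) \<Rightarrow> 'k ^ ('n \<times> 'n) \<Rightarrow> 'k ^ ('n::finite \<times> 'n)" where
  "tensor_map T x = (\<Sum>p\<in>UNIV. x $ p *s tensor (T (axis (fst p) 1)) (T (axis (snd p) 1)))"

lemma tensor_sum_sum:
  fixes u w :: "'i \<Rightarrow> 'k::field ^ 'n::finite" and a b :: "'i \<Rightarrow> 'k"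
  shows "tensor (\<Sum>i\<in>I. a i *s u i) (\<Sum>j\<in>J. b j *s w j)
       = (\<Sum>i\<in>I. \<Sum>j\<in>J. (a i * b j) *s tensor (u i) (w j))"
  by (simp add: tensor_def vec_eq_iff sum_product algebra_simps)

lemma tensor_map_tensor:
  fixes T :: "'k::field ^ 'n \<Rightarrow> 'k ^ 'n::finite"
  assumes "Vector_Spaces.linear (*s) (*s) T"
  shows "tensor_map T (tensor v w) = tensor (T v) (T w)"
proof -
  interpret T: Vector_Spaces.linear "(*s)" "(*s)" T by fact
  have e: "T x = (\<Sum>i\<in>UNIV. x $ i *s T (axis i 1))" for x
    by (subst basis_expansion[of x, symmetric]) (simp only: T.sum T.scale)
  have "tensor (T v) (T w) = tensor (\<Sum>i\<in>UNIV. v $ i *s T (axis i 1)) (\<Sum>i\<in>UNIV. w $ i *s T (axis i 1))"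
    using e by metis
  also have "\<dots> = tensor_map T (tensor v w)"
    unfolding tensor_sum_sum
    by (simp add: tensor_map_def tensor_def sum.cartesian_product case_prod_unfold)
  finally show ?thesis ..
qed

definition swap_span :: "('k::field ^ ('n::finite \<times> 'n)) set" where
  "swap_span = vec.span {tensor v w - tensor w v | v w. True}"

definition sym2_eq :: "'k::field ^ ('n::finite \<times> 'n) \<Rightarrow> 'k ^ ('n \<times> 'n) \<Rightarrow> bool" where
  "sym2_eq x y \<longleftrightarrow> x - y \<in> swap_span"

lemma swap_span_closed:
  "0 \<in> swap_span"
  "x \<in> swap_span \<Longrightarrow> y \<in> swap_span \<Longrightarrow> x + y \<in> swap_span"
  "x \<in> swap_span \<Longrightarrow> y \<in> swap_span \<Longrightarrow> x - y \<in> swap_span"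
  "x \<in> swap_span \<Longrightarrow> - x \<in> swap_span"
  "x \<in> swap_span \<Longrightarrow> c *s x \<in> swap_span"
  unfolding swap_span_def
  by (rule vec.span_zero, erule (1) vec.span_add, erule (1) vec.span_diff,
      erule vec.span_neg, erule vec.span_scale)

lemma sym2_eq_refl: "sym2_eq x x"
  by (simp add: sym2_eq_def swap_span_closed)

quotient_type (overloaded) ('k, 'n) sym2 = "('k::field) ^ (('n::finite) \<times> 'n)" / sym2_eq
  morphisms rep_sym2 abs_sym2
proof (rule equivpI)
  show "reflp sym2_eq"
    by (simp add: reflp_def sym2_eq_refl)
  show "symp sym2_eq"
    unfolding symp_def sym2_eq_def using swap_span_closed(4) by fastforce
  show "transp sym2_eq"
    unfolding transp_def sym2_eq_def using swap_span_closed(2) by fastforce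
qed

instantiation sym2 :: (field, finite) ab_group_add
begin

lift_definition zero_sym2 :: "('a, 'b) sym2" is 0 .

lift_definition plus_sym2 :: "('a, 'b) sym2 \<Rightarrow> ('a, 'b) sym2 \<Rightarrow> ('a, 'b) sym2" is "(+)"
  unfolding sym2_eq_def by (simp only: add_diff_add swap_span_closed(2))

lift_definition uminus_sym2 :: "('a, 'b) sym2 \<Rightarrow> ('a, 'b) sym2" is uminus
  unfolding sym2_eq_def by (simp only: minus_diff_minus swap_span_closed(4))

lift_definition minus_sym2 :: "('a, 'b) sym2 \<Rightarrow> ('a, 'b) sym2 \<Rightarrow> ('a, 'b) sym2" is "(-)"
proof -
  fix a b c d :: "'a ^ ('b \<times> 'b)"
  assume "sym2_eq a b" "sym2_eq c d"
  moreover have "(a - c) - (b - d) = (a - b) - (c - d)" by simp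
  ultimately show "sym2_eq (a - c) (b - d)"
    unfolding sym2_eq_def by (simp only: swap_span_closed(3))
qed

instance
proof
  fix a b c :: "('a, 'b) sym2"
  show "a + b + c = a + (b + c)" by transfer (simp only: add.assoc sym2_eq_refl)
  show "a + b = b + a" by transfer (simp only: add.commute sym2_eq_refl)
  show "0 + a = a" by transfer (simp only: add_0_left sym2_eq_refl)
  show "- a + a = 0" by transfer (simp only: left_minus sym2_eq_refl)
  show "a - b = a + - b" by transfer (simp only: diff_conv_add_uminus sym2_eq_refl)
qed

end

lift_definition sym2_scale :: "'k::field \<Rightarrow> ('k, 'n::finite) sym2 \<Rightarrow> ('k, 'n) sym2" is "(*s)"
  unfolding sym2_eq_def
  by (simp only: vec.scale_right_diff_distrib[symmetric] swap_span_closed(5))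

lemma vector_space_sym2: "vector_space (sym2_scale :: 'k::field \<Rightarrow> ('k, 'n::finite) sym2 \<Rightarrow> _)"
proof
  fix a b :: 'k and x y :: "('k, 'n) sym2"
  show "sym2_scale a (x + y) = sym2_scale a x + sym2_scale a y"
    by transfer (simp only: vec.scale_right_distrib sym2_eq_refl)
  show "sym2_scale (a + b) x = sym2_scale a x + sym2_scale b x"
    by transfer (simp only: vec.scale_left_distrib sym2_eq_refl)
  show "sym2_scale a (sym2_scale b x) = sym2_scale (a * b) x"
    by transfer (simp only: vec.scale_scale sym2_eq_refl)
  show "sym2_scale 1 x = x"
    by transfer (simp only: vec.scale_one sym2_eq_refl)
qed

text \<open>For linear \<open>T\<close>, the map induced by \<open>T \<otimes> T\<close>.\<close>

lift_definition sym2_map ::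
  "('k::field ^ 'n \<Rightarrow> 'k ^ 'n) \<Rightarrow> ('k, 'n::finite) sym2 \<Rightarrow> ('k, 'n) sym2" is tensor_map
proof -
  fix T :: "'k ^ 'n \<Rightarrow> 'k ^ 'n" and x y :: "'k ^ ('n \<times> 'n)"
  assume "sym2_eq x y"
  then have xy: "x - y \<in> swap_span" by (simp add: sym2_eq_def)
  have lin: "Vector_Spaces.linear (*s) (*s) (tensor_map T)"
    by unfold_locales
       (simp_all add: tensor_map_def vec.scale_left_distrib sum.distrib vec.scale_sum_right)
  have S: "module.subspace (*s) {z. tensor_map T z \<in> swap_span}"
  proof -
    interpret L: Vector_Spaces.linear "(*s)" "(*s)" "tensor_map T" by (fact lin)
    show ?thesis
      by (auto simp: vec.subspace_def swap_span_def L.zero L.add L.scale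
          intro: vec.span_zero vec.span_add vec.span_scale)
  qed
  have gen: "tensor_map T (tensor v w - tensor w v) \<in> swap_span" for v w
  proof -
    let ?e = "\<lambda>i. T (axis i 1)"
    let ?d = "\<lambda>i j. tensor (?e i) (?e j) - tensor (?e j) (?e i)"
    have d: "tensor_map T (tensor a b)
        = (\<Sum>i\<in>UNIV. \<Sum>j\<in>UNIV. (a $ i * b $ j) *s tensor (?e i) (?e j))" for a b
      by (simp add: tensor_map_def tensor_def sum.cartesian_product case_prod_unfold)
    have d': "tensor_map T (tensor w v)
        = (\<Sum>i\<in>UNIV. \<Sum>j\<in>UNIV. (v $ i * w $ j) *s tensor (?e j) (?e i))"
      unfolding d by (subst sum.swap) (simp add: mult.commute)
    have "tensor_map T (tensor v w - tensor w v)
        = tensor_map T (tensor v w) - tensor_map T (tensor w v)"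
    proof -
      interpret L: Vector_Spaces.linear "(*s)" "(*s)" "tensor_map T" by (fact lin)
      show ?thesis by (rule L.diff)
    qed
    also have "\<dots> = (\<Sum>i\<in>UNIV. \<Sum>j\<in>UNIV. (v $ i * w $ j) *s ?d i j)"
      unfolding d' unfolding d by (simp add: sum_subtractf vec.scale_right_diff_distrib)
    also have "\<dots> \<in> swap_span"
      unfolding swap_span_def
      by (intro vec.span_sum vec.span_scale vec.span_base) blast
    finally show ?thesis .
  qed
  have "swap_span \<subseteq> {z. tensor_map T z \<in> swap_span}"
    by (subst swap_span_def, rule vec.span_minimal) (use gen S in auto)
  then have "tensor_map T (x - y) \<in> swap_span" using xy by blast
  moreover have "tensor_map T (x - y) = tensor_map T x - tensor_map T y"
  proof -
    interpret L: Vector_Spaces.linear "(*s)" "(*s)" "tensor_map T" by (fact lin)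
    show ?thesis by (rule L.diff)
  qed
  ultimately show "sym2_eq (tensor_map T x) (tensor_map T y)" by (simp add: sym2_eq_def)
qed
lemma sym2_map_tensor:
  fixes T :: "'k::field ^ 'n \<Rightarrow> 'k ^ 'n::finite"
  assumes "Vector_Spaces.linear (*s) (*s) T"
  shows "sym2_map T (abs_sym2 (tensor v w)) = abs_sym2 (tensor (T v) (T w))"
  by (simp add: sym2_map.abs_eq tensor_map_tensor[OF assms])

lemma sym2_tensor_commute: "abs_sym2 (tensor v w) = abs_sym2 (tensor w v)"
  unfolding sym2.abs_eq_iff sym2_eq_def swap_span_def by (rule vec.span_base) blast

end

theory Submission
  imports Defs
begin

text \<open>
  Write \<open>V = L(\<omega>\<^sub>1 + \<omega>\<^sub>2)\<close> and \<open>S = L(2\<omega>\<^sub>1)\<close>, and let \<open>e\<^sub>i, f\<^sub>i\<close> be root vectors for the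
  simple roots \<open>\<alpha>\<^sub>i\<close> and their negatives.

  \<^bold>\<open>Passing between group and Lie algebra.\<close> The group is generated by the root subgroups \<open>1 + t X\<close>
  with \<open>X\<close> among the \<open>e\<^sub>i, f\<^sub>i\<close> (\<open>Sp4_generated\<close>), and on a rational module \<open>1 + t X\<close> acts by a
  polynomial in \<open>t\<close> whose linear coefficient is the differential of \<open>X\<close>. On an irreducible module
  the weights are invariant under the Weyl group and bounded by the highest weight, so for \<open>V\<close> and
  \<open>S\<close> they lie in the box \<open>\<bar>a\<bar>, \<bar>b\<bar> \<le> 2\<close>, and the degree in \<open>t\<close> is at most \<open>4\<close>. As \<open>4!\<close> is invertible
  in characteristic \<open>5\<close>, the action of \<open>1 + t X\<close> is then the exponential of \<open>t X\<close>; in particular \<open>V\<close>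
  and \<open>S\<close> are irreducible under the \<open>e\<^sub>i, f\<^sub>i\<close> alone (\<open>irreducible_Lie\<close>).

  \<^bold>\<open>The two homomorphism spaces agree.\<close> A \<open>G\<close>-homomorphism can be differentiated. Conversely, let \<open>F\<close>
  commute with the \<open>e\<^sub>i, f\<^sub>i\<close>. On \<open>Sym\<^sub>2(V)\<close> the action of \<open>1 + t X\<close> may have degree above \<open>4\<close>, and \<open>F\<close>
  automatically respects only the coefficients of degree at most \<open>4\<close>. The higher coefficients occur
  only for the short root, and they are sums of vectors on which its coroot acts by \<open>\<plusminus>4\<close> or \<open>\<plusminus>6\<close>. On
  \<open>S\<close> that coroot has eigenvalues \<open>0\<close> and \<open>\<plusminus>2\<close>, which are different modulo \<open>5\<close>, so \<open>F\<close> kills these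
  terms (\<open>high_terms_vanish\<close>) and is \<open>G\<close>-equivariant.

  \<^bold>\<open>A model of \<open>V\<close>.\<close> In characteristic \<open>5\<close> the module \<open>V\<close> has dimension \<open>12\<close>: it is a Weil module, the
  odd part of \<open>k[x, y]/(x\<^sup>5, y\<^sup>5)\<close>, on which the Lie algebra acts by quadratic elements of the Weyl
  algebra, with \<open>x\<^sup>a y\<^sup>b\<close> of weight \<open>(a - 2, b - 2)\<close>. A module generated by a highest weight vector
  maps onto every irreducible module of that highest weight (\<open>hom_from_highest_weight_module\<close>). For
  the Weil module the map is bijective; applied to symmetric \<open>4 \<times> 4\<close> matrices the same lemma gives a
  map onto \<open>S\<close>.

  \<^bold>\<open>Dimension at most one.\<close> Composing \<open>F : Sym\<^sub>2(V) \<rightarrow> S\<close> with a functional supported on the highest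
  weight space of \<open>S\<close> gives a symmetric form on \<open>V\<close> of weight \<open>2\<omega>\<^sub>1\<close> annihilated by the \<open>f\<^sub>i\<close>, and \<open>F\<close>
  can be recovered from it. Such a form has only four values on pairs of monomials, and three linear
  relations leave one of them free (\<open>invariant_form_on_monomials\<close>).

  \<^bold>\<open>Dimension at least one.\<close> The Weil module carries an invariant symplectic form \<open>B\<close>, and the moment
  map sends \<open>p, q\<close> to the symmetric matrix \<open>B(z\<^sub>i z\<^sub>j p, q) + B(z\<^sub>j z\<^sub>i p, q)\<close>, where the \<open>z\<^sub>i\<close> run
  through \<open>\<partial>\<^sub>x, \<partial>\<^sub>y, x, y\<close>. It is symmetric and equivariant because \<open>[e, z\<^sub>i]\<close> is again linear in the
  \<open>z\<^sub>j\<close> (\<open>moment_equivariant\<close>).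
\<close>

section \<open>Root subgroups of the symplectic group\<close>

lemma infinite_alg_closed: "infinite (UNIV :: 'k::alg_closed_field set)"
proof
  assume fin: "finite (UNIV :: 'k set)"
  \<comment> \<open>A polynomial without roots, if the field were finite.\<close>
  define p :: "'k poly" where "p = (\<Prod>a\<in>UNIV. [:- a, 1:]) + 1"
  have "degree (\<Prod>a\<in>(UNIV::'k set). [:- a, 1:]) = card (UNIV :: 'k set)"
    by (subst degree_prod_eq_sum_degree) auto
  moreover have "card (UNIV :: 'k set) > 0" using fin by (simp add: card_gt_0_iff)
  ultimately have "degree p > 0" unfolding p_def by (subst degree_add_eq_left) auto
  then obtain x where "poly p x = 0" using alg_closed_imp_poly_has_root by blast
  moreover have "poly (\<Prod>a\<in>(UNIV::'k set). [:- a, 1:]) x = 0"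
    using fin by (simp add: poly_prod)
  ultimately show False by (simp add: p_def)
qed

text \<open>
  The principle behind every comparison of coefficients below: over an infinite field of positive
  characteristic, too, a polynomial is determined by its values.
\<close>

lemma poly_ext_infinite:
  fixes p q :: "'k::field poly"
  assumes "infinite (UNIV :: 'k set)" "\<And>t. poly p t = poly q t"
  shows "p = q"
proof (rule ccontr)
  assume "p \<noteq> q"
  then have "finite {t. poly (p - q) t = 0}" by (intro poly_roots_finite) auto
  with assms show False by simp
qed

lemma UNIV_22: "(UNIV :: (2 + 2) set) = {Inl 1, Inl 2, Inr 1, Inr 2}"
  by (auto simp: UNIV_Plus_UNIV[symmetric] UNIV_2)

lemma forall_22: "(\<forall>i :: 2 + 2. P i) \<longleftrightarrow> P (Inl 1) \<and> P (Inl 2) \<and> P (Inr 1) \<and> P (Inr 2)"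
  by (metis UNIV_22 UNIV_I insertE singletonD)

lemma sum_22: "sum f (UNIV :: (2 + 2) set) = f (Inl 1) + f (Inl 2) + f (Inr 1) + f (Inr 2)"
  by (simp add: UNIV_22 add.assoc)

definition E4 :: "2 + 2 \<Rightarrow> 2 + 2 \<Rightarrow> 'k::field mat4" where
  "E4 i j = (\<chi> a b. if a = i \<and> b = j then 1 else 0)"

text \<open>
  \<open>Short\<close> stands for \<open>\<epsilon>\<^sub>1 - \<epsilon>\<^sub>2\<close> and \<open>Long\<close> for \<open>2\<epsilon>\<^sub>2\<close>. Each of the four root vectors below has
  square zero, so \<open>1 + t X\<close> is its one-parameter group.
\<close>

datatype simple_root = Short | Long

fun e_mat :: "simple_root \<Rightarrow> 'k::field mat4" where
  "e_mat Short = E4 (Inl 1) (Inl 2) - E4 (Inr 2) (Inr 1)"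
| "e_mat Long = E4 (Inl 2) (Inr 2)"

definition f_mat :: "simple_root \<Rightarrow> 'k::field mat4" where
  "f_mat r = transpose (e_mat r)"

declare e_mat.simps [simp del]

lemma f_mat_simps:
  "f_mat Short = E4 (Inl 2) (Inl 1) - E4 (Inr 1) (Inr 2)"
  "f_mat Long = E4 (Inr 2) (Inl 2)"
  by (auto simp: f_mat_def e_mat.simps E4_def transpose_def vec_eq_iff)

text \<open>
  This is literally the line along which \<^const>\<open>deriv_at_one\<close> differentiates, so that root subgroups
  compute differentials.
\<close>

definition unip :: "'k::field mat4 \<Rightarrow> 'k \<Rightarrow> 'k mat4" where
  "unip X t = (\<chi> i j. mat 1 $ i $ j + t * X $ i $ j)"

definition simple_mats :: "'k::field mat4 set" where
  "simple_mats = range e_mat \<union> range f_mat"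

lemma simple_mats_cases [consumes 1]:
  assumes "X \<in> simple_mats"
  obtains "X = e_mat Short" | "X = e_mat Long" | "X = f_mat Short" | "X = f_mat Long"
proof -
  from assms consider r where "X = e_mat r" | r where "X = f_mat r"
    unfolding simple_mats_def by blast
  then show thesis by (metis (full_types) that simple_root.exhaust)
qed

lemma Sp4_iff:
  "M \<in> Sp4 \<longleftrightarrow>
     (\<forall>i j. (\<Sum>k\<in>UNIV. M $ Inl k $ Inl i * M $ Inr k $ Inl j - M $ Inr k $ Inl i * M $ Inl k $ Inl j) = 0)
   \<and> (\<forall>i j. (\<Sum>k\<in>UNIV. M $ Inl k $ Inl i * M $ Inr k $ Inr j - M $ Inr k $ Inl i * M $ Inl k $ Inr j)
          = (if i = j then 1 else 0))
   \<and> (\<forall>i j. (\<Sum>k\<in>UNIV. M $ Inl k $ Inr i * M $ Inr k $ Inr j - M $ Inr k $ Inr i * M $ Inl k $ Inr j) = 0)"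
  unfolding Sp4_def
  by (simp add: Let_def vec_eq_iff matrix_matrix_mult_def transpose_def mat_def sum_subtractf)

definition J4 :: "'k::field mat4" where
  "J4 = (\<chi> i j. case (i, j) of (Inl a, Inr b) \<Rightarrow> if a = b then 1 else 0
             | (Inr a, Inl b) \<Rightarrow> if a = b then -1 else 0 | _ \<Rightarrow> 0)"

text \<open>
  The three block conditions say that the columns of \<open>M\<close> pair like the standard symplectic basis; the
  fourth block follows from them by antisymmetry.
\<close>

lemma Sp4_iff_entries:
  "M \<in> Sp4 \<longleftrightarrow>
     (\<forall>i j. M $ Inl 1 $ i * M $ Inr 1 $ j - M $ Inr 1 $ i * M $ Inl 1 $ j
          + (M $ Inl 2 $ i * M $ Inr 2 $ j - M $ Inr 2 $ i * M $ Inl 2 $ j) = J4 $ i $ j)"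
proof -
  define w where "w i j = M $ Inl 1 $ i * M $ Inr 1 $ j - M $ Inr 1 $ i * M $ Inl 1 $ j
          + (M $ Inl 2 $ i * M $ Inr 2 $ j - M $ Inr 2 $ i * M $ Inl 2 $ j)" for i j
  have swap: "w i j = - w j i" for i j by (simp add: w_def)
  have "M \<in> Sp4 \<longleftrightarrow> (\<forall>a b. w (Inl a) (Inl b) = 0)
      \<and> (\<forall>a b. w (Inl a) (Inr b) = (if a = b then 1 else 0)) \<and> (\<forall>a b. w (Inr a) (Inr b) = 0)"
    unfolding Sp4_iff sum_2 w_def ..
  moreover have "w (Inr a) (Inl b) = (if a = b then -1 else 0)"
    if "\<forall>a b. w (Inl a) (Inr b) = (if a = b then 1 else 0)" for a b
    using that swap[of "Inr a" "Inl b"] by auto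
  ultimately have "M \<in> Sp4 \<longleftrightarrow> (\<forall>i j. w i j = J4 $ i $ j)"
    by (auto simp: split_sum_all J4_def)
  then show ?thesis unfolding w_def .
qed

lemma Sp4_iff_J: "M \<in> Sp4 \<longleftrightarrow> transpose M ** J4 ** M = J4"
proof -
  have entry: "(transpose M ** J4 ** M) $ i $ j =
      M $ Inl 1 $ i * M $ Inr 1 $ j - M $ Inr 1 $ i * M $ Inl 1 $ j
          + (M $ Inl 2 $ i * M $ Inr 2 $ j - M $ Inr 2 $ i * M $ Inl 2 $ j)" for i j
    by (simp add: matrix_matrix_mult_def transpose_def sum_22 J4_def)
  have "transpose M ** J4 ** M = J4 \<longleftrightarrow> (\<forall>i j. (transpose M ** J4 ** M) $ i $ j = J4 $ i $ j)"
    unfolding vec_eq_iff ..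
  then show ?thesis unfolding entry Sp4_iff_entries by (rule sym)
qed

lemma E4_nth: "E4 i j $ a $ b = (if a = i \<and> b = j then 1 else 0)"
  by (simp add: E4_def)

lemma unip_nth: "unip X t $ a $ b = (if a = b then 1 else 0) + t * X $ a $ b"
  by (simp add: unip_def mat_def)

lemma mult_nth: "(A ** B) $ i $ j = A $ i $ Inl 1 * B $ Inl 1 $ j + A $ i $ Inl 2 * B $ Inl 2 $ j
   + A $ i $ Inr 1 * B $ Inr 1 $ j + A $ i $ Inr 2 * B $ Inr 2 $ j" for A B :: "'k::field mat4"
  by (simp add: matrix_matrix_mult_def sum_22)

lemma mat4_eq_iff: "A = B \<longleftrightarrow> (\<forall>i j. A $ i $ j = B $ i $ j)" for A B :: "'k::field mat4"
  unfolding vec_eq_iff ..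

lemmas root_mats_nth = unip_nth E4_nth e_mat.simps f_mat_simps

lemmas mat4_simps = mat4_eq_iff mult_nth forall_22 root_mats_nth

lemma unip_Sp4: "X \<in> simple_mats \<Longrightarrow> unip X t \<in> Sp4"
  by (cases X rule: simple_mats_cases) (simp_all add: Sp4_iff forall_2 sum_2 root_mats_nth)

lemma unip_0 [simp]: "unip X 0 = mat 1"
  by (simp add: unip_def vec_eq_iff)

lemma unip_add: "X \<in> simple_mats \<Longrightarrow> unip X t ** unip X s = unip X (t + s)"
  by (cases X rule: simple_mats_cases) (simp_all add: mat4_simps algebra_simps)

text \<open>
  The difference of two distinct simple roots is not a root.
\<close>

lemma unip_commute:
  "i \<noteq> j \<Longrightarrow> unip (e_mat i) t ** unip (f_mat j) s = unip (f_mat j) s ** unip (e_mat i) t"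
  by (cases i; cases j) (simp_all add: mat4_simps algebra_simps)

lemma Sp4_mult: assumes "g \<in> Sp4" "h \<in> Sp4" shows "g ** h \<in> Sp4"
proof -
  have "transpose (g ** h) ** J4 ** (g ** h) = transpose h ** (transpose g ** J4 ** g) ** h"
    by (simp add: matrix_transpose_mul matrix_mul_assoc)
  then show ?thesis using assms by (simp add: Sp4_iff_J)
qed

section \<open>Generation by root subgroups\<close>

inductive_set gen :: "'k::field mat4 set" where
  one: "mat 1 \<in> gen"
| step: "X \<in> simple_mats \<Longrightarrow> g \<in> gen \<Longrightarrow> unip X t ** g \<in> gen"

lemma simple_mats_mem [simp]: "e_mat r \<in> simple_mats" "f_mat r \<in> simple_mats"
  by (auto simp: simple_mats_def)

lemma gen_iff: assumes "X \<in> simple_mats" shows "unip X t ** g \<in> gen \<longleftrightarrow> g \<in> gen"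
proof
  assume "unip X t ** g \<in> gen"
  then have "unip X (- t) ** (unip X t ** g) \<in> gen" using gen.step[OF assms] by blast
  also have "unip X (- t) ** (unip X t ** g) = g"
    by (simp add: matrix_mul_assoc unip_add assms)
  finally show "g \<in> gen" .
qed (use assms gen.step in blast)

text \<open>
  Left multiplication by a root element is a row operation; by \<open>gen_iff\<close> such operations do not affect
  membership in \<^const>\<open>gen\<close>, so elimination may be carried out freely.
\<close>

lemma row_op:
  "(unip (e_mat Short) t ** g) $ Inl 1 $ j = g $ Inl 1 $ j + t * g $ Inl 2 $ j"
  "(unip (e_mat Short) t ** g) $ Inl 2 $ j = g $ Inl 2 $ j"
  "(unip (e_mat Short) t ** g) $ Inr 1 $ j = g $ Inr 1 $ j"
  "(unip (e_mat Short) t ** g) $ Inr 2 $ j = g $ Inr 2 $ j - t * g $ Inr 1 $ j"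
  "(unip (e_mat Long) t ** g) $ Inl 1 $ j = g $ Inl 1 $ j"
  "(unip (e_mat Long) t ** g) $ Inl 2 $ j = g $ Inl 2 $ j + t * g $ Inr 2 $ j"
  "(unip (e_mat Long) t ** g) $ Inr 1 $ j = g $ Inr 1 $ j"
  "(unip (e_mat Long) t ** g) $ Inr 2 $ j = g $ Inr 2 $ j"
  "(unip (f_mat Short) t ** g) $ Inl 1 $ j = g $ Inl 1 $ j"
  "(unip (f_mat Short) t ** g) $ Inl 2 $ j = g $ Inl 2 $ j + t * g $ Inl 1 $ j"
  "(unip (f_mat Short) t ** g) $ Inr 1 $ j = g $ Inr 1 $ j - t * g $ Inr 2 $ j"
  "(unip (f_mat Short) t ** g) $ Inr 2 $ j = g $ Inr 2 $ j"
  "(unip (f_mat Long) t ** g) $ Inl 1 $ j = g $ Inl 1 $ j"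
  "(unip (f_mat Long) t ** g) $ Inl 2 $ j = g $ Inl 2 $ j"
  "(unip (f_mat Long) t ** g) $ Inr 1 $ j = g $ Inr 1 $ j"
  "(unip (f_mat Long) t ** g) $ Inr 2 $ j = g $ Inr 2 $ j + t * g $ Inl 2 $ j"
  for g :: "'k::field mat4"
  by (simp_all add: mult_nth root_mats_nth)

lemma symplectic_columns:
  assumes "M \<in> Sp4"
  shows "M $ Inl 1 $ i * M $ Inr 1 $ j - M $ Inr 1 $ i * M $ Inl 1 $ j
          + (M $ Inl 2 $ i * M $ Inr 2 $ j - M $ Inr 2 $ i * M $ Inl 2 $ j) = J4 $ i $ j"
  using assms Sp4_iff_entries by blast

lemma J4_nth:
  "J4 $ Inl a $ Inl b = 0" "J4 $ Inl a $ Inr b = (if a = b then 1 else 0)"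
  "J4 $ Inr a $ Inl b = (if a = b then -1 else 0)" "J4 $ Inr a $ Inr b = 0"
  by (simp_all add: J4_def)

text \<open>
  The last stage of the elimination: \<open>g\<close> lies in the unipotent radical of the stabiliser of the first
  basis vector.
\<close>

lemma gen_of_unipotent_radical:
  assumes two: "(2::'k::field) \<noteq> 0" and g: "g \<in> (Sp4 :: 'k mat4 set)"
    and c1: "g $ Inl 1 $ Inl 1 = 1" "g $ Inl 2 $ Inl 1 = 0" "g $ Inr 1 $ Inl 1 = 0" "g $ Inr 2 $ Inl 1 = 0"
    and c2: "g $ Inl 2 $ Inl 2 = 1" "g $ Inr 2 $ Inl 2 = 0" and c4: "g $ Inl 2 $ Inr 2 = 0" "g $ Inr 2 $ Inr 2 = 1"
  shows "g \<in> gen"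
proof -
  note w = symplectic_columns[OF g]
  define p q r where "p = g $ Inl 1 $ Inl 2" and "q = g $ Inl 1 $ Inr 1 - p * g $ Inl 2 $ Inr 1"
    and "r = g $ Inl 1 $ Inr 2"
  have r1: "g $ Inr 1 $ Inl 2 = 0" "g $ Inr 1 $ Inr 1 = 1" "g $ Inr 1 $ Inr 2 = 0"
    using w[of "Inl 1" "Inl 2"] w[of "Inl 1" "Inr 1"] w[of "Inl 1" "Inr 2"] by (simp_all add: c1 J4_nth)
  have c3: "g $ Inr 2 $ Inr 1 = - p" "g $ Inl 2 $ Inr 1 = r"
    using w[of "Inl 2" "Inr 1"] w[of "Inr 1" "Inr 2"]
    by (simp_all add: c2 c4 r1 J4_nth p_def r_def eq_neg_iff_add_eq_0 algebra_simps)
  let ?e1 = "unip (e_mat Short)" and ?e2 = "unip (e_mat Long)"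
  have four: "(4::'k) \<noteq> 0"
    using two by (metis mult_2_right mult_eq_0_iff numeral_Bit0)
  define s1 s2 where "s1 = - (q + r) / 2" and "s2 = (r - q) / 2"
  have s: "q = - s1 - s2" "r = s2 - s1" using two four by (simp_all add: s1_def s2_def field_simps)
  have b1: "g $ Inl 1 $ Inr 1 = q + p * r" by (simp add: q_def c3)
  \<comment> \<open>The symmetric block \<open>(q, r; r, 0)\<close> is a combination of squares of \<open>(1, 1)\<close>, \<open>(-1, 1)\<close> and
    \<open>(0, 1)\<close>, each of which is the block of a conjugate of a long root element.\<close>
  have "?e1 1 ** (?e2 s1 ** (?e1 (- 1) ** (?e1 (- 1) ** (?e2 s2 ** (?e1 1 ** (?e2 q ** (?e1 (- p) ** g)))))))
      = mat 1"
    unfolding mat4_eq_iff forall_22 row_op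
    by (simp add: c1 c2 c3 c4 r1 b1 p_def[symmetric] r_def[symmetric]) (simp add: mat_def s algebra_simps)
  then have "?e1 1 ** (?e2 s1 ** (?e1 (- 1) ** (?e1 (- 1) ** (?e2 s2 ** (?e1 1 ** (?e2 q ** (?e1 (- p) ** g)))))))
      \<in> gen"
    using gen.one by simp
  then show ?thesis by (simp only: gen_iff simple_mats_mem)
qed

text \<open>
  The middle block is a \<open>2 \<times> 2\<close> matrix of determinant \<open>1\<close>, which the two long root subgroups reduce to
  the identity.
\<close>

lemma gen_of_first_column:
  assumes two: "(2::'k::field) \<noteq> 0" and g: "g \<in> (Sp4 :: 'k mat4 set)"
    and c1: "g $ Inl 1 $ Inl 1 = 1" "g $ Inl 2 $ Inl 1 = 0" "g $ Inr 1 $ Inl 1 = 0" "g $ Inr 2 $ Inl 1 = 0"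
  shows "g \<in> gen"
proof -
  let ?e2 = "unip (e_mat Long)" and ?f2 = "unip (f_mat Long)"
  have nz: "h \<in> gen" if h: "h \<in> (Sp4 :: 'k mat4 set)"
    "h $ Inl 1 $ Inl 1 = 1" "h $ Inl 2 $ Inl 1 = 0" "h $ Inr 1 $ Inl 1 = 0" "h $ Inr 2 $ Inl 1 = 0"
    and c: "h $ Inr 2 $ Inl 2 \<noteq> 0" for h
  proof -
    define t where "t = (1 - h $ Inl 2 $ Inl 2) / h $ Inr 2 $ Inl 2"
    define k where "k = ?f2 (- h $ Inr 2 $ Inl 2) ** (?e2 t ** h)"
    have k: "k \<in> Sp4" unfolding k_def by (intro Sp4_mult unip_Sp4 h simple_mats_mem)
    have k1: "k $ Inl 1 $ Inl 1 = 1" "k $ Inl 2 $ Inl 1 = 0" "k $ Inr 1 $ Inl 1 = 0" "k $ Inr 2 $ Inl 1 = 0"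
      "k $ Inl 2 $ Inl 2 = 1" "k $ Inr 2 $ Inl 2 = 0"
      using h(2-5) c by (simp_all add: k_def row_op t_def)
    have k2: "k $ Inr 1 $ Inl 2 = 0" "k $ Inr 1 $ Inr 2 = 0"
      using symplectic_columns[OF k, of "Inl 1" "Inl 2"] symplectic_columns[OF k, of "Inl 1" "Inr 2"]
      by (simp_all add: k1 J4_nth)
    have k3: "k $ Inr 2 $ Inr 2 = 1"
      using symplectic_columns[OF k, of "Inl 2" "Inr 2"] by (simp add: k1 k2 J4_nth)
    have "?e2 (- k $ Inl 2 $ Inr 2) ** k \<in> gen"
      by (rule gen_of_unipotent_radical[OF two])
         (auto intro!: Sp4_mult unip_Sp4 k simp: row_op k1 k3)
    then show ?thesis unfolding k_def by (simp only: gen_iff simple_mats_mem)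
  qed
  show ?thesis
  proof (cases "g $ Inr 2 $ Inl 2 = 0")
    case True
    have "g $ Inr 1 $ Inl 2 = 0" "g $ Inr 1 $ Inr 2 = 0"
      using symplectic_columns[OF g, of "Inl 1" "Inl 2"] symplectic_columns[OF g, of "Inl 1" "Inr 2"]
      by (simp_all add: c1 J4_nth)
    then have "g $ Inl 2 $ Inl 2 \<noteq> 0"
      using symplectic_columns[OF g, of "Inl 2" "Inr 2"] True by (auto simp: J4_nth)
    then have "?f2 1 ** g \<in> gen"
      by (intro nz Sp4_mult unip_Sp4 g simple_mats_mem) (simp_all add: row_op c1 True)
    then show ?thesis by (simp only: gen_iff simple_mats_mem)
  qed (use nz g c1 in blast)
qed

text \<open>
  The lower half \<open>(u, v)\<close> of the first column is cleared by conjugates of the negative long root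
  subgroup, which add multiples of \<open>(1, 1)\<close> and of \<open>(1, -1)\<close> to it.
\<close>

lemma gen_of_leading_one:
  assumes two: "(2::'k::field) \<noteq> 0" and g: "g \<in> (Sp4 :: 'k mat4 set)" and c1: "g $ Inl 1 $ Inl 1 = 1"
  shows "g \<in> gen"
proof -
  let ?f1 = "unip (f_mat Short)" and ?f2 = "unip (f_mat Long)"
  define h where "h = ?f1 (- g $ Inl 2 $ Inl 1) ** g"
  have h: "h \<in> Sp4" "h $ Inl 1 $ Inl 1 = 1" "h $ Inl 2 $ Inl 1 = 0"
    unfolding h_def by (auto intro!: Sp4_mult unip_Sp4 g simp: row_op c1)
  define u v where "u = h $ Inr 1 $ Inl 1" and "v = h $ Inr 2 $ Inl 1"
  have four: "(4::'k) \<noteq> 0"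
    using two by (metis mult_2_right mult_eq_0_iff numeral_Bit0)
  define s1 s2 where "s1 = - (u + v) / 2" and "s2 = (v - u) / 2"
  have s: "u = - s1 - s2" "v = s2 - s1" using two four by (simp_all add: s1_def s2_def field_simps)
  have "?f1 (- 1) ** (?f2 s1 ** (?f1 1 ** (?f1 1 ** (?f2 s2 ** (?f1 (- 1) ** h))))) \<in> gen"
    by (rule gen_of_first_column[OF two])
       (auto intro!: Sp4_mult unip_Sp4 h(1) simp: row_op h(2,3) u_def[symmetric] v_def[symmetric] s)
  then show ?thesis unfolding h_def by (simp only: gen_iff simple_mats_mem)
qed

text \<open>
  A nonzero second entry of the first column makes it possible to turn the first entry into \<open>1\<close>, and a
  nonzero entry anywhere in that column can be moved to the second place.
\<close>

theorem Sp4_generated: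
  assumes two: "(2::'k::field) \<noteq> 0" and g: "g \<in> (Sp4 :: 'k mat4 set)"
  shows "g \<in> gen"
proof -
  let ?e1 = "unip (e_mat Short)" and ?e2 = "unip (e_mat Long)" and ?f1 = "unip (f_mat Short)"
  have A: "h \<in> gen" if h: "h \<in> (Sp4 :: 'k mat4 set)" and "h $ Inl 2 $ Inl 1 \<noteq> 0" for h
  proof -
    have "?e1 ((1 - h $ Inl 1 $ Inl 1) / h $ Inl 2 $ Inl 1) ** h \<in> gen"
      by (rule gen_of_leading_one[OF two]) (auto intro!: Sp4_mult unip_Sp4 h simp: row_op that)
    then show ?thesis by (simp only: gen_iff simple_mats_mem)
  qed
  have B: "h \<in> gen" if h: "h \<in> (Sp4 :: 'k mat4 set)" and "h $ Inr 2 $ Inl 1 \<noteq> 0" for h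
  proof (cases "h $ Inl 2 $ Inl 1 = 0")
    case True
    have "?e2 1 ** h \<in> gen"
      by (rule A) (auto intro!: Sp4_mult unip_Sp4 h simp: row_op that True)
    then show ?thesis by (simp only: gen_iff simple_mats_mem)
  qed (use A h in blast)
  have "\<not> (g $ Inl 2 $ Inl 1 = 0 \<and> g $ Inr 2 $ Inl 1 = 0 \<and> g $ Inl 1 $ Inl 1 = 0 \<and> g $ Inr 1 $ Inl 1 = 0)"
    using symplectic_columns[OF g, of "Inl 1" "Inr 1"] by (auto simp: J4_nth)
  then consider "g $ Inl 2 $ Inl 1 \<noteq> 0" | "g $ Inr 2 $ Inl 1 \<noteq> 0"
    | "g $ Inl 2 $ Inl 1 = 0" "g $ Inr 2 $ Inl 1 = 0" "g $ Inl 1 $ Inl 1 \<noteq> 0"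
    | "g $ Inl 2 $ Inl 1 = 0" "g $ Inr 2 $ Inl 1 = 0" "g $ Inr 1 $ Inl 1 \<noteq> 0"
    by blast
  then show ?thesis
  proof cases
    case 3
    then have "?f1 1 ** g \<in> gen" by (intro A) (auto intro!: Sp4_mult unip_Sp4 g simp: row_op)
    then show ?thesis by (simp only: gen_iff simple_mats_mem)
  next
    case 4
    then have "?e1 1 ** g \<in> gen" by (intro B) (auto intro!: Sp4_mult unip_Sp4 g simp: row_op)
    then show ?thesis by (simp only: gen_iff simple_mats_mem)
  qed (use A B g in blast)+
qed

section \<open>Torus, Weyl group and coroots\<close>

lemma torus_nth:
  "torus_elt t1 t2 $ Inl 1 $ j = (if j = Inl 1 then t1 else 0)"
  "torus_elt t1 t2 $ Inl 2 $ j = (if j = Inl 2 then t2 else 0)"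
  "torus_elt t1 t2 $ Inr 1 $ j = (if j = Inr 1 then inverse t1 else 0)"
  "torus_elt t1 t2 $ Inr 2 $ j = (if j = Inr 2 then inverse t2 else 0)"
  by (auto simp: torus_elt_def)

lemma torus_Sp4: "t1 \<noteq> 0 \<Longrightarrow> t2 \<noteq> 0 \<Longrightarrow> torus_elt t1 t2 \<in> Sp4"
  by (simp add: Sp4_iff forall_2 sum_2 torus_nth)

fun alpha :: "simple_root \<Rightarrow> weight" where
  "alpha Short = eps1 - eps2"
| "alpha Long = 2 *s eps2"

lemma root_nth [simp]:
  "alpha Short $ 1 = 1" "alpha Short $ 2 = -1" "alpha Long $ 1 = 0" "alpha Long $ 2 = 2"
  by (simp_all add: eps1_def eps2_def axis_def)

declare alpha.simps [simp del]

text \<open>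
  The torus scales the root subgroup of \<open>X\<close> through the character \<open>\<alpha>\<close>, which is why its divided
  powers shift weights by multiples of \<open>\<alpha>\<close>.
\<close>

definition root_vector :: "'k::field mat4 \<Rightarrow> weight \<Rightarrow> bool" where
  "root_vector X \<alpha> \<longleftrightarrow> X \<in> simple_mats \<and> (\<forall>t1 t2 t. t1 \<noteq> 0 \<longrightarrow> t2 \<noteq> 0 \<longrightarrow>
     torus_elt t1 t2 ** unip X t = unip X (char_at \<alpha> t1 t2 * t) ** torus_elt t1 t2)"

lemma root_vector_e: "root_vector (e_mat r) (alpha r)"
  unfolding root_vector_def
  by (cases r; intro conjI allI impI simple_mats_mem)
     (simp_all add: mat4_simps torus_nth char_at_def power_int_minus power2_eq_square field_simps)

lemma root_vector_f: "root_vector (f_mat r) (- alpha r)"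
  unfolding root_vector_def
  by (cases r; intro conjI allI impI simple_mats_mem)
     (simp_all add: mat4_simps torus_nth char_at_def power_int_minus power2_eq_square field_simps)

text \<open>
  Representatives of the reflections in the short and in the long simple root. They make the set of
  weights of a module invariant under the Weyl group.
\<close>

definition swap_mat :: "'k::field mat4" where
  "swap_mat = E4 (Inl 1) (Inl 2) + E4 (Inl 2) (Inl 1) + E4 (Inr 1) (Inr 2) + E4 (Inr 2) (Inr 1)"

definition flip_mat :: "'k::field mat4" where
  "flip_mat = E4 (Inl 1) (Inl 1) + E4 (Inr 1) (Inr 1) + E4 (Inl 2) (Inr 2) - E4 (Inr 2) (Inl 2)"

lemma swap_flip_Sp4: "swap_mat \<in> Sp4" "flip_mat \<in> Sp4"
  by (simp_all add: Sp4_iff forall_2 sum_2 swap_mat_def flip_mat_def E4_nth)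

lemma torus_swap: "torus_elt t1 t2 ** swap_mat = swap_mat ** torus_elt t2 t1"
  by (simp add: mat4_simps torus_nth swap_mat_def)

lemma torus_flip: "torus_elt t1 t2 ** flip_mat = flip_mat ** torus_elt t1 (inverse t2)"
  by (simp add: mat4_simps torus_nth flip_mat_def)

text \<open>
  The coroots as one-parameter subgroups of the torus.
\<close>

fun coroot_elt :: "simple_root \<Rightarrow> 'k::field \<Rightarrow> 'k mat4" where
  "coroot_elt Short u = torus_elt u (inverse u)"
| "coroot_elt Long u = torus_elt 1 u"

fun pairing :: "weight \<Rightarrow> simple_root \<Rightarrow> int" where
  "pairing \<mu> Short = \<mu> $ 1 - \<mu> $ 2"
| "pairing \<mu> Long = \<mu> $ 2"

text \<open>
  The factorisation \<open>(1, t; 0, 1)(1, 0; s, 1) = (1, 0; s/u, 1)(u, 0; 0, 1/u)(1, t/u; 0, 1)\<close> in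
  \<open>SL\<^sub>2\<close>, with \<open>u = 1 + t s\<close>. Its coefficient of \<open>t s\<close> is the relation \<open>[e, f] = h\<close>.
\<close>

lemma unip_e_f:
  assumes ts: "t * s = u - 1" and u: "u \<noteq> 0"
  shows "unip (e_mat r) t ** unip (f_mat r) s
    = unip (f_mat r) (s / u) ** (coroot_elt r u ** unip (e_mat r) (t / u))"
proof -
  define v where "v = inverse u"
  have v: "u * v = 1" "inverse u = v" "s / u = s * v" "t / u = t * v" "inverse v = u"
    using u by (simp_all add: v_def field_simps)
  have k: "1 + t * s = u" "s * v * (u * (t * v)) + v = 1" "v + s * v * (u * (t * v)) = 1" "v * u = 1"
    using ts v(1) by algebra+
  show ?thesis unfolding v(3,4)
    by (cases r) (simp_all add: mat4_simps torus_nth v(1,2,5) k)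
qed

section \<open>Divided powers on rational modules\<close>

lemma vec_poly_eq:
  fixes a b :: "nat \<Rightarrow> 'k::alg_closed_field ^ 'n"
  assumes "\<And>t. (\<Sum>n\<le>N. t ^ n *s a n) = (\<Sum>n\<le>N. t ^ n *s b n)" and "n \<le> N"
  shows "a n = b n"
proof (rule vec_eq_iff[THEN iffD2], rule)
  fix i
  have "(\<Sum>n\<le>N. monom (a n $ i) n) = (\<Sum>n\<le>N. monom (b n $ i) n)"
  proof (rule poly_ext_infinite[OF infinite_alg_closed])
    fix t
    show "poly (\<Sum>n\<le>N. monom (a n $ i) n) t = poly (\<Sum>n\<le>N. monom (b n $ i) n) t"
      using arg_cong[OF assms(1)[of t], of "\<lambda>x. x $ i"] by (simp add: poly_sum poly_monom mult.commute)
  qed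
  from arg_cong[OF this, of "\<lambda>p. coeff p n"] show "a n $ i = b n $ i"
    using assms(2) by (simp add: coeff_sum if_distrib cong: if_cong)
qed

lemma polyfun_on_line:
  assumes "polyfun f" shows "\<exists>p. \<forall>t. poly p t = f (unip X t)"
  using assms
proof induction
  case (const c) show ?case by (rule exI[of _ "[:c:]"]) simp
next
  case (entry i j)
  show ?case by (rule exI[of _ "[: mat 1 $ i $ j, X $ i $ j :]"]) (simp add: unip_def)
next
  case (add f g) then show ?case by (metis poly_add)
next
  case (mult f g) then show ?case by (metis poly_mult)
qed

text \<open>
  The coefficient of \<open>t\<^sup>n\<close> in the action of \<open>1 + t X\<close>, that is, the divided power \<open>X\<^sup>n / n!\<close>. It makes
  sense in every characteristic, since rationality turns each coordinate into a polynomial in \<open>t\<close>.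
\<close>

definition divpow :: "('k::field mat4 \<Rightarrow> 'k ^ 'n \<Rightarrow> 'k ^ 'm) \<Rightarrow> 'k mat4 \<Rightarrow> nat \<Rightarrow> 'k ^ 'n \<Rightarrow> 'k ^ 'm" where
  "divpow \<rho> X n v = (\<chi> i. coeff (THE p. \<forall>t. poly p t = \<rho> (unip X t) v $ i) n)"

lemma linear_component: "Vector_Spaces.linear (*s) (*) (\<lambda>v :: 'k::field ^ 'n. v $ i)"
  by unfold_locales (simp_all add: algebra_simps)

locale rational_rep =
  fixes \<rho> :: "('k::alg_closed_field) mat4 \<Rightarrow> 'k ^ 'n \<Rightarrow> 'k ^ 'n::finite"
  assumes rational: "rational_module (*s) \<rho>"
begin

lemma linear_rho: "g \<in> Sp4 \<Longrightarrow> Vector_Spaces.linear (*s) (*s) (\<rho> g)"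
  using rational by (simp add: rational_module_def)

lemma rho_add: "g \<in> Sp4 \<Longrightarrow> \<rho> g (v + w) = \<rho> g v + \<rho> g w"
  using linear_rho by (metis Vector_Spaces.linear_iff)

lemma rho_scale: "g \<in> Sp4 \<Longrightarrow> \<rho> g (c *s v) = c *s \<rho> g v"
  using linear_rho by (metis Vector_Spaces.linear_iff)

lemma rho_mult: "g \<in> Sp4 \<Longrightarrow> h \<in> Sp4 \<Longrightarrow> \<rho> (g ** h) v = \<rho> g (\<rho> h v)"
  using rational by (simp add: rational_module_def)

lemma rho_one: "\<rho> (mat 1) v = v"
  using rational by (simp add: rational_module_def)

abbreviation curve :: "'k mat4 \<Rightarrow> 'k ^ 'n \<Rightarrow> 'n \<Rightarrow> 'k poly" where
  "curve X v i \<equiv> (THE p. \<forall>t. poly p t = \<rho> (unip X t) v $ i)"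

lemma curve_eqI:
  assumes "\<And>t. poly p t = \<rho> (unip X t) v $ i" shows "curve X v i = p"
  by (rule the_equality) (use assms in \<open>auto intro!: poly_ext_infinite[OF infinite_alg_closed]\<close>)

lemma poly_curve:
  assumes "X \<in> simple_mats" shows "poly (curve X v i) t = \<rho> (unip X t) v $ i"
proof -
  from rational linear_component[of i] obtain f where f: "polyfun f" "\<And>g. g \<in> Sp4 \<Longrightarrow> \<rho> g v $ i = f g"
    unfolding rational_module_def by blast
  obtain p where "\<And>t. poly p t = f (unip X t)"
    using polyfun_on_line[OF f(1)] by blast
  then have "\<And>t. poly p t = \<rho> (unip X t) v $ i" by (simp add: f(2) unip_Sp4[OF assms])
  with curve_eqI[OF this] show ?thesis by simp
qed

abbreviation dp :: "'k mat4 \<Rightarrow> nat \<Rightarrow> 'k ^ 'n \<Rightarrow> 'k ^ 'n" where "dp \<equiv> divpow \<rho>"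

lemma dp_nth: "dp X n v $ i = coeff (curve X v i) n"
  by (simp add: divpow_def)

lemma dp_expand:
  assumes "X \<in> simple_mats"
  shows "\<exists>N. (\<forall>n>N. dp X n v = 0) \<and> (\<forall>M\<ge>N. \<forall>t. \<rho> (unip X t) v = (\<Sum>n\<le>M. t ^ n *s dp X n v))"
proof -
  define N where "N = Max (range (\<lambda>i. degree (curve X v i)))"
  have deg: "degree (curve X v i) \<le> N" for i unfolding N_def by (rule Max_ge) auto
  have "\<rho> (unip X t) v $ i = (\<Sum>n\<le>M. t ^ n *s dp X n v) $ i" if "N \<le> M" for M t i
  proof -
    have "\<rho> (unip X t) v $ i = poly (curve X v i) t" by (simp add: poly_curve assms)
    also have "\<dots> = (\<Sum>n\<le>M. coeff (curve X v i) n * t ^ n)"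
      using arg_cong[OF poly_as_sum_of_monoms'[OF le_trans[OF deg that]], of "\<lambda>p. poly p t"]
      by (simp add: poly_sum poly_monom)
    finally show ?thesis by (simp add: dp_nth mult.commute)
  qed
  moreover have "dp X n v = 0" if "N < n" for n
    using coeff_eq_0[OF le_less_trans[OF deg that]] by (simp add: vec_eq_iff dp_nth)
  ultimately show ?thesis by (metis vec_eq_iff)
qed

lemma linear_dp: assumes X: "X \<in> simple_mats" shows "Vector_Spaces.linear (*s) (*s) (dp X n)"
proof -
  have "curve X (v + w) i = curve X v i + curve X w i" for v w i
    by (rule curve_eqI) (simp add: poly_curve X rho_add unip_Sp4)
  moreover have "curve X (c *s v) i = smult c (curve X v i)" for c v i
    by (rule curve_eqI) (simp add: poly_curve X rho_scale unip_Sp4)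
  ultimately show ?thesis
    by unfold_locales (simp_all add: vec_eq_iff dp_nth algebra_simps)
qed

text \<open>
  Coefficient extraction for maps that permute root elements of one root: conjugation by the torus gives
  the weights of divided powers, and commuting root subgroups give commuting divided powers.
\<close>

lemma dp_intertwine:
  fixes h :: "'k ^ 'n \<Rightarrow> 'k ^ 'n"
  assumes X: "X \<in> simple_mats" and h: "Vector_Spaces.linear (*s) (*s) h"
    and eq: "\<And>t. h (\<rho> (unip X t) v) = \<rho> (unip X (c * t)) w"
  shows "h (dp X n v) = c ^ n *s dp X n w"
proof -
  interpret h: Vector_Spaces.linear "(*s)" "(*s)" h by (fact h)
  obtain N1 where N1: "\<And>M t. M \<ge> N1 \<Longrightarrow> \<rho> (unip X t) v = (\<Sum>n\<le>M. t ^ n *s dp X n v)"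
    using dp_expand[OF X, of v] by blast
  obtain N2 where N2: "\<And>M t. M \<ge> N2 \<Longrightarrow> \<rho> (unip X t) w = (\<Sum>n\<le>M. t ^ n *s dp X n w)"
    using dp_expand[OF X, of w] by blast
  define M where "M = max n (max N1 N2)"
  have M: "M \<ge> N1" "M \<ge> N2" "n \<le> M" by (auto simp: M_def)
  show ?thesis
  proof (rule vec_poly_eq[OF _ M(3), where b = "\<lambda>n. c ^ n *s dp X n w" and a = "\<lambda>n. h (dp X n v)"])
    fix t
    show "(\<Sum>n\<le>M. t ^ n *s h (dp X n v)) = (\<Sum>n\<le>M. t ^ n *s (c ^ n *s dp X n w))"
      using eq[of t] unfolding N1[OF M(1)] N2[OF M(2)]
      by (simp add: h.sum h.scale power_mult_distrib mult.commute)
  qed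
qed

lemma dp_0: assumes X: "X \<in> simple_mats" shows "dp X 0 v = v"
proof (rule vec_eq_iff[THEN iffD2], rule)
  fix i show "dp X 0 v $ i = v $ i"
    using poly_curve[OF X, of v i 0] by (simp add: dp_nth poly_0_coeff_0 rho_one)
qed

text \<open>
  The coefficient of \<open>t\<close> in \<open>(1 + t X)(1 + s X) = 1 + (s + t) X\<close> is a derivative in \<open>s\<close>.
\<close>

lemma dp_1_dp: assumes X: "X \<in> simple_mats" shows "dp X 1 (dp X n v) = of_nat (Suc n) *s dp X (Suc n) v"
proof (rule vec_eq_iff[THEN iffD2], rule)
  fix i
  interpret h: Vector_Spaces.linear "(*s)" "(*s)" "dp X 1" by (rule linear_dp[OF X])
  obtain N where N: "\<And>M t. M \<ge> N \<Longrightarrow> \<rho> (unip X t) v = (\<Sum>n\<le>M. t ^ n *s dp X n v)"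
    and N': "\<And>m. m > N \<Longrightarrow> dp X m v = 0"
    using dp_expand[OF X, of v] by blast
  \<comment> \<open>As functions of \<open>s\<close>, both sides are the coefficient of \<open>t\<close> in \<open>\<rho> (1 + (s + t) X) v\<close>.\<close>
  have "(\<Sum>m\<le>max N n. monom (dp X 1 (dp X m v) $ i) m) = pderiv (curve X v i)"
  proof (rule poly_ext_infinite[OF infinite_alg_closed])
    fix s
    have "curve X (\<rho> (unip X s) v) i = pcompose (curve X v i) [:s, 1:]"
      by (rule curve_eqI)
         (simp add: poly_pcompose poly_curve[OF X] rho_mult[symmetric] unip_Sp4[OF X] unip_add[OF X] add.commute)
    then have "dp X 1 (\<rho> (unip X s) v) $ i = coeff (pcompose (curve X v i) [:s, 1:]) 1"
      by (simp add: dp_nth)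
    also have "\<dots> = poly (pderiv (pcompose (curve X v i) [:s, 1:])) 0"
      by (simp add: poly_0_coeff_0 coeff_pderiv)
    also have "\<dots> = poly (pderiv (curve X v i)) s"
      by (simp add: pderiv_pcompose poly_pcompose pderiv_pCons)
    finally have "dp X 1 (\<rho> (unip X s) v) $ i = poly (pderiv (curve X v i)) s" .
    moreover have "dp X 1 (\<rho> (unip X s) v) = (\<Sum>m\<le>max N n. s ^ m *s dp X 1 (dp X m v))"
      by (subst N[OF max.cobounded1[of N n]]) (simp only: h.sum h.scale)
    ultimately show "poly (\<Sum>m\<le>max N n. monom (dp X 1 (dp X m v) $ i) m) s = poly (pderiv (curve X v i)) s"
      by (simp add: poly_sum poly_monom mult.commute)
  qed
  from arg_cong[OF this, of "\<lambda>p. coeff p n"]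
  show "dp X 1 (dp X n v) $ i = (of_nat (Suc n) *s dp X (Suc n) v) $ i"
    by (simp add: coeff_sum if_distrib coeff_pderiv dp_nth distrib_right cong: if_cong)
qed

lemma dp_commute:
  assumes "i \<noteq> j"
  shows "dp (e_mat i) n (dp (f_mat j) m v) = dp (f_mat j) m (dp (e_mat i) n v)"
proof -
  have 1: "\<rho> (unip (f_mat j) s) (dp (e_mat i) n w) = dp (e_mat i) n (\<rho> (unip (f_mat j) s) w)" for s w
    using dp_intertwine[OF simple_mats_mem(1), of "\<rho> (unip (f_mat j) s)" i w 1]
    by (simp add: linear_rho unip_Sp4 rho_mult[symmetric] unip_commute[OF assms])
  show ?thesis
    using dp_intertwine[OF simple_mats_mem(2) linear_dp[OF simple_mats_mem(1)], of i n j v 1] 1 by simp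
qed

end

section \<open>Weights of rational modules\<close>

lemma gen_subset_Sp4: "g \<in> gen \<Longrightarrow> g \<in> Sp4"
proof (induction rule: gen.induct)
  case one show ?case using torus_Sp4[of 1 1] unip_Sp4[OF simple_mats_mem(1), of _ 0] by simp
qed (simp add: Sp4_mult unip_Sp4)

lemma char_at_add:
  assumes "t1 \<noteq> 0" "t2 \<noteq> 0"
  shows "char_at (\<mu> + \<nu>) t1 t2 = char_at \<mu> t1 t2 * char_at \<nu> t1 t2"
  using assms by (simp add: char_at_def power_int_add)

lemma char_at_scale:
  assumes "t1 \<noteq> 0" "t2 \<noteq> 0"
  shows "char_at (int n *s \<mu>) t1 t2 = char_at \<mu> t1 t2 ^ n"
  using assms by (simp add: char_at_def power_mult_distrib power_int_power' mult.commute)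

text \<open>
  Distinct characters are separated by a point, because \<open>t\<^sup>d = 1\<close> has only finitely many solutions for
  \<open>d > 0\<close>.
\<close>

lemma ex_powi_neq:
  assumes "a \<noteq> b" shows "\<exists>t::'k::alg_closed_field. t \<noteq> 0 \<and> t powi a \<noteq> t powi b"
proof (rule ccontr)
  assume "\<not> ?thesis"
  then have eq: "t powi a = t powi b" if "t \<noteq> 0" for t :: 'k using that by blast
  define d where "d = nat \<bar>a - b\<bar>"
  have "t ^ d = 1" if "t \<noteq> 0" for t :: 'k
  proof -
    have "t powi (a - b) = 1" "t powi (b - a) = 1"
      using eq[OF that] that by (simp_all add: power_int_diff)
    then show ?thesis unfolding d_def
      by (cases "a \<le> b") (simp_all add: power_int_def split: if_splits)
  qed
  \<comment> \<open>The additional factor \<open>t\<close> covers \<open>t = 0\<close>.\<close>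
  then have "poly (monom 1 (Suc d) - monom 1 1) t = 0" for t :: 'k
    by (cases "t = 0") (simp_all add: poly_monom)
  then have "monom 1 (Suc d) - monom 1 1 = (0 :: 'k poly)"
    by (intro poly_ext_infinite[OF infinite_alg_closed]) simp
  then have "coeff (monom 1 (Suc d) - monom 1 1 :: 'k poly) 1 = 0" by simp
  then show False using assms by (simp add: d_def split: if_splits)
qed

lemma ex_char_neq:
  assumes "\<mu> \<noteq> \<nu>"
  shows "\<exists>t1 t2 :: 'k::alg_closed_field. t1 \<noteq> 0 \<and> t2 \<noteq> 0 \<and> char_at \<mu> t1 t2 \<noteq> char_at \<nu> t1 t2"
proof -
  from assms consider "\<mu> $ 1 \<noteq> \<nu> $ 1" | "\<mu> $ 2 \<noteq> \<nu> $ 2"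
    by (auto simp: vec_eq_iff forall_2)
  then show ?thesis
  proof cases
    case 1
    from ex_powi_neq[OF this] obtain t :: 'k where "t \<noteq> 0" "t powi (\<mu> $ 1) \<noteq> t powi (\<nu> $ 1)" by blast
    then show ?thesis by (intro exI[of _ t] exI[of _ 1]) (simp add: char_at_def)
  next
    case 2
    from ex_powi_neq[OF this] obtain t :: 'k where "t \<noteq> 0" "t powi (\<mu> $ 2) \<noteq> t powi (\<nu> $ 2)" by blast
    then show ?thesis by (intro exI[of _ 1] exI[of _ t]) (simp add: char_at_def)
  qed
qed

lemma weight_leD:
  assumes "weight_le \<mu> \<nu>"
  shows "\<mu> $ 1 \<le> \<nu> $ 1" "\<mu> $ 1 + \<mu> $ 2 \<le> \<nu> $ 1 + \<nu> $ 2"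
    "even (\<nu> $ 1 + \<nu> $ 2 - (\<mu> $ 1 + \<mu> $ 2))"
proof -
  from assms obtain c :: "weight \<Rightarrow> nat" where c: "\<nu> - \<mu> = (\<Sum>\<alpha>\<in>pos_roots. int (c \<alpha>) *s \<alpha>)"
    unfolding weight_le_def by blast
  define e1 e2 :: weight where "e1 = eps1" and "e2 = eps2"
  have e: "e1 $ 1 = 1" "e1 $ 2 = 0" "e2 $ 1 = 0" "e2 $ 2 = 1"
    by (simp_all add: e1_def e2_def eps1_def eps2_def axis_def)
  have "distinct [2 *s e1, 2 *s e2, e1 + e2, e1 - e2]"
    by (simp add: vec_eq_iff forall_2 e)
  then have *: "\<nu> - \<mu> = int (c (2 *s e1)) *s (2 *s e1) + int (c (2 *s e2)) *s (2 *s e2)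
      + int (c (e1 + e2)) *s (e1 + e2) + int (c (e1 - e2)) *s (e1 - e2)"
    unfolding c pos_roots_def e1_def[symmetric] e2_def[symmetric] by (simp add: add.assoc)
  have **: "\<nu> $ 1 - \<mu> $ 1 = 2 * int (c (2 *s e1)) + int (c (e1 + e2)) + int (c (e1 - e2))"
     "\<nu> $ 2 - \<mu> $ 2 = 2 * int (c (2 *s e2)) + int (c (e1 + e2)) - int (c (e1 - e2))"
    using arg_cong[OF *, of "\<lambda>x. x $ 1"] arg_cong[OF *, of "\<lambda>x. x $ 2"] by (simp_all add: e)
  show "\<mu> $ 1 \<le> \<nu> $ 1" "\<mu> $ 1 + \<mu> $ 2 \<le> \<nu> $ 1 + \<nu> $ 2" using ** by linarith+
  show "even (\<nu> $ 1 + \<nu> $ 2 - (\<mu> $ 1 + \<mu> $ 2))" using ** by presburger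
qed

context rational_rep
begin

abbreviation wt :: "weight \<Rightarrow> ('k ^ 'n) set" where "wt \<mu> \<equiv> weight_space (*s) \<rho> \<mu>"

lemma wtD: "v \<in> wt \<mu> \<Longrightarrow> t1 \<noteq> 0 \<Longrightarrow> t2 \<noteq> 0 \<Longrightarrow> \<rho> (torus_elt t1 t2) v = char_at \<mu> t1 t2 *s v"
  by (simp add: weight_space_def)

lemma wt_zero: "0 \<in> wt \<mu>"
  using rho_scale[of _ 0 0] by (auto simp: weight_space_def torus_Sp4)

lemma dp_wt:
  assumes X: "root_vector X \<alpha>" and v: "v \<in> wt \<mu>"
  shows "dp X n v \<in> wt (\<mu> + int n *s \<alpha>)"
  unfolding weight_space_def
proof (intro CollectI allI impI)
  fix t1 t2 :: 'k assume t: "t1 \<noteq> 0" "t2 \<noteq> 0"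
  have S: "X \<in> simple_mats" using X by (simp add: root_vector_def)
  interpret D: Vector_Spaces.linear "(*s)" "(*s)" "dp X n" by (rule linear_dp[OF S])
  have "\<rho> (torus_elt t1 t2) (dp X n v) = char_at \<alpha> t1 t2 ^ n *s dp X n (\<rho> (torus_elt t1 t2) v)"
  proof (rule dp_intertwine[OF S linear_rho[OF torus_Sp4[OF t]]])
    fix u
    show "\<rho> (torus_elt t1 t2) (\<rho> (unip X u) v)
        = \<rho> (unip X (char_at \<alpha> t1 t2 * u)) (\<rho> (torus_elt t1 t2) v)"
      using X t by (simp add: rho_mult[symmetric] torus_Sp4 unip_Sp4 S root_vector_def)
  qed
  also have "\<dots> = char_at (\<mu> + int n *s \<alpha>) t1 t2 *s dp X n v"
    using t v by (simp add: wtD D.scale char_at_add char_at_scale mult.commute)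
  finally show "\<rho> (torus_elt t1 t2) (dp X n v) = char_at (\<mu> + int n *s \<alpha>) t1 t2 *s dp X n v" .
qed

lemma stable_Sp4:
  assumes two: "(2::'k) \<noteq> 0" and U: "\<And>X t v. X \<in> simple_mats \<Longrightarrow> v \<in> U \<Longrightarrow> \<rho> (unip X t) v \<in> U"
    and g: "g \<in> Sp4" and v: "v \<in> U"
  shows "\<rho> g v \<in> U"
proof -
  from Sp4_generated[OF two g] have "\<forall>v\<in>U. \<rho> g v \<in> U"
    by (induction rule: gen.induct) (simp_all add: rho_one rho_mult unip_Sp4 gen_subset_Sp4 U)
  with v show ?thesis by blast
qed

lemma swap_wt: "v \<in> wt \<mu> \<Longrightarrow> \<rho> swap_mat v \<in> wt (vector [\<mu> $ 2, \<mu> $ 1])"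
  by (auto simp: weight_space_def rho_mult[symmetric] torus_Sp4 swap_flip_Sp4 torus_swap)
     (simp add: rho_mult torus_Sp4 swap_flip_Sp4 rho_scale char_at_def mult.commute)

lemma flip_wt: "v \<in> wt \<mu> \<Longrightarrow> \<rho> flip_mat v \<in> wt (vector [\<mu> $ 1, - \<mu> $ 2])"
  by (auto simp: weight_space_def rho_mult[symmetric] torus_Sp4 swap_flip_Sp4 torus_flip)
     (simp add: rho_mult torus_Sp4 swap_flip_Sp4 rho_scale char_at_def power_int_minus power_int_inverse)

lemma swap_eq_0: "\<rho> swap_mat v = 0 \<Longrightarrow> v = 0"
proof -
  assume "\<rho> swap_mat v = 0"
  then have "\<rho> swap_mat (\<rho> swap_mat v) = 0" using rho_scale[of swap_mat 0 0] by (simp add: swap_flip_Sp4)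
  moreover have "swap_mat ** swap_mat = (mat 1 :: 'k mat4)"
    by (simp add: mat4_simps swap_mat_def) (simp add: mat_def)
  ultimately show "v = 0" by (simp add: rho_mult[symmetric] swap_flip_Sp4 rho_one)
qed

lemma flip_eq_0: "\<rho> flip_mat v = 0 \<Longrightarrow> v = 0"
proof -
  assume *: "\<rho> flip_mat v = 0"
  have z: "\<rho> flip_mat 0 = 0" using rho_scale[of flip_mat 0 0] by (simp add: swap_flip_Sp4)
  have "\<rho> (flip_mat ** flip_mat ** (flip_mat ** flip_mat)) v = 0"
    by (simp add: rho_mult swap_flip_Sp4 Sp4_mult * z)
  moreover have "flip_mat ** flip_mat ** (flip_mat ** flip_mat) = (mat 1 :: 'k mat4)"
    by (simp add: mat4_simps flip_mat_def) (simp add: mat_def)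
  ultimately show "v = 0" by (simp add: rho_one)
qed

text \<open>
  Weight spaces for different weights are independent. The projection is a product of factors
  \<open>(t - \<mu>(t)) / (\<nu>(t) - \<mu>(t))\<close>, where for each \<open>\<mu>\<close> in \<open>A\<close> the torus element \<open>t\<close> is chosen to separate \<open>\<mu>\<close>
  from \<open>\<nu>\<close>.
\<close>

lemma weight_separating_projection:
  assumes "finite A" "\<nu> \<notin> A"
  shows "\<exists>P. Vector_Spaces.linear (*s) (*s) P \<and> (\<forall>v\<in>wt \<nu>. P v = v) \<and> (\<forall>\<mu>\<in>A. \<forall>v\<in>wt \<mu>. P v = 0)"
  using assms
proof (induction A)
  case empty
  have "Vector_Spaces.linear (*s) (*s) (\<lambda>v :: 'k ^ 'n. v)" by (rule vec.linear_ident)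
  then show ?case by blast
next
  case (insert \<mu> A)
  then obtain P where P: "Vector_Spaces.linear (*s) (*s) P" "\<And>v. v \<in> wt \<nu> \<Longrightarrow> P v = v"
    "\<And>\<kappa> v. \<kappa> \<in> A \<Longrightarrow> v \<in> wt \<kappa> \<Longrightarrow> P v = 0" by auto
  interpret P: Vector_Spaces.linear "(*s)" "(*s)" P by (fact P)
  have ne0: "\<nu> \<noteq> \<mu>" using insert.prems by simp
  obtain t1 t2 :: 'k where t: "t1 \<noteq> 0" "t2 \<noteq> 0" and ne: "char_at \<nu> t1 t2 \<noteq> char_at \<mu> t1 t2"
    using ex_char_neq[OF ne0] by blast
  define c where "c = 1 / (char_at \<nu> t1 t2 - char_at \<mu> t1 t2)"
  define Q where "Q v = c *s P (\<rho> (torus_elt t1 t2) v - char_at \<mu> t1 t2 *s v)" for v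
  have Q: "Q v = (c * (char_at \<kappa> t1 t2 - char_at \<mu> t1 t2)) *s P v" if "v \<in> wt \<kappa>" for \<kappa> v
  proof -
    have "\<rho> (torus_elt t1 t2) v - char_at \<mu> t1 t2 *s v = (char_at \<kappa> t1 t2 - char_at \<mu> t1 t2) *s v"
      by (simp only: wtD[OF that t] vec.scale_left_diff_distrib)
    then show ?thesis by (simp only: Q_def P.scale vec.scale_scale)
  qed
  have "Vector_Spaces.linear (*s) (*s) Q"
  proof unfold_locales
    fix a :: 'k and v w :: "'k ^ 'n"
    let ?r = "\<rho> (torus_elt t1 t2)"
    have "?r (v + w) - char_at \<mu> t1 t2 *s (v + w)
        = (?r v - char_at \<mu> t1 t2 *s v) + (?r w - char_at \<mu> t1 t2 *s w)"
      by (simp add: rho_add torus_Sp4 t vec.scale_right_distrib)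
    then show "Q (v + w) = Q v + Q w" by (simp only: Q_def P.add vec.scale_right_distrib)
    have "?r (a *s v) - char_at \<mu> t1 t2 *s (a *s v) = a *s (?r v - char_at \<mu> t1 t2 *s v)"
      by (simp only: rho_scale torus_Sp4 t vec.scale_right_diff_distrib vec.scale_scale mult.commute not_False_eq_True)
    then show "Q (a *s v) = a *s Q v" by (simp only: Q_def P.scale vec.scale_scale mult.commute)
  qed
  moreover have "Q v = v" if "v \<in> wt \<nu>" for v
    using Q[OF that] P(2)[OF that] ne by (simp add: c_def)
  moreover have "Q v = 0" if "\<kappa> \<in> insert \<mu> A" "v \<in> wt \<kappa>" for \<kappa> v
    using Q[OF that(2)] P(3)[OF _ that(2)] that(1) by auto
  ultimately show ?case by blast
qed

end

section \<open>Irreducible modules with small highest weight\<close>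

lemma coeff_1_monom_linear_power:
  "coeff (monom c n * [:1, s:] ^ N) 1 = (if n = 0 then c * (of_nat N * s) else if n = 1 then c else 0)"
  for c s :: "'k::field"
proof -
  have 0: "coeff ([:1, s:] ^ N) 0 = 1" by (simp add: coeff_0_power)
  have 1: "coeff ([:1, s:] ^ N) (Suc 0) = of_nat N * s"
  proof (induction N)
    case (Suc N)
    have "coeff ([:1, s:] ^ N) 0 = 1" by (simp add: coeff_0_power)
    with Suc show ?case by (simp add: algebra_simps)
  qed simp
  show ?thesis
  proof (cases n)
    case 0
    then show ?thesis using 1 by (simp add: monom_0)
  next
    case (Suc m)
    then show ?thesis using 0 by (simp add: monom_Suc monom_0 coeff_monom_mult)
  qed
qed

lemma pairing_add: "pairing (\<mu> + \<nu>) r = pairing \<mu> r + pairing \<nu> r"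
  by (cases r) auto

lemma pairing_root_self: "pairing (int n *s alpha r) r = 2 * int n"
  by (cases r) auto

lemma coroot_elt_weight:
  assumes "u \<noteq> 0" "v \<in> weight_space (*s) \<rho> \<mu>"
  shows "\<rho> (coroot_elt r u) v = (u powi pairing \<mu> r) *s v"
proof (cases r)
  case Short
  have "\<rho> (torus_elt u (inverse u)) v = char_at \<mu> u (inverse u) *s v"
    using assms by (simp add: weight_space_def)
  then show ?thesis using Short assms(1)
    by (simp add: char_at_def power_int_diff power_int_inverse divide_inverse)
next
  case Long
  have "\<rho> (torus_elt 1 u) v = char_at \<mu> 1 u *s v"
    using assms by (simp add: weight_space_def)
  then show ?thesis using Long by (simp add: char_at_def)
qed

lemma coroot_elt_Sp4: "u \<noteq> 0 \<Longrightarrow> coroot_elt r u \<in> Sp4"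
  by (cases r) (simp_all add: torus_Sp4)

text \<open>
  The weights that the two modules of interest can have. Along any simple root a string inside the box
  has at most five members, which is what bounds divided powers.
\<close>

definition box :: "weight set" where
  "box = {\<mu>. \<bar>\<mu> $ 1\<bar> \<le> 2 \<and> \<bar>\<mu> $ 2\<bar> \<le> 2}"

lemma finite_box: "finite box"
proof (rule finite_subset)
  show "box \<subseteq> (\<lambda>(a, b). vector [a, b]) ` ({-2..2} \<times> {-2..2})"
  proof
    fix \<mu> assume "\<mu> \<in> box"
    moreover have "\<mu> = vector [\<mu> $ 1, \<mu> $ 2]" by (simp add: vec_eq_iff forall_2)
    ultimately show "\<mu> \<in> (\<lambda>(a, b). vector [a, b]) ` ({-2..2} \<times> {-2..2})"
      by (intro image_eqI[of _ _ "(\<mu> $ 1, \<mu> $ 2)"]) (auto simp: box_def)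
  qed
qed simp

text \<open>
  The bound on the highest weight confines all weights to \<^const>\<open>box\<close>. Together with characteristic
  \<open>5\<close> it makes the factorials of all nonzero divided powers invertible.
\<close>

locale small_rep = rational_rep \<rho>
  for \<rho> :: "('k::alg_closed_field) mat4 \<Rightarrow> 'k ^ 'n \<Rightarrow> 'k ^ 'n::finite" +
  fixes lam :: weight
  assumes irred: "irreducible_module (*s) \<rho>"
    and hw: "has_highest_weight (*s) \<rho> lam"
    and lam_small: "lam $ 1 \<le> 2"
    and char_5: "CHAR('k) = 5"
begin

lemma of_nat_neq_0: "0 < n \<Longrightarrow> n < 5 \<Longrightarrow> (of_nat n :: 'k) \<noteq> 0"
  unfolding of_nat_eq_0_iff_char_dvd char_5 by (auto dest: dvd_imp_le)

lemma two_neq_0: "(2 :: 'k) \<noteq> 0"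
  using of_nat_neq_0[of 2] by simp

lemma irreducibleD:
  assumes "vec.subspace U" and "\<And>X t v. X \<in> simple_mats \<Longrightarrow> v \<in> U \<Longrightarrow> \<rho> (unip X t) v \<in> U"
  shows "U = {0} \<or> U = UNIV"
proof -
  have "\<rho> g ` U \<subseteq> U" if "g \<in> Sp4" for g
    using stable_Sp4[OF two_neq_0 assms(2) that] by blast
  then show ?thesis using irred assms(1) unfolding irreducible_module_def by blast
qed

lemma rho_0: "g \<in> Sp4 \<Longrightarrow> \<rho> g 0 = 0"
  using rho_scale[of g 0 0] by simp

text \<open>
  Divided powers send weight vectors to weight vectors, so the span of the weight spaces is stable under
  root elements, hence under the group; by irreducibility it is everything.
\<close>

lemma span_weights: "vec.span (\<Union>\<mu>. wt \<mu>) = UNIV"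
proof -
  let ?S = "vec.span (\<Union>\<mu>. wt \<mu>)"
  have "\<rho> (unip X t) v \<in> ?S" if X: "X \<in> simple_mats" and v: "v \<in> ?S" for X t v
  proof -
    obtain \<alpha> where \<alpha>: "root_vector X \<alpha>"
      using X root_vector_e root_vector_f unfolding simple_mats_def by blast
    show ?thesis using v
    proof (induction rule: vec.span_induct_alt)
      case base show ?case by (simp add: rho_0 unip_Sp4 X vec.span_zero)
    next
      case (step c x y)
      then obtain \<mu> where x: "x \<in> wt \<mu>" by blast
      obtain N where "\<rho> (unip X t) x = (\<Sum>n\<le>N. t ^ n *s dp X n x)"
        using dp_expand[OF X, of x] by blast
      moreover have "\<dots> \<in> ?S"
        by (intro vec.span_sum vec.span_scale vec.span_base) (use dp_wt[OF \<alpha> x] in blast)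
      ultimately have "\<rho> (unip X t) x \<in> ?S" by simp
      then show ?case using step
        by (simp add: rho_add rho_scale unip_Sp4 X vec.span_add vec.span_scale)
    qed
  qed
  then have "?S = {0} \<or> ?S = UNIV" by (intro irreducibleD vec.subspace_span)
  moreover have "?S \<noteq> {0}"
    using hw wt_zero[of lam] unfolding has_highest_weight_def
    by (metis UN_I UNIV_I empty_iff insert_iff subsetI subset_singletonD vec.span_base)
  ultimately show ?thesis by blast
qed

text \<open>
  Linear statements need only be checked on weight vectors.
\<close>

lemma weight_induct:
  assumes "vec.subspace {v. P v}" and "\<And>\<mu> v. v \<in> wt \<mu> \<Longrightarrow> P v"
  shows "P v"
proof -
  have "vec.span (\<Union>\<mu>. wt \<mu>) \<subseteq> {v. P v}"
    by (rule vec.span_minimal) (use assms in auto)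
  then show ?thesis using span_weights by auto
qed

lemma weight_bound:
  assumes "v \<in> wt \<mu>" "v \<noteq> 0"
  shows "\<mu> $ 1 \<le> lam $ 1" "\<mu> $ 1 + \<mu> $ 2 \<le> lam $ 1 + lam $ 2"
    "even (lam $ 1 + lam $ 2 - (\<mu> $ 1 + \<mu> $ 2))"
  using weight_leD[of \<mu> lam] hw assms unfolding has_highest_weight_def by blast+

text \<open>
  Apply the bound by the highest weight to all eight images of \<open>\<mu>\<close> under the Weyl group.
\<close>

lemma weights:
  assumes v: "v \<in> wt \<mu>" "v \<noteq> 0"
  shows "\<bar>\<mu> $ 1\<bar> \<le> lam $ 1" "\<bar>\<mu> $ 2\<bar> \<le> lam $ 1"
    "\<bar>\<mu> $ 1\<bar> + \<bar>\<mu> $ 2\<bar> \<le> lam $ 1 + lam $ 2" "even (lam $ 1 + lam $ 2 - (\<mu> $ 1 + \<mu> $ 2))"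
proof -
  note b = weight_bound
  have F: "\<rho> flip_mat w \<noteq> 0" and S: "\<rho> swap_mat w \<noteq> 0" if "w \<noteq> 0" for w
    using flip_eq_0 swap_eq_0 that by blast+
  note f = flip_wt[OF v(1)] F[OF v(2)] and s = swap_wt[OF v(1)] S[OF v(2)]
  note fs = flip_wt[OF s(1)] F[OF s(2)] and sf = swap_wt[OF f(1)] S[OF f(2)]
  note sfs = swap_wt[OF fs(1)] S[OF fs(2)] and fsf = flip_wt[OF sf(1)] F[OF sf(2)]
  note fsfs = flip_wt[OF sfs(1)] F[OF sfs(2)]
  have all: "\<mu> $ 1 \<le> lam $ 1" "- (\<mu> $ 1) \<le> lam $ 1" "\<mu> $ 2 \<le> lam $ 1" "- (\<mu> $ 2) \<le> lam $ 1"
    "\<mu> $ 1 + \<mu> $ 2 \<le> lam $ 1 + lam $ 2" "\<mu> $ 1 - \<mu> $ 2 \<le> lam $ 1 + lam $ 2"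
    "- (\<mu> $ 1) + \<mu> $ 2 \<le> lam $ 1 + lam $ 2" "- (\<mu> $ 1) - \<mu> $ 2 \<le> lam $ 1 + lam $ 2"
    using b(1,2)[OF v] b(1,2)[OF f] b(1,2)[OF s] b(1,2)[OF fs] b(1,2)[OF sf] b(1,2)[OF sfs]
      b(1,2)[OF fsf] b(1,2)[OF fsfs] by simp_all
  show "even (lam $ 1 + lam $ 2 - (\<mu> $ 1 + \<mu> $ 2))" by (rule b(3)[OF v])
  show "\<bar>\<mu> $ 1\<bar> \<le> lam $ 1" "\<bar>\<mu> $ 2\<bar> \<le> lam $ 1" "\<bar>\<mu> $ 1\<bar> + \<bar>\<mu> $ 2\<bar> \<le> lam $ 1 + lam $ 2"
    using all by linarith+
qed

lemma weight_in_box: "v \<in> wt \<mu> \<Longrightarrow> v \<noteq> 0 \<Longrightarrow> \<mu> \<in> box"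
  using weights[of v \<mu>] lam_small by (simp add: box_def)

lemma root_vectorE:
  assumes "X \<in> simple_mats"
  obtains r where "root_vector X (alpha r)" | r where "root_vector X (- alpha r)"
  using assms root_vector_e root_vector_f unfolding simple_mats_def by blast

lemma dp_eq_0:
  assumes X: "X \<in> simple_mats" and n: "n > 4" shows "dp X n v = 0"
proof -
  interpret D: Vector_Spaces.linear "(*s)" "(*s)" "dp X n" by (rule linear_dp[OF X])
  show ?thesis
  proof (rule weight_induct[where P = "\<lambda>v. dp X n v = 0"])
    show "vec.subspace {v. dp X n v = 0}"
      by (simp add: vec.subspace_def D.zero D.add D.scale)
  next
    fix \<mu> v assume v: "v \<in> wt \<mu>"
    from X obtain r \<alpha> where r: "root_vector X \<alpha>" "\<alpha> = alpha r \<or> \<alpha> = - alpha r"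
      using root_vectorE by metis
    show "dp X n v = 0"
    proof (rule ccontr)
      assume nz: "dp X n v \<noteq> 0"
      then have "v \<noteq> 0" using D.zero by auto
      with weight_in_box[OF v] weight_in_box[OF dp_wt[OF r(1) v] nz] n r(2)
      show False by (cases r) (auto simp: box_def)
    qed
  qed
qed

lemma unip_expand:
  assumes X: "X \<in> simple_mats"
  shows "\<rho> (unip X t) v = (\<Sum>n\<le>4. t ^ n *s dp X n v)"
proof -
  obtain N where N: "\<And>M t. M \<ge> N \<Longrightarrow> \<rho> (unip X t) v = (\<Sum>n\<le>M. t ^ n *s dp X n v)"
    using dp_expand[OF X, of v] by blast
  have "(\<Sum>n\<le>max N 4. t ^ n *s dp X n v) = (\<Sum>n\<le>4. t ^ n *s dp X n v)"
    by (rule sum.mono_neutral_right) (auto simp: dp_eq_0[OF X])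
  then show ?thesis using N[of "max N 4" t] by simp
qed

text \<open>
  Since \<open>1 + t X\<close> acts as \<open>\<Sum> t\<^sup>n X\<^sup>n / n!\<close> with \<open>n \<le> 4\<close>, a subspace stable under \<open>X\<close> is stable under the
  root subgroup.
\<close>

lemma irreducible_Lie:
  assumes U: "vec.subspace U" and e: "\<And>r v. v \<in> U \<Longrightarrow> dp (e_mat r) 1 v \<in> U"
    and f: "\<And>r v. v \<in> U \<Longrightarrow> dp (f_mat r) 1 v \<in> U"
  shows "U = {0} \<or> U = UNIV"
proof (rule irreducibleD[OF U])
  fix X :: "'k mat4" and t v assume X: "X \<in> simple_mats" and v: "v \<in> U"
  have "dp X n v \<in> U" if "n \<le> 4" for n
    using that
  proof (induction n)
    case 0 show ?case by (simp add: dp_0[OF X] v)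
  next
    case (Suc n)
    then have "dp X 1 (dp X n v) \<in> U" using X e f unfolding simple_mats_def by auto
    then have "of_nat (Suc n) *s dp X (Suc n) v \<in> U" by (simp only: dp_1_dp[OF X])
    then have "(1 / of_nat (Suc n)) *s (of_nat (Suc n) *s dp X (Suc n) v) \<in> U"
      by (rule vec.subspace_scale[OF U])
    then show ?case using of_nat_neq_0[of "Suc n"] Suc.prems by (simp del: of_nat_Suc)
  qed
  then show "\<rho> (unip X t) v \<in> U"
    unfolding unip_expand[OF X] by (intro vec.subspace_sum[OF U] vec.subspace_scale[OF U]) auto
qed

end

section \<open>The action of the simple root vectors\<close>

context small_rep
begin

definition ee :: "simple_root \<Rightarrow> 'k ^ 'n \<Rightarrow> 'k ^ 'n" where "ee r = dp (e_mat r) 1"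
definition ff :: "simple_root \<Rightarrow> 'k ^ 'n \<Rightarrow> 'k ^ 'n" where "ff r = dp (f_mat r) 1"

lemma linear_ee: "Vector_Spaces.linear (*s) (*s) (ee r)"
  and linear_ff: "Vector_Spaces.linear (*s) (*s) (ff r)"
  unfolding ee_def ff_def by (rule linear_dp, rule simple_mats_mem)+

lemma pairing_bound:
  assumes "v \<in> wt \<mu>" "v \<noteq> 0" shows "\<bar>pairing \<mu> r\<bar> \<le> 4"
  using weight_in_box[OF assms] by (cases r) (auto simp: box_def)

text \<open>
  The expansion of \<open>unip_e_f\<close> on a weight vector, multiplied by \<open>(1 + t s)\<^sup>9\<close>. On the right hand side
  the coroot contributes \<open>u = 1 + t s\<close> to the power \<open>pairing \<mu> r + 2n\<close>, the parameters contribute the power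
  \<open>- n - m\<close>, and \<open>9\<close> is large enough to keep all exponents positive. Then both sides are polynomials in
  \<open>t\<close> and \<open>s\<close>, and both vanish for \<open>1 + t s = 0\<close>, where the factorisation is not available.
\<close>

lemma e_f_expand:
  assumes v: "v \<in> wt \<mu>" "v \<noteq> 0"
  shows "(\<Sum>n\<le>4. \<Sum>m\<le>4. (t ^ n * s ^ m * (1 + t * s) ^ 9) *s dp (e_mat r) n (dp (f_mat r) m v))
    = (\<Sum>n\<le>4. \<Sum>m\<le>4. (t ^ n * s ^ m * (1 + t * s) ^ nat (9 + pairing \<mu> r + int n - int m))
         *s dp (f_mat r) m (dp (e_mat r) n v))" (is "?L = ?R")
proof -
  define u where "u = 1 + t * s"
  define k where "k = pairing \<mu> r"
  have k: "\<bar>k\<bar> \<le> 4" unfolding k_def by (rule pairing_bound[OF v])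
  let ?E = "dp (e_mat r)" and ?F = "dp (f_mat r)"
  let ?P = "(\<Sum>n\<le>4. \<Sum>m\<le>4. (t ^ n * s ^ m) *s ?E n (?F m v))"
  let ?Q = "(\<Sum>n\<le>4. \<Sum>m\<le>4. ((t / u) ^ n * (s / u) ^ m * u powi (k + 2 * int n)) *s ?F m (?E n v))"
  note S = unip_Sp4[OF simple_mats_mem(1)] unip_Sp4[OF simple_mats_mem(2)]
  show ?thesis
  proof (cases "u = 0")
    case True
    have "nat (9 + k + int n - int m) \<noteq> 0" if "m \<le> 4" for n m using that k by linarith
    then have "u ^ nat (9 + k + int n - int m) = 0" if "m \<le> 4" for n m
      using that True by (metis power_eq_0_iff not_gr_zero)
    then have "?R = 0"
      unfolding u_def[symmetric] k_def[symmetric] by (intro sum.neutral ballI) simp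
    moreover have "?L = 0" unfolding u_def[symmetric] using True by simp
    ultimately show ?thesis by simp
  next
    case False
    have lin: "Vector_Spaces.linear (*s) (*s) (?E n)" "Vector_Spaces.linear (*s) (*s) (?F n)" for n
      by (rule linear_dp, rule simple_mats_mem)+
    have "\<rho> (unip (e_mat r) t) (\<rho> (unip (f_mat r) s) v)
        = ?P"
    proof -
      have "?E n (\<Sum>m\<le>4. s ^ m *s ?F m v) = (\<Sum>m\<le>4. s ^ m *s ?E n (?F m v))" for n
      proof -
        interpret L: Vector_Spaces.linear "(*s)" "(*s)" "?E n" by (rule lin)
        show ?thesis by (simp only: L.sum L.scale)
      qed
      then show ?thesis
        by (simp only: unip_expand simple_mats_mem vec.scale_sum_right vec.scale_scale)
    qed
    moreover have "\<rho> (unip (e_mat r) t) (\<rho> (unip (f_mat r) s) v)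
        = ?Q"
    proof -
      let ?h = "coroot_elt r u"
      have h: "?h \<in> Sp4" by (rule coroot_elt_Sp4[OF False])
      have hE: "\<rho> ?h (?E n v) = (u powi (k + 2 * int n)) *s ?E n v" for n
        using coroot_elt_weight[OF False dp_wt[OF root_vector_e v(1)], of r r n]
        by (simp add: k_def pairing_add pairing_root_self)
      interpret h: Vector_Spaces.linear "(*s)" "(*s)" "\<rho> ?h" by (rule linear_rho[OF h])
      have "\<rho> (unip (e_mat r) t) (\<rho> (unip (f_mat r) s) v)
          = \<rho> (unip (f_mat r) (s / u)) (\<rho> ?h (\<rho> (unip (e_mat r) (t / u)) v))"
      proof -
        have "\<rho> (unip (e_mat r) t) (\<rho> (unip (f_mat r) s) v) = \<rho> (unip (e_mat r) t ** unip (f_mat r) s) v"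
          by (simp only: rho_mult S)
        also have "unip (e_mat r) t ** unip (f_mat r) s
            = unip (f_mat r) (s / u) ** (?h ** unip (e_mat r) (t / u))"
          by (rule unip_e_f) (use False in \<open>simp_all add: u_def\<close>)
        finally show ?thesis by (simp only: rho_mult S h Sp4_mult)
      qed
      also have "\<rho> ?h (\<rho> (unip (e_mat r) (t / u)) v)
          = (\<Sum>n\<le>4. ((t / u) ^ n * u powi (k + 2 * int n)) *s ?E n v)"
        by (simp only: unip_expand simple_mats_mem h.sum h.scale hE vec.scale_scale)
      also have "\<rho> (unip (f_mat r) (s / u)) \<dots>
          = (\<Sum>m\<le>4. \<Sum>n\<le>4. ((t / u) ^ n * (s / u) ^ m * u powi (k + 2 * int n)) *s ?F m (?E n v))"
      proof -
        have "?F m (\<Sum>n\<le>4. ((t / u) ^ n * u powi (k + 2 * int n)) *s ?E n v)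
            = (\<Sum>n\<le>4. ((t / u) ^ n * u powi (k + 2 * int n)) *s ?F m (?E n v))" for m
        proof -
          interpret L: Vector_Spaces.linear "(*s)" "(*s)" "?F m" by (rule lin)
          show ?thesis by (simp only: L.sum L.scale)
        qed
        then show ?thesis
          by (simp only: unip_expand simple_mats_mem vec.scale_sum_right vec.scale_scale mult_ac)
      qed
      also have "\<dots> = ?Q"
        by (rule sum.swap)
      finally show ?thesis .
    qed
    ultimately have "u ^ 9 *s ?P
      = u ^ 9 *s ?Q"
      by simp
    moreover have "u ^ 9 *s ?P = ?L"
      by (simp only: vec.scale_sum_right vec.scale_scale u_def mult_ac)
    moreover have "u ^ 9 *s ?Q
       = ?R"
    proof -
      have "u ^ 9 * ((t / u) ^ n * (s / u) ^ m * u powi (k + 2 * int n))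
          = t ^ n * s ^ m * u ^ nat (9 + k + int n - int m)" if "m \<le> 4" for n m
      proof -
        have "u ^ nat (9 + k + int n - int m) = u powi (9 + k + int n - int m)"
          using that k by (simp add: power_int_def)
        also have "\<dots> = u powi (9 + (k + 2 * int n) - int n - int m)"
          by (rule arg_cong) simp
        also have "\<dots> = u ^ 9 * u powi (k + 2 * int n) / u ^ n / u ^ m"
          using False by (simp only: power_int_diff power_int_add power_int_of_nat power_int_numeral simp_thms)
        finally have *: "u ^ nat (9 + k + int n - int m) = u ^ 9 * u powi (k + 2 * int n) / u ^ n / u ^ m" .
        show ?thesis unfolding * by (simp add: power_divide mult_ac)
      qed
      then show ?thesis
        unfolding vec.scale_sum_right vec.scale_scale u_def[symmetric] k_def[symmetric]
        by (intro sum.cong refl) simp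
    qed
    ultimately show ?thesis by simp
  qed
qed

lemma e_f_commutator:
  assumes v: "v \<in> wt \<mu>"
  shows "ee r (ff r v) = ff r (ee r v) + of_int (pairing \<mu> r) *s v"
proof (cases "v = 0")
  case True
  interpret E: Vector_Spaces.linear "(*s)" "(*s)" "ee r" by (rule linear_ee)
  interpret F: Vector_Spaces.linear "(*s)" "(*s)" "ff r" by (rule linear_ff)
  show ?thesis using True by (simp add: E.zero F.zero)
next
  case False
  define k where "k = pairing \<mu> r"
  have k: "\<bar>k\<bar> \<le> 4" unfolding k_def by (rule pairing_bound[OF v False])
  define N where "N n m = nat (9 + k + int n - int m)" for n m
  let ?E = "dp (e_mat r)" and ?F = "dp (f_mat r)"
  show ?thesis
  proof (rule vec_eq_iff[THEN iffD2], rule)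
    fix i
    \<comment> \<open>Compare the coefficients of \<open>t\<close>, for fixed \<open>s\<close>, and then those of \<open>s\<close>.\<close>
    have 1: "(\<Sum>m\<le>4. s ^ m * ?E 1 (?F m v) $ i) + (\<Sum>m\<le>4. 9 * s ^ Suc m * ?F m v $ i)
      = (\<Sum>m\<le>4. s ^ m * ?F m (?E 1 v) $ i) + (\<Sum>m\<le>4. of_nat (N 0 m) * s ^ Suc m * ?F m v $ i)" for s
    proof -
      define A where "A = (\<Sum>n\<le>4. \<Sum>m\<le>4. monom (s ^ m * ?E n (?F m v) $ i) n * [:1, s:] ^ 9)"
      define B where "B = (\<Sum>n\<le>4. \<Sum>m\<le>4. monom (s ^ m * ?F m (?E n v) $ i) n * [:1, s:] ^ N n m)"
      have "A = B"
      proof (rule poly_ext_infinite[OF infinite_alg_closed])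
        fix t
        show "poly A t = poly B t"
          using arg_cong[OF e_f_expand[OF v False, of t s r], of "\<lambda>x. x $ i"]
          by (simp add: A_def B_def N_def k_def poly_sum poly_monom poly_power mult_ac)
      qed
      then have "coeff A 1 = coeff B 1" by simp
      moreover have "coeff A 1 = (\<Sum>m\<le>4. 9 * s ^ Suc m * ?F m v $ i) + (\<Sum>m\<le>4. s ^ m * ?E 1 (?F m v) $ i)"
        unfolding A_def coeff_sum coeff_1_monom_linear_power
        by (simp add: eval_nat_numeral dp_0 algebra_simps)
      moreover have "coeff B 1 = (\<Sum>m\<le>4. of_nat (N 0 m) * s ^ Suc m * ?F m v $ i) + (\<Sum>m\<le>4. s ^ m * ?F m (?E 1 v) $ i)"
        unfolding B_def coeff_sum coeff_1_monom_linear_power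
        by (simp add: eval_nat_numeral dp_0 algebra_simps)
      ultimately show ?thesis by (simp add: add.commute)
    qed
    define A where "A = (\<Sum>m\<le>4. monom (?E 1 (?F m v) $ i) m) + (\<Sum>m\<le>4. monom (9 * ?F m v $ i) (Suc m))"
    define B where "B = (\<Sum>m\<le>4. monom (?F m (?E 1 v) $ i) m) + (\<Sum>m\<le>4. monom (of_nat (N 0 m) * ?F m v $ i) (Suc m))"
    have "A = B"
    proof (rule poly_ext_infinite[OF infinite_alg_closed])
      fix s show "poly A s = poly B s"
        using 1[of s] by (simp only: A_def B_def poly_sum poly_monom poly_add mult_ac)
    qed
    then have "coeff A 1 = coeff B 1" by simp
    then have "?E 1 (?F 1 v) $ i + 9 * v $ i = ?F 1 (?E 1 v) $ i + of_nat (N 0 0) * v $ i"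
      unfolding A_def B_def by (simp add: coeff_sum eval_nat_numeral dp_0)
    moreover have "(of_nat (N 0 0) :: 'k) = 9 + of_int k"
      using k by (simp add: N_def of_nat_nat)
    ultimately show "ee r (ff r v) $ i = (ff r (ee r v) + of_int (pairing \<mu> r) *s v) $ i"
      by (simp add: k_def ee_def ff_def algebra_simps)
  qed
qed

text \<open>
  Defining the coroot as a commutator makes every map that commutes with the \<open>e\<^sub>i\<close> and \<open>f\<^sub>i\<close> commute
  with it as well.
\<close>

definition hh :: "simple_root \<Rightarrow> 'k ^ 'n \<Rightarrow> 'k ^ 'n" where
  "hh r v = ee r (ff r v) - ff r (ee r v)"

lemma hh_wt: "v \<in> wt \<mu> \<Longrightarrow> hh r v = of_int (pairing \<mu> r) *s v"
  by (simp add: hh_def e_f_commutator)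

lemma linear_hh: "Vector_Spaces.linear (*s) (*s) (hh r)"
proof -
  interpret E: Vector_Spaces.linear "(*s)" "(*s)" "ee r" by (rule linear_ee)
  interpret F: Vector_Spaces.linear "(*s)" "(*s)" "ff r" by (rule linear_ff)
  show ?thesis
    by unfold_locales (simp_all add: hh_def E.add F.add E.scale F.scale vec.scale_right_diff_distrib)
qed

lemma ee_wt: "v \<in> wt \<mu> \<Longrightarrow> ee r v \<in> wt (\<mu> + alpha r)"
  using dp_wt[OF root_vector_e, where n = 1] by (simp add: ee_def)

lemma ff_wt: "v \<in> wt \<mu> \<Longrightarrow> ff r v \<in> wt (\<mu> - alpha r)"
  using dp_wt[OF root_vector_f, where n = 1] by (simp add: ff_def)

lemma ee_ff_other: "i \<noteq> j \<Longrightarrow> ee i (ff j v) = ff j (ee i v)"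
  unfolding ee_def ff_def by (rule dp_commute)

lemma ee_ff_same: "ee i (ff i v) = ff i (ee i v) + hh i v"
  by (simp add: hh_def)

lemma hh_ff: "hh i (ff j v) = ff j (hh i v) - of_int (pairing (alpha j) i) *s ff j v"
proof -
  interpret F: Vector_Spaces.linear "(*s)" "(*s)" "ff j" by (rule linear_ff)
  interpret H: Vector_Spaces.linear "(*s)" "(*s)" "hh i" by (rule linear_hh)
  show ?thesis
  proof (rule weight_induct[where P = "\<lambda>v. hh i (ff j v) = ff j (hh i v) - of_int (pairing (alpha j) i) *s ff j v"])
    show "vec.subspace {v. hh i (ff j v) = ff j (hh i v) - of_int (pairing (alpha j) i) *s ff j v}"
      by (simp add: vec.subspace_def F.zero F.add F.scale H.zero H.add H.scale vec.scale_right_distrib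
          vec.scale_right_diff_distrib mult.commute)
  next
    fix \<mu> v assume v: "v \<in> wt \<mu>"
    have "pairing (\<mu> - alpha j) i = pairing \<mu> i - pairing (alpha j) i" by (cases i) auto
    then show "hh i (ff j v) = ff j (hh i v) - of_int (pairing (alpha j) i) *s ff j v"
      by (simp add: hh_wt[OF v] hh_wt[OF ff_wt[OF v]] F.scale vec.scale_left_diff_distrib)
  qed
qed

lemma not_above_lam: "wt (lam + alpha r) = {0}"
proof -
  have "v = 0" if v: "v \<in> wt (lam + alpha r)" for v
    using weight_bound(1,2)[OF v] by (cases r) auto
  then show ?thesis using wt_zero by blast
qed

text \<open>
  A functional supported on the highest weight space kills every \<open>ff r v\<close>: for a weight vector \<open>v\<close> this could
  fail only if \<open>v\<close> had weight \<open>lam + alpha r\<close>, which exceeds the highest weight.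
\<close>

lemma highest_functional:
  obtains v0 \<phi> where "v0 \<in> wt lam" "v0 \<noteq> 0" "\<And>r. ee r v0 = 0"
    "Vector_Spaces.linear (*s) (*) \<phi>" "\<phi> v0 = 1" "\<And>\<mu> v. v \<in> wt \<mu> \<Longrightarrow> \<mu> \<noteq> lam \<Longrightarrow> \<phi> v = 0"
    "\<And>r v. \<phi> (ff r v) = 0"
proof -
  obtain v0 where v0: "v0 \<in> wt lam" "v0 \<noteq> 0"
    using hw wt_zero[of lam] unfolding has_highest_weight_def by blast
  obtain P where P: "Vector_Spaces.linear (*s) (*s) P" "\<And>v. v \<in> wt lam \<Longrightarrow> P v = v"
    "\<And>\<mu> v. \<mu> \<in> box - {lam} \<Longrightarrow> v \<in> wt \<mu> \<Longrightarrow> P v = 0"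
    using weight_separating_projection[of "box - {lam}" lam] finite_box by auto
  interpret P: Vector_Spaces.linear "(*s)" "(*s)" P by (fact P)
  obtain i where i: "v0 $ i \<noteq> 0" using v0(2) by (auto simp: vec_eq_iff)
  define \<phi> where "\<phi> v = P v $ i / v0 $ i" for v
  have lin: "Vector_Spaces.linear (*s) (*) \<phi>"
    by unfold_locales (simp_all add: \<phi>_def P.add P.scale add_divide_distrib algebra_simps)
  interpret phi: Vector_Spaces.linear "(*s)" "(*)" \<phi> by (fact lin)
  have other: "\<phi> v = 0" if v: "v \<in> wt \<mu>" "\<mu> \<noteq> lam" for \<mu> v
  proof (cases "v = 0")
    case False
    with P(3)[OF _ v(1)] weight_in_box[OF v(1)] v(2) show ?thesis by (simp add: \<phi>_def)
  qed (simp add: phi.zero)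
  have "\<phi> (ff r v) = 0" for r v
  proof -
    interpret F: Vector_Spaces.linear "(*s)" "(*s)" "ff r" by (rule linear_ff)
    show ?thesis
    proof (rule weight_induct[where P = "\<lambda>v. \<phi> (ff r v) = 0"])
      show "vec.subspace {v. \<phi> (ff r v) = 0}"
        by (simp add: vec.subspace_def F.zero F.add F.scale phi.zero phi.add phi.scale)
    next
      fix \<mu> v assume v: "v \<in> wt \<mu>"
      show "\<phi> (ff r v) = 0"
      proof (cases "\<mu> - alpha r = lam")
        case True
        then have "v \<in> wt (lam + alpha r)" using v by auto
        then have "v = 0" using not_above_lam by blast
        then show ?thesis by (simp add: F.zero phi.zero)
      qed (use other ff_wt[OF v] in blast)
    qed
  qed
  moreover have "ee r v0 = 0" for r
    using ee_wt[OF v0(1), of r] not_above_lam by blast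
  moreover have "\<phi> v0 = 1" using i by (simp add: \<phi>_def P(2) v0)
  ultimately show thesis using that v0 lin other by blast
qed

end

section \<open>Maps out of highest weight modules\<close>

text \<open>
  The submodule of \<open>W \<oplus> V\<close> generated by a pair of highest weight vectors, built with the lowering
  operators only. It will turn out to be the graph of a homomorphism.
\<close>

inductive hw_graph :: "('k::field \<Rightarrow> 'w::ab_group_add \<Rightarrow> 'w) \<Rightarrow> ('r \<Rightarrow> 'w \<Rightarrow> 'w) \<Rightarrow> 'w \<Rightarrow>
    ('r \<Rightarrow> 'k ^ 'n \<Rightarrow> 'k ^ 'n) \<Rightarrow> 'k ^ 'n \<Rightarrow> 'w \<Rightarrow> 'k ^ 'n::finite \<Rightarrow> bool"
  for sc f w0 g v0 where
  base: "hw_graph sc f w0 g v0 w0 v0"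
| add: "hw_graph sc f w0 g v0 w v \<Longrightarrow> hw_graph sc f w0 g v0 w' v' \<Longrightarrow> hw_graph sc f w0 g v0 (w + w') (v + v')"
| scale: "hw_graph sc f w0 g v0 w v \<Longrightarrow> hw_graph sc f w0 g v0 (sc c w) (c *s v)"
| step: "hw_graph sc f w0 g v0 w v \<Longrightarrow> hw_graph sc f w0 g v0 (f i w) (g i v)"

context small_rep
begin

lemma irreducible_ef:
  assumes "vec.subspace U" "\<And>r v. v \<in> U \<Longrightarrow> ee r v \<in> U" "\<And>r v. v \<in> U \<Longrightarrow> ff r v \<in> U"
  shows "U = {0} \<or> U = UNIV"
  using assms unfolding ee_def ff_def by (rule irreducible_Lie)

text \<open>
  Let \<open>R\<close> be the submodule generated by \<open>(w0, v0)\<close>. It is stable under the raising operators because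
  the commutation relations express \<open>e\<close> applied to a word in the \<open>f\<^sub>i\<close> by words in the \<open>f\<^sub>i\<close> with the same
  coefficients on both sides. The set of all \<open>v\<close> with \<open>(0, v)\<close> in \<open>R\<close> is a submodule of the irreducible
  module \<open>V\<close>; it does not contain \<open>v0\<close>, because the functionals \<open>\<psi>\<close> and \<open>\<phi>\<close> that read off the coefficient of
  the highest weight vector agree on \<open>R\<close>. Hence it vanishes and \<open>R\<close> is the graph of a map, which is onto
  by irreducibility. The map respects the highest coefficient: if \<open>\<pi> w = 0\<close> then \<open>\<psi> w = 0\<close>.

  In the applications \<open>W\<close> is a space of functions and the module proper is a subset \<open>C\<close> of it.
\<close>

lemma hom_from_highest_weight_module:
  fixes sc :: "'k \<Rightarrow> 'w::ab_group_add \<Rightarrow> 'w" and eW fW hW :: "simple_root \<Rightarrow> 'w \<Rightarrow> 'w"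
  assumes sc: "vector_space sc"
    and lin: "\<And>i. Vector_Spaces.linear sc sc (eW i)" "\<And>i. Vector_Spaces.linear sc sc (fW i)"
      "\<And>i. Vector_Spaces.linear sc sc (hW i)"
    and C: "w0 \<in> C" "\<And>w w'. w \<in> C \<Longrightarrow> w' \<in> C \<Longrightarrow> w + w' \<in> C" "\<And>c w. w \<in> C \<Longrightarrow> sc c w \<in> C"
      "\<And>i w. w \<in> C \<Longrightarrow> fW i w \<in> C"
    and ef: "\<And>i j w. w \<in> C \<Longrightarrow> eW i (fW j w) = fW j (eW i w) + (if i = j then hW i w else 0)"
    and hf: "\<And>i j w. w \<in> C \<Longrightarrow> hW i (fW j w) = fW j (hW i w) - sc (of_int (pairing (alpha j) i)) (fW j w)"
    and w0: "\<And>i. eW i w0 = 0" "\<And>i. hW i w0 = sc (of_int (pairing lam i)) w0"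
    and psi: "Vector_Spaces.linear sc (*) \<psi>" "\<psi> w0 = 1" "\<And>i w. w \<in> C \<Longrightarrow> \<psi> (fW i w) = 0"
    and cyclic: "\<And>U. w0 \<in> U \<Longrightarrow> (\<And>w w'. w \<in> U \<Longrightarrow> w' \<in> U \<Longrightarrow> w + w' \<in> U) \<Longrightarrow>
      (\<And>c w. w \<in> U \<Longrightarrow> sc c w \<in> U) \<Longrightarrow> (\<And>i w. w \<in> U \<Longrightarrow> fW i w \<in> U) \<Longrightarrow> C \<subseteq> U"
  obtains \<pi> where "\<And>w w'. w \<in> C \<Longrightarrow> w' \<in> C \<Longrightarrow> \<pi> (w + w') = \<pi> w + \<pi> w'"
    "\<And>c w. w \<in> C \<Longrightarrow> \<pi> (sc c w) = c *s \<pi> w" "\<And>w. w \<in> C \<Longrightarrow> \<pi> w = 0 \<Longrightarrow> \<psi> w = 0"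
    "\<And>i w. w \<in> C \<Longrightarrow> eW i w \<in> C \<and> \<pi> (eW i w) = ee i (\<pi> w)"
    "\<And>i w. w \<in> C \<Longrightarrow> \<pi> (fW i w) = ff i (\<pi> w)" "\<And>v. \<exists>w\<in>C. \<pi> w = v"
proof -
  obtain v0 \<phi> where v0: "v0 \<in> wt lam" "v0 \<noteq> 0" "\<And>r. ee r v0 = 0"
    and phi: "Vector_Spaces.linear (*s) (*) \<phi>" "\<phi> v0 = 1" "\<And>r v. \<phi> (ff r v) = 0"
    using highest_functional by metis
  interpret W: vector_space sc by (fact sc)
  interpret phi: Vector_Spaces.linear "(*s)" "(*)" \<phi> by (fact phi)
  interpret psi: Vector_Spaces.linear sc "(*)" \<psi> by (fact psi)
  interpret E: Vector_Spaces.linear "(*s)" "(*s)" "ee i" for i by (rule linear_ee)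
  interpret F: Vector_Spaces.linear "(*s)" "(*s)" "ff i" for i by (rule linear_ff)
  interpret H: Vector_Spaces.linear "(*s)" "(*s)" "hh i" for i by (rule linear_hh)
  interpret eW: Vector_Spaces.linear sc sc "eW i" for i by (rule lin)
  interpret fW: Vector_Spaces.linear sc sc "fW i" for i by (rule lin)
  interpret hW: Vector_Spaces.linear sc sc "hW i" for i by (rule lin)
  define R where "R = hw_graph sc fW w0 ff v0"
  have R0: "R w0 v0" and Radd: "R w v \<Longrightarrow> R w' v' \<Longrightarrow> R (w + w') (v + v')"
    and Rscale: "R w v \<Longrightarrow> R (sc c w) (c *s v)" and Rf: "R w v \<Longrightarrow> R (fW i w) (ff i v)"
    for w v w' v' c i unfolding R_def by (auto intro: hw_graph.intros)
  have Rdiff: "R (w - w') (v - v')" if "R w v" "R w' v'" for w v w' v'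
    using Radd[OF that(1) Rscale[OF that(2), of "-1"]] by simp
  have Rzero: "R 0 0" using Rscale[OF R0, of 0] by simp
  have RC: "w \<in> C" if "R w v" for w v
    using that unfolding R_def by (induction rule: hw_graph.induct) (auto intro: C)
  have Reh: "(\<forall>i. R (eW i w) (ee i v)) \<and> (\<forall>i. R (hW i w) (hh i v))" if "R w v" for w v
    using that unfolding R_def
  proof (induction rule: hw_graph.induct)
    case base
    then show ?case
      using Rzero Rscale[OF R0] by (simp add: w0 v0 hh_wt[OF v0(1)] R_def)
  next
    case (add w v w' v')
    then show ?case using Radd by (simp add: eW.add hW.add E.add H.add R_def)
  next
    case (scale w v c)
    then show ?case using Rscale by (simp add: eW.scale hW.scale E.scale H.scale R_def)
  next
    case (step w v j)
    then have R: "R w v" "\<And>i. R (eW i w) (ee i v)" "\<And>i. R (hW i w) (hh i v)" by (simp_all add: R_def)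
    have "R (eW i (fW j w)) (ee i (ff j v))" for i
    proof (cases "i = j")
      case True
      then show ?thesis using Radd[OF Rf[OF R(2)] R(3)] by (simp add: ef[OF RC[OF R(1)]] ee_ff_same)
    next
      case False
      then show ?thesis using Rf[OF R(2)] by (simp add: ef[OF RC[OF R(1)]] ee_ff_other)
    qed
    moreover have "R (hW i (fW j w)) (hh i (ff j v))" for i
      unfolding hh_ff hf[OF RC[OF R(1)]] by (intro Rdiff Rscale Rf R)
    ultimately show ?case by (simp add: R_def)
  qed
  have Rphi: "\<phi> v = \<psi> w" if "R w v" for w v
    using that RC unfolding R_def
  proof (induction rule: hw_graph.induct)
    case base show ?case by (simp add: phi psi)
  next
    case add then show ?case by (simp add: phi.add psi.add)
  next
    case scale then show ?case by (simp add: phi.scale psi.scale)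
  next
    case (step w v i)
    then have "w \<in> C" using RC by (simp add: R_def)
    then show ?case by (simp add: phi psi)
  qed
  have zero: "v = 0" if "R 0 v" for v
  proof -
    have "vec.subspace {v. R 0 v}"
      unfolding vec.subspace_def using Rzero Radd[of 0 _ 0] Rscale[of 0] by auto
    then have "{v. R 0 v} = {0} \<or> {v. R 0 v} = UNIV"
    proof (rule irreducible_ef)
      fix r v assume v: "v \<in> {v. R 0 v}"
      show "ee r v \<in> {v. R 0 v}" using Reh[of 0 v] v eW.zero by auto
      show "ff r v \<in> {v. R 0 v}" using Rf[of 0 v r] v fW.zero by simp
    qed
    moreover have "\<not> R 0 v0" using Rphi[of 0 v0] phi(2) psi.zero by auto
    ultimately show ?thesis using that by blast
  qed
  have unique: "v = v'" if "R w v" "R w v'" for w v v'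
    using zero[of "v - v'"] Rdiff[OF that] by simp
  have onto: "\<exists>w. R w v" for v
  proof -
    let ?U = "{v. \<exists>w. R w v}"
    have "vec.subspace ?U"
      unfolding vec.subspace_def using Rzero Radd Rscale by blast
    then have "?U = {0} \<or> ?U = UNIV"
    proof (rule irreducible_ef)
      fix r v assume v: "v \<in> ?U"
      show "ee r v \<in> ?U" using Reh v by blast
      show "ff r v \<in> ?U" using Rf v by blast
    qed
    moreover have "v0 \<in> ?U" using R0 by blast
    ultimately show ?thesis using v0(2) by blast
  qed
  have domain: "\<exists>v. R w v" if "w \<in> C" for w
  proof -
    have "C \<subseteq> {w. \<exists>v. R w v}"
      by (rule cyclic) (use R0 Radd Rscale Rf in blast)+
    then show ?thesis using that by blast
  qed
  define \<pi> where "\<pi> w = (THE v. R w v)" for w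
  have pi: "\<pi> w = v" if "R w v" for w v
    unfolding \<pi>_def by (rule the_equality) (use that unique in blast)+
  have Rpi: "R w (\<pi> w)" if "w \<in> C" for w
    using domain[OF that] pi by auto
  show thesis
  proof (rule that[of \<pi>])
    show "\<pi> (w + w') = \<pi> w + \<pi> w'" if "w \<in> C" "w' \<in> C" for w w'
      by (intro pi Radd Rpi that)
    show "\<pi> (sc c w) = c *s \<pi> w" if "w \<in> C" for c w
      by (intro pi Rscale Rpi that)
    show "\<psi> w = 0" if "w \<in> C" "\<pi> w = 0" for w
      using Rphi[OF Rpi[OF that(1)]] that(2) phi.zero by simp
    show "eW i w \<in> C \<and> \<pi> (eW i w) = ee i (\<pi> w)" if "w \<in> C" for i w
      using Reh[OF Rpi[OF that]] RC pi by blast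
    show "\<pi> (fW i w) = ff i (\<pi> w)" if "w \<in> C" for i w
      by (intro pi Rf Rpi that)
    show "\<exists>w\<in>C. \<pi> w = v" for v
      using onto[of v] RC pi by blast
  qed
qed

end

section \<open>Differentiating rational modules\<close>

lemma functionals_separate:
  fixes sc :: "'k::field \<Rightarrow> 'v::ab_group_add \<Rightarrow> 'v"
  assumes sc: "vector_space sc" and "\<And>\<phi>. Vector_Spaces.linear sc (*) \<phi> \<Longrightarrow> \<phi> u = \<phi> v"
  shows "u = v"
proof (rule ccontr)
  assume ne: "u \<noteq> v"
  interpret vector_space_pair sc "(*) :: 'k \<Rightarrow> 'k \<Rightarrow> 'k"
    using sc by (simp add: vector_space_pair_def vector_space_over_itself.vector_space_axioms)
  have "vs1.independent {u - v}" using ne by (simp add: vs1.dependent_single)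
  then obtain g where g: "Vector_Spaces.linear sc (*) g" "g (u - v) = 1"
    using linear_independent_extend[of "{u - v}" "\<lambda>_. 1"] by auto
  interpret g: Vector_Spaces.linear sc "(*)" g by (rule g(1))
  have "g (u - v) = 0" using assms(2)[OF g(1)] by (simp add: g.diff)
  then show False using g(2) by simp
qed

lemma deriv_at_one_eqI:
  fixes f :: "'k::alg_closed_field mat4 \<Rightarrow> 'k"
  assumes "\<And>t. poly p t = f (unip X t)"
  shows "deriv_at_one f X = coeff p 1"
proof -
  have "(THE p. \<forall>t. poly p t = f (\<chi> i j. mat 1 $ i $ j + t * X $ i $ j)) = p"
    by (rule the_equality) (use assms in \<open>auto simp: unip_def intro!: poly_ext_infinite[OF infinite_alg_closed]\<close>)
  then show ?thesis by (simp add: deriv_at_one_def)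
qed

lemma polyfun_scale: "polyfun f \<Longrightarrow> polyfun (\<lambda>M. c * f M)"
  by (intro polyfun.mult polyfun.const)

lemma polyfun_sum:
  assumes "\<And>b. b \<in> B \<Longrightarrow> polyfun (f b)" shows "polyfun (\<lambda>M. \<Sum>b\<in>B. f b M)"
  using assms by (induction B rule: infinite_finite_induct) (auto intro: polyfun.intros)

text \<open>
  This is the defining property of the tangent space: derivatives in directions of the Lie algebra
  depend only on the restriction of a function to the group.
\<close>

lemma deriv_at_one_lie:
  fixes f g :: "'k::alg_closed_field mat4 \<Rightarrow> 'k"
  assumes X: "X \<in> lie_Sp4" and "polyfun f" "polyfun g" "\<And>h. h \<in> Sp4 \<Longrightarrow> f h = g h"
  shows "deriv_at_one f X = deriv_at_one g X"
proof -
  obtain p where p: "\<And>t. poly p t = f (unip X t)" using polyfun_on_line[OF assms(2)] by blast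
  obtain q where q: "\<And>t. poly q t = g (unip X t)" using polyfun_on_line[OF assms(3)] by blast
  have "deriv_at_one (\<lambda>M. f M + (-1) * g M) X = 0"
    using X assms polyfun.add[OF assms(2) polyfun_scale[OF assms(3), of "-1"]] unfolding lie_Sp4_def by fastforce
  moreover have "deriv_at_one (\<lambda>M. f M + (-1) * g M) X = coeff (p - q) 1"
    by (rule deriv_at_one_eqI) (simp add: p q)
  ultimately show ?thesis using deriv_at_one_eqI[OF p] deriv_at_one_eqI[OF q] by simp
qed

lemma simple_mats_lie: assumes "X \<in> simple_mats" shows "X \<in> (lie_Sp4 :: 'k::alg_closed_field mat4 set)"
proof -
  have "deriv_at_one f X = 0" if "\<forall>g\<in>Sp4. f g = 0" for f :: "'k mat4 \<Rightarrow> 'k"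
    by (subst deriv_at_one_eqI[of 0]) (use that unip_Sp4[OF assms] in auto)
  then show ?thesis by (auto simp: lie_Sp4_def)
qed

text \<open>
  The condition that characterises \<^const>\<open>differential\<close>. It has to be shown to have exactly one
  solution, as the definition uses a definite description.
\<close>

definition is_differential ::
  "('k::field \<Rightarrow> 'v::ab_group_add \<Rightarrow> 'v) \<Rightarrow> ('k mat4 \<Rightarrow> 'v \<Rightarrow> 'v) \<Rightarrow> 'k mat4 \<Rightarrow> 'v \<Rightarrow> 'v \<Rightarrow> bool" where
  "is_differential sc \<rho> X v u \<longleftrightarrow> (\<forall>\<phi> f.
     Vector_Spaces.linear sc (*) \<phi> \<and> polyfun f \<and> (\<forall>g\<in>Sp4. \<phi> (\<rho> g v) = f g) \<longrightarrow> \<phi> u = deriv_at_one f X)"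

lemma differential_eqI:
  assumes rat: "rational_module sc \<rho>" and u: "is_differential sc \<rho> X v u"
  shows "differential sc \<rho> X v = u"
  unfolding differential_def is_differential_def[symmetric]
proof (rule the_equality)
  show "is_differential sc \<rho> X v u" by (rule u)
  fix w assume w: "is_differential sc \<rho> X v w"
  show "w = u"
  proof (rule functionals_separate)
    show "vector_space sc" using rat by (simp add: rational_module_def)
    fix \<phi> assume phi: "Vector_Spaces.linear sc (*) \<phi>"
    then obtain f where "polyfun f" "\<forall>g\<in>Sp4. \<phi> (\<rho> g v) = f g"
      using rat unfolding rational_module_def by blast
    with phi u w show "\<phi> w = \<phi> u" unfolding is_differential_def by metis
  qed
qed

text \<open>
  Existence. On a basis \<open>B\<close> the coordinates of the orbit map are regular functions \<open>F b\<close>, and the vector with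
  coordinates \<open>deriv_at_one (F b) X\<close> works: for a functional \<open>\<phi>\<close> the function \<open>\<Sum> \<phi>(b) F b\<close> agrees on the group
  with any other regular function representing \<open>\<phi>\<close> on the orbit.
\<close>

lemma is_differential:
  fixes sc :: "'k::alg_closed_field \<Rightarrow> 'v::ab_group_add \<Rightarrow> 'v"
  assumes rat: "rational_module sc \<rho>" and X: "X \<in> lie_Sp4"
  shows "is_differential sc \<rho> X v (differential sc \<rho> X v)"
proof -
  have sc: "vector_space sc" using rat by (simp add: rational_module_def)
  interpret vector_space sc by (fact sc)
  obtain B0 where B0: "finite B0" "span B0 = UNIV" using rat by (auto simp: rational_module_def)
  obtain B where B: "B \<subseteq> B0" "independent B" "B0 \<subseteq> span B"
    using maximal_independent_subset[of B0] by blast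
  have fin: "finite B" using B(1) B0(1) finite_subset by blast
  have sp: "span B = UNIV" using B(3) B0(2) span_minimal[OF B(3) subspace_span] by auto
  have lin: "Vector_Spaces.linear sc (*) (\<lambda>v. representation B v b)" for b
  proof -
    interpret P: vector_space_pair sc "(*) :: 'k \<Rightarrow> 'k \<Rightarrow> 'k"
      using sc by (simp add: vector_space_pair_def vector_space_over_itself.vector_space_axioms)
    show ?thesis
      unfolding Vector_Spaces.linear_iff
      using sc vector_space_over_itself.vector_space_axioms sp B(2)
      by (auto simp: representation_add representation_scale)
  qed
  have expand: "w = (\<Sum>b\<in>B. sc (representation B w b) b)" for w
    using sum_representation_eq[OF B(2) _ fin order_refl, of w] sp by simp
  have "\<forall>b. \<exists>f. polyfun f \<and> (\<forall>g\<in>Sp4. representation B (\<rho> g v) b = f g)"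
    using rat lin unfolding rational_module_def by blast
  then obtain F where F: "\<And>b. polyfun (F b)" "\<And>b g. g \<in> Sp4 \<Longrightarrow> representation B (\<rho> g v) b = F b g"
    by metis
  have "\<forall>b. \<exists>p. \<forall>t. poly p t = F b (unip X t)" using polyfun_on_line[OF F(1)] by blast
  then obtain P where P: "\<And>b t. poly (P b) t = F b (unip X t)" by metis
  define u where "u = (\<Sum>b\<in>B. sc (deriv_at_one (F b) X) b)"
  have "is_differential sc \<rho> X v u"
    unfolding is_differential_def
  proof (intro allI impI, elim conjE)
    fix \<phi> f assume phi: "Vector_Spaces.linear sc (*) \<phi>" and f: "polyfun f" "\<forall>g\<in>Sp4. \<phi> (\<rho> g v) = f g"
    interpret phi: Vector_Spaces.linear sc "(*)" \<phi> by (fact phi)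
    have "deriv_at_one f X = deriv_at_one (\<lambda>M. \<Sum>b\<in>B. \<phi> b * F b M) X"
    proof (rule deriv_at_one_lie[OF X f(1)])
      show "polyfun (\<lambda>M. \<Sum>b\<in>B. \<phi> b * F b M)" by (intro polyfun_sum polyfun_scale F)
      fix h :: "'k mat4" assume h: "h \<in> Sp4"
      have "f h = \<phi> (\<rho> h v)" using f h by simp
      also have "\<dots> = (\<Sum>b\<in>B. representation B (\<rho> h v) b * \<phi> b)"
        by (subst expand) (simp only: phi.sum phi.scale)
      finally show "f h = (\<Sum>b\<in>B. \<phi> b * F b h)" using h by (simp add: F mult.commute)
    qed
    also have "\<dots> = coeff (\<Sum>b\<in>B. smult (\<phi> b) (P b)) 1"
      by (rule deriv_at_one_eqI) (simp add: poly_sum P)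
    also have "\<dots> = (\<Sum>b\<in>B. \<phi> b * deriv_at_one (F b) X)"
      by (simp add: coeff_sum deriv_at_one_eqI[OF P])
    also have "\<dots> = \<phi> u" by (simp add: u_def phi.sum phi.scale mult.commute)
    finally show "\<phi> u = deriv_at_one f X" ..
  qed
  with differential_eqI[OF rat this] show ?thesis by simp
qed

theorem Hom_G_subset_Hom_Lie:
  fixes sc :: "'k::alg_closed_field \<Rightarrow> 'v::ab_group_add \<Rightarrow> 'v"
  assumes "rational_module sc \<rho>" "rational_module sc' \<rho>'"
  shows "Hom_G sc \<rho> sc' \<rho>' \<subseteq> Hom_Lie sc \<rho> sc' \<rho>'"
proof
  fix F assume F: "F \<in> Hom_G sc \<rho> sc' \<rho>'"
  then have lin: "Vector_Spaces.linear sc sc' F" and eq: "\<And>g v. g \<in> Sp4 \<Longrightarrow> F (\<rho> g v) = \<rho>' g (F v)"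
    by (auto simp: Hom_G_def)
  have "differential sc' \<rho>' X (F v) = F (differential sc \<rho> X v)" if X: "X \<in> lie_Sp4" for X v
  proof (rule differential_eqI[OF assms(2)])
    show "is_differential sc' \<rho>' X (F v) (F (differential sc \<rho> X v))"
      unfolding is_differential_def
    proof (intro allI impI, elim conjE)
      fix \<phi> f assume *: "Vector_Spaces.linear sc' (*) \<phi>" "polyfun f" "\<forall>g\<in>Sp4. \<phi> (\<rho>' g (F v)) = f g"
      have "Vector_Spaces.linear sc (*) (\<phi> \<circ> F)"
        by (rule Vector_Spaces.linear_compose[OF lin *(1)])
      moreover have "\<forall>g\<in>Sp4. (\<phi> \<circ> F) (\<rho> g v) = f g" using * eq by simp
      ultimately have "(\<phi> \<circ> F) (differential sc \<rho> X v) = deriv_at_one f X"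
        using is_differential[OF assms(1) X, of v] *(2) unfolding is_differential_def by blast
      then show "\<phi> (F (differential sc \<rho> X v)) = deriv_at_one f X" by simp
    qed
  qed
  with lin show "F \<in> Hom_Lie sc \<rho> sc' \<rho>'" by (simp add: Hom_Lie_def)
qed

text \<open>
  For root vectors the differential is the linear coefficient of the root subgroup.
\<close>

lemma differential_curve:
  fixes sc :: "'k::alg_closed_field \<Rightarrow> 'v::ab_group_add \<Rightarrow> 'v"
  assumes rat: "rational_module sc \<rho>" and X: "X \<in> simple_mats" and N: "1 \<le> N"
    and c: "\<And>t. \<rho> (unip X t) v = (\<Sum>n\<le>N. sc (t ^ n) (c n))"
  shows "differential sc \<rho> X v = c 1"
proof (rule differential_eqI[OF rat], unfold is_differential_def, intro allI impI, elim conjE)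
  fix \<phi> f assume *: "Vector_Spaces.linear sc (*) \<phi>" "polyfun f" "\<forall>g\<in>Sp4. \<phi> (\<rho> g v) = f g"
  interpret phi: Vector_Spaces.linear sc "(*)" \<phi> by (fact *)
  have "deriv_at_one f X = coeff (\<Sum>n\<le>N. monom (\<phi> (c n)) n) 1"
  proof (rule deriv_at_one_eqI)
    fix t
    have "f (unip X t) = \<phi> (\<rho> (unip X t) v)" using *(3) unip_Sp4[OF X] by simp
    then show "poly (\<Sum>n\<le>N. monom (\<phi> (c n)) n) t = f (unip X t)"
      by (simp add: c phi.sum phi.scale poly_sum poly_monom mult.commute)
  qed
  also have "\<dots> = \<phi> (c 1)" using N by (simp add: coeff_sum if_distrib cong: if_cong)
  finally show "\<phi> (c 1) = deriv_at_one f X" ..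
qed

section \<open>The symmetric square as a rational module\<close>

abbreviation sp :: "'k::field ^ 'n \<Rightarrow> 'k ^ 'n \<Rightarrow> ('k, 'n::finite) sym2" where
  "sp v w \<equiv> abs_sym2 (tensor v w)"

lemma abs_sym2_add: "abs_sym2 (x + y) = abs_sym2 x + abs_sym2 y"
  by (simp add: plus_sym2.abs_eq)

lemma abs_sym2_scale: "abs_sym2 (c *s x) = sym2_scale c (abs_sym2 x)"
  by (simp add: sym2_scale.abs_eq)

lemma abs_sym2_zero: "abs_sym2 0 = 0"
  by (simp add: zero_sym2_def)

lemma sp_add: "sp (v + v') w = sp v w + sp v' w" "sp v (w + w') = sp v w + sp v w'"
  by (simp_all add: abs_sym2_add[symmetric] tensor_def vec_eq_iff algebra_simps plus_vec_def)

lemma sp_scale: "sp (c *s v) w = sym2_scale c (sp v w)" "sp v (c *s w) = sym2_scale c (sp v w)"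
  by (simp_all add: abs_sym2_scale[symmetric] tensor_def vec_eq_iff mult_ac vector_scalar_mult_def)

lemma sp_sum: "sp (\<Sum>i\<in>I. g i) w = (\<Sum>i\<in>I. sp (g i) w)" "sp v (\<Sum>i\<in>I. h i) = (\<Sum>i\<in>I. sp v (h i))"
proof -
  have z: "sp 0 w = 0" "sp v 0 = 0" for v w
    by (simp_all add: tensor_def abs_sym2_zero[symmetric] zero_vec_def)
  show "sp (\<Sum>i\<in>I. g i) w = (\<Sum>i\<in>I. sp (g i) w)"
    by (induction I rule: infinite_finite_induct) (simp_all add: sp_add z)
  show "sp v (\<Sum>i\<in>I. h i) = (\<Sum>i\<in>I. sp v (h i))"
    by (induction I rule: infinite_finite_induct) (simp_all add: sp_add z)
qed

lemma tensor_expand: "x = (\<Sum>p\<in>UNIV. x $ p *s tensor (axis (fst p) 1) (axis (snd p) 1))"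
  for x :: "'k::field ^ ('n::finite \<times> 'n)"
proof -
  have "tensor (axis (fst p) 1) (axis (snd p) 1) = (axis p 1 :: 'k ^ ('n \<times> 'n))" for p
    by (auto simp: tensor_def vec_eq_iff axis_def prod_eq_iff)
  then show ?thesis by (simp add: basis_expansion)
qed

lemma sym2_expand: "\<exists>c. z = (\<Sum>p\<in>UNIV. sym2_scale (c p) (sp (axis (fst p) 1) (axis (snd p) 1)))"
  for z :: "('k::field, 'n::finite) sym2"
proof -
  obtain x where z: "z = abs_sym2 x" by (metis Quotient3_abs_rep Quotient3_sym2)
  have "abs_sym2 (\<Sum>p\<in>I. g p) = (\<Sum>p\<in>I. abs_sym2 (g p))" for g :: "'n \<times> 'n \<Rightarrow> 'k ^ ('n \<times> 'n)" and I
    by (induction I rule: infinite_finite_induct) (simp_all add: abs_sym2_add abs_sym2_zero)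
  then have "z = (\<Sum>p\<in>UNIV. sym2_scale (x $ p) (sp (axis (fst p) 1) (axis (snd p) 1)))"
    unfolding z by (subst tensor_expand) (simp add: abs_sym2_scale)
  then show ?thesis by blast
qed

lemma sym2_induct:
  fixes z :: "('k::field, 'n::finite) sym2"
  assumes sp: "\<And>v w. P (sp v w)" and add: "\<And>x y. P x \<Longrightarrow> P y \<Longrightarrow> P (x + y)"
  shows "P z"
proof -
  have zero: "P 0" using sp[of 0 0] by (simp add: tensor_def abs_sym2_zero[symmetric] zero_vec_def)
  obtain c where c: "z = (\<Sum>p\<in>UNIV. sym2_scale (c p) (sp (axis (fst p) 1) (axis (snd p) 1)))"
    using sym2_expand by blast
  have "P (\<Sum>p\<in>I. sym2_scale (c p) (sp (axis (fst p) 1) (axis (snd p) 1)))" for I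
    by (induction I rule: infinite_finite_induct) (simp_all add: zero add sp sp_scale(1)[symmetric])
  then show ?thesis unfolding c .
qed

lemma linear_sym2_map: "Vector_Spaces.linear sym2_scale sym2_scale (sym2_map T)"
  for T :: "'k::field ^ 'n \<Rightarrow> 'k ^ 'n::finite"
proof -
  have "sym2_map T (x + y) = sym2_map T x + sym2_map T y" for x y :: "('k, 'n) sym2"
    by transfer (simp add: tensor_map_def vec.scale_left_distrib sum.distrib sym2_eq_refl)
  moreover have "sym2_map T (sym2_scale c x) = sym2_scale c (sym2_map T x)" for c and x :: "('k, 'n) sym2"
    by transfer (simp add: tensor_map_def vec.scale_sum_right sym2_eq_refl)
  ultimately show ?thesis
    by (simp add: Vector_Spaces.linear_iff vector_space_sym2)
qed

text \<open>
  The universal property of the symmetric square.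
\<close>

lemma linear_sym2_lift:
  fixes \<beta> :: "'k::field ^ 'n \<Rightarrow> 'k ^ 'n \<Rightarrow> 'k ^ 'm::finite"
  assumes add: "\<And>u v w. \<beta> (u + v) w = \<beta> u w + \<beta> v w" and scale: "\<And>c v w. \<beta> (c *s v) w = c *s \<beta> v w"
    and commute: "\<And>v w. \<beta> v w = \<beta> w v"
  obtains F where "Vector_Spaces.linear sym2_scale (*s) F" "\<And>v w :: 'k ^ 'n::finite. F (sp v w) = \<beta> v w"
proof -
  define T where "T x = (\<Sum>p\<in>UNIV. x $ p *s \<beta> (axis (fst p) 1) (axis (snd p) 1))" for x :: "'k ^ ('n \<times> 'n)"
  have linT: "Vector_Spaces.linear (*s) (*s) T"
    by unfold_locales (simp_all add: T_def vec.scale_left_distrib sum.distrib vec.scale_sum_right)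
  interpret T: Vector_Spaces.linear "(*s)" "(*s)" T by (fact linT)
  have L: "Vector_Spaces.linear (*s) (*s) (\<lambda>v. \<beta> v w)" for w
    by unfold_locales (simp_all add: add scale)
  have R: "Vector_Spaces.linear (*s) (*s) (\<beta> v)" for v
    by unfold_locales (simp_all add: add scale commute[of v])
  have ex: "\<beta> v w = (\<Sum>i\<in>UNIV. \<Sum>j\<in>UNIV. (v $ i * w $ j) *s \<beta> (axis i 1) (axis j 1))" for v w
  proof -
    have "\<beta> v w = (\<Sum>i\<in>UNIV. v $ i *s \<beta> (axis i 1) w)"
    proof -
      interpret L: Vector_Spaces.linear "(*s)" "(*s)" "\<lambda>v. \<beta> v w" by (rule L)
      show ?thesis by (subst basis_expansion[of v, symmetric]) (simp only: L.sum L.scale)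
    qed
    moreover have "\<beta> u w = (\<Sum>j\<in>UNIV. w $ j *s \<beta> u (axis j 1))" for u
    proof -
      interpret R: Vector_Spaces.linear "(*s)" "(*s)" "\<beta> u" by (rule R)
      show ?thesis by (subst basis_expansion[of w, symmetric]) (simp only: R.sum R.scale)
    qed
    ultimately show ?thesis by (simp add: vec.scale_sum_right)
  qed
  have T_tensor: "T (tensor v w) = \<beta> v w" for v w
    unfolding ex[of v w] by (simp add: T_def tensor_def sum.cartesian_product case_prod_unfold)
  have ker: "T x = 0" if "x \<in> swap_span" for x
  proof -
    have "swap_span \<subseteq> {x. T x = 0}"
      unfolding swap_span_def
      by (rule vec.span_minimal)
         (auto simp: T.diff T_tensor commute vec.subspace_def T.zero T.add T.scale)
    then show ?thesis using that by blast
  qed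
  define F where "F z = T (rep_sym2 z)" for z
  have F_abs: "F (abs_sym2 x) = T x" for x
  proof -
    have "sym2_eq (rep_sym2 (abs_sym2 x)) x"
      by (rule rep_abs_rsp_left[OF Quotient3_sym2]) (rule sym2_eq_refl)
    then have "T (rep_sym2 (abs_sym2 x) - x) = 0" unfolding sym2_eq_def by (rule ker)
    then show ?thesis by (simp add: F_def T.diff)
  qed
  have abs: "\<exists>x. z = abs_sym2 x" for z :: "('k, 'n) sym2" by (metis Quotient3_abs_rep Quotient3_sym2)
  have "F (z + z') = F z + F z'" for z z'
    using abs[of z] abs[of z'] by (auto simp: abs_sym2_add[symmetric] F_abs T.add)
  moreover have "F (sym2_scale c z) = c *s F z" for c z
    using abs[of z] by (auto simp: abs_sym2_scale[symmetric] F_abs T.scale)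
  ultimately have "Vector_Spaces.linear sym2_scale (*s) F"
    by (simp add: Vector_Spaces.linear_iff vector_space_sym2 vec.vector_space_axioms)
  moreover have "F (sp v w) = \<beta> v w" for v w by (simp add: F_abs T_tensor)
  ultimately show thesis using that by blast
qed

lemma rational_sym2:
  fixes \<rho> :: "('k::alg_closed_field) mat4 \<Rightarrow> 'k ^ 'n \<Rightarrow> 'k ^ 'n::finite"
  assumes "rational_module (*s) \<rho>"
  shows "rational_module sym2_scale (\<lambda>g. sym2_map (\<rho> g))"
proof -
  interpret rational_rep \<rho> by unfold_locales (fact assms)
  interpret S: vector_space "sym2_scale :: 'k \<Rightarrow> ('k, 'n) sym2 \<Rightarrow> _" by (rule vector_space_sym2)
  have map_sp: "sym2_map (\<rho> g) (sp v w) = sp (\<rho> g v) (\<rho> g w)" if "g \<in> Sp4" for g v w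
    using sym2_map_tensor[OF linear_rho[OF that]] .
  have map_add: "sym2_map T (x + y) = sym2_map T x + sym2_map T y" for T and x y :: "('k, 'n) sym2"
    using linear_sym2_map[of T] by (simp add: Vector_Spaces.linear_iff)
  have "\<exists>B. finite B \<and> S.span B = UNIV"
  proof (intro exI conjI)
    let ?B = "range (\<lambda>p. sp (axis (fst p) 1) (axis (snd p) 1)) :: ('k, 'n) sym2 set"
    show "finite ?B" by simp
    have "z \<in> S.span ?B" for z
    proof -
      obtain c where "z = (\<Sum>p\<in>UNIV. sym2_scale (c p) (sp (axis (fst p) 1) (axis (snd p) 1)))"
        using sym2_expand by blast
      moreover have "\<dots> \<in> S.span ?B" by (intro S.span_sum S.span_scale S.span_base) blast
      ultimately show ?thesis by simp
    qed
    then show "S.span ?B = UNIV" by blast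
  qed
  moreover have "sym2_map (\<rho> (mat 1)) = id"
  proof
    fix z :: "('k, 'n) sym2"
    have m: "mat 1 \<in> (Sp4 :: 'k mat4 set)" using unip_Sp4[OF simple_mats_mem(1), of _ 0] by simp
    show "sym2_map (\<rho> (mat 1)) z = id z"
    proof (induction z rule: sym2_induct)
      case (1 v w)
      show ?case unfolding map_sp[OF m] by (simp add: rho_one)
    qed (simp only: map_add id_apply)
  qed
  moreover have "sym2_map (\<rho> (g ** h)) = sym2_map (\<rho> g) \<circ> sym2_map (\<rho> h)" if "g \<in> Sp4" "h \<in> Sp4" for g h
  proof
    fix z :: "('k, 'n) sym2"
    show "sym2_map (\<rho> (g ** h)) z = (sym2_map (\<rho> g) \<circ> sym2_map (\<rho> h)) z"
    proof (induction z rule: sym2_induct)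
      case (1 v w)
      show ?case unfolding map_sp[OF Sp4_mult[OF that]] by (simp add: map_sp that rho_mult)
    qed (simp only: map_add o_apply)
  qed
  moreover have "\<exists>f. polyfun f \<and> (\<forall>g\<in>Sp4. \<phi> (sym2_map (\<rho> g) z) = f g)"
    if phi: "Vector_Spaces.linear sym2_scale (*) \<phi>" for \<phi> and z :: "('k, 'n) sym2"
  proof (induction z rule: sym2_induct)
    interpret phi: Vector_Spaces.linear sym2_scale "(*)" \<phi> by (fact phi)
    {
      case (1 v w)
      have "\<exists>f. polyfun f \<and> (\<forall>g\<in>Sp4. \<rho> g u $ i = f g)" for u i
        using assms linear_component[of i] unfolding rational_module_def by blast
      then obtain c where c: "\<And>u i. polyfun (c u i)" "\<And>u i g. g \<in> Sp4 \<Longrightarrow> \<rho> g u $ i = c u i g"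
        by metis
      let ?f = "\<lambda>g. \<Sum>i\<in>UNIV. \<Sum>j\<in>UNIV. (c v i g * c w j g) * \<phi> (sp (axis i 1) (axis j 1))"
      have "polyfun ?f" by (intro polyfun_sum polyfun.mult c polyfun.const)
      moreover have "\<phi> (sym2_map (\<rho> g) (sp v w)) = ?f g" if g: "g \<in> Sp4" for g
      proof -
        have coords: "sp x y = (\<Sum>i\<in>UNIV. \<Sum>j\<in>UNIV. sym2_scale (x $ i * y $ j) (sp (axis i 1) (axis j 1)))" for x y :: "'k ^ 'n"
        proof -
          have "sp x y = sp (\<Sum>i\<in>UNIV. x $ i *s axis i 1) (\<Sum>j\<in>UNIV. y $ j *s axis j 1)"
            by (simp only: basis_expansion)
          also have "\<dots> = (\<Sum>j\<in>UNIV. \<Sum>i\<in>UNIV. sym2_scale (y $ j * x $ i) (sp (axis i 1) (axis j 1)))"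
            by (simp only: sp_sum sp_scale S.scale_sum_right S.scale_scale)
          finally show ?thesis by (subst sum.swap) (simp add: mult.commute)
        qed
        show ?thesis
          unfolding map_sp[OF g] by (subst coords) (simp only: phi.sum phi.scale c(2)[OF g])
      qed
      ultimately show ?case by blast
    next
      case (2 x y)
      then obtain f f' where "polyfun f" "\<forall>g\<in>Sp4. \<phi> (sym2_map (\<rho> g) x) = f g"
        "polyfun f'" "\<forall>g\<in>Sp4. \<phi> (sym2_map (\<rho> g) y) = f' g" by blast
      then show ?case
        by (intro exI[of _ "\<lambda>g. f g + f' g"]) (auto intro: polyfun.add simp: map_add phi.add)
    }
  qed
  ultimately show ?thesis
    unfolding rational_module_def using vector_space_sym2 linear_sym2_map by blast
qed

type_synonym 'k bipoly = "nat \<Rightarrow> nat \<Rightarrow> 'k"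

type_synonym 'k sqmat = "2 + 2 \<Rightarrow> 2 + 2 \<Rightarrow> 'k"

section \<open>The Weil module on truncated polynomials\<close>

definition fscale :: "'k::field \<Rightarrow> ('a \<Rightarrow> 'b \<Rightarrow> 'k) \<Rightarrow> 'a \<Rightarrow> 'b \<Rightarrow> 'k" where
  "fscale c u = (\<lambda>a b. c * u a b)"

lemma fscale_apply [simp]: "fscale c u a b = c * u a b"
  by (simp add: fscale_def)

lemma vector_space_fscale: "vector_space fscale"
  by unfold_locales (simp_all add: fun_eq_iff algebra_simps)

lemma linear_fscale_iff:
  "Vector_Spaces.linear fscale fscale h \<longleftrightarrow>
    (\<forall>u v. h (u + v) = h u + h v) \<and> (\<forall>c u. h (fscale c u) = fscale c (h u))"
  by (auto simp: Vector_Spaces.linear_iff vector_space_fscale)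

text \<open>
  A function \<open>u\<close> stands for the element \<open>\<Sum> u a b x\<^sup>a y\<^sup>b\<close> of \<open>k[x, y]/(x\<^sup>5, y\<^sup>5)\<close>, and the four operators
  are multiplication by \<open>x\<close> and \<open>y\<close> and the two partial derivatives. The derivatives are well defined on
  the quotient because the derivative of \<open>x\<^sup>5\<close> is \<open>0\<close> in characteristic \<open>5\<close>.
\<close>

definition mX :: "('k::field) bipoly \<Rightarrow> 'k bipoly" where
  "mX u a b = (if 1 \<le> a \<and> a \<le> 4 then u (a - 1) b else 0)"
definition mY :: "('k::field) bipoly \<Rightarrow> 'k bipoly" where
  "mY u a b = (if 1 \<le> b \<and> b \<le> 4 then u a (b - 1) else 0)"
definition dX :: "('k::field) bipoly \<Rightarrow> 'k bipoly" where
  "dX u a b = (if a < 4 then of_nat (a + 1) * u (a + 1) b else 0)"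
definition dY :: "('k::field) bipoly \<Rightarrow> 'k bipoly" where
  "dY u a b = (if b < 4 then of_nat (b + 1) * u a (b + 1) else 0)"

lemmas weyl_defs = mX_def mY_def dX_def dY_def

text \<open>
  The root vectors act by \<open>x \<partial>\<^sub>y\<close>, \<open>y\<^sup>2/2\<close>, \<open>y \<partial>\<^sub>x\<close> and \<open>- \<partial>\<^sub>y\<^sup>2/2\<close>; modulo \<open>5\<close> the constants \<open>1/2\<close> and
  \<open>- 1/2\<close> are \<open>3\<close> and \<open>2\<close>.
\<close>

fun eW :: "simple_root \<Rightarrow> ('k::field) bipoly \<Rightarrow> 'k bipoly" where
  "eW Short u = mX (dY u)"
| "eW Long u = fscale 3 (mY (mY u))"

fun fW :: "simple_root \<Rightarrow> ('k::field) bipoly \<Rightarrow> 'k bipoly" where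
  "fW Short u = mY (dX u)"
| "fW Long u = fscale 2 (dY (dY u))"

text \<open>
  The monomial \<open>x\<^sup>a y\<^sup>b\<close> has weight \<open>(a + 1/2, b + 1/2)\<close>, which is \<open>(a - 2, b - 2)\<close> modulo \<open>5\<close>.
\<close>

fun hW :: "simple_root \<Rightarrow> ('k::field) bipoly \<Rightarrow> 'k bipoly" where
  "hW Short u = (\<lambda>a b. (of_nat a - of_nat b) * u a b)"
| "hW Long u = (\<lambda>a b. (of_nat b - 2) * u a b)"

definition trunc :: "('k::field) bipoly set" where
  "trunc = {u. \<forall>a b. a > 4 \<or> b > 4 \<longrightarrow> u a b = 0}"

definition odd_trunc :: "('k::field) bipoly set" where
  "odd_trunc = {u. \<forall>a b. a > 4 \<or> b > 4 \<or> even (a + b) \<longrightarrow> u a b = 0}"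

definition xy_monom :: "nat \<Rightarrow> nat \<Rightarrow> ('k::field) bipoly" where
  "xy_monom a b = (\<lambda>x y. if x = a \<and> y = b then 1 else 0)"

lemma linear_W:
  "Vector_Spaces.linear fscale fscale (eW i)" "Vector_Spaces.linear fscale fscale (fW i)"
  "Vector_Spaces.linear fscale fscale (hW i)"
  unfolding linear_fscale_iff by (cases i; auto simp: fun_eq_iff weyl_defs algebra_simps)+

lemma odd_trunc_closed:
  "u \<in> odd_trunc \<Longrightarrow> v \<in> odd_trunc \<Longrightarrow> u + v \<in> odd_trunc"
  "u \<in> odd_trunc \<Longrightarrow> fscale c u \<in> odd_trunc"
  "u \<in> odd_trunc \<Longrightarrow> fW i u \<in> odd_trunc" "u \<in> odd_trunc \<Longrightarrow> eW i u \<in> odd_trunc"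
  by (cases i; auto simp: odd_trunc_def weyl_defs)+

lemma char_5_simps:
  assumes "CHAR('k::field) = 5"
  shows "(5::'k) = 0" "(2::'k) \<noteq> 0" "(3::'k) \<noteq> 0" "(4::'k) \<noteq> 0" "(1::'k) + 4 = 0"
proof -
  have "(of_nat n :: 'k) = 0 \<longleftrightarrow> 5 dvd n" for n
    using assms by (simp add: of_nat_eq_0_iff_char_dvd)
  from this[of 5] this[of 2] this[of 3] this[of 4]
  show "(5::'k) = 0" "(2::'k) \<noteq> 0" "(3::'k) \<noteq> 0" "(4::'k) \<noteq> 0" "(1::'k) + 4 = 0" by simp_all
qed

lemma odd_cases:
  assumes "\<not> (a > 4 \<or> b > 4 \<or> even (a + b))"
  shows "(a, b) \<in> {(4,3), (4,1), (3,4), (3,2), (3,0), (2,3), (2,1), (1,4), (1,2), (1,0), (0,3), (0,1::nat)}"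
proof -
  have "a = 0 \<or> a = 1 \<or> a = 2 \<or> a = 3 \<or> a = 4" "b = 0 \<or> b = 1 \<or> b = 2 \<or> b = 3 \<or> b = 4"
    using assms by auto
  then show ?thesis by (elim disjE) (use assms in simp_all)
qed

text \<open>
  The two moves \<open>(a + 1, b) \<mapsto> (a, b + 1)\<close> and \<open>(a, b + 2) \<mapsto> (a, b)\<close> are those of the two lowering operators, so
  this says that \<open>x\<^sup>4 y\<^sup>3\<close> generates the odd part. Read backwards, along the raising operators, it says that
  every coefficient can be moved to the place of \<open>x\<^sup>4 y\<^sup>3\<close>. Both uses follow.
\<close>

lemma odd_exponent_induct:
  assumes "Z 4 3" and S: "\<And>a b. a < 4 \<Longrightarrow> b < 4 \<Longrightarrow> Z (Suc a) b \<Longrightarrow> Z a (Suc b)"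
    and L: "\<And>a b. b \<le> 2 \<Longrightarrow> Z a (Suc (Suc b)) \<Longrightarrow> Z a b"
    and ab: "\<not> (a > 4 \<or> b > 4 \<or> even (a + b))"
  shows "Z a (b::nat)"
proof -
  note Z43 = assms(1)
  have Z41: "Z 4 1" using L[of 1 4] Z43 by (simp add: eval_nat_numeral)
  have Z34: "Z 3 4" using S[of 3 3] Z43 by (simp add: eval_nat_numeral)
  have Z32: "Z 3 2" using L[of 2 3] Z34 by (simp add: eval_nat_numeral)
  have Z30: "Z 3 0" using L[of 0 3] Z32 by (simp add: eval_nat_numeral)
  have Z23: "Z 2 3" using S[of 2 2] Z32 by (simp add: eval_nat_numeral)
  have Z21: "Z 2 1" using L[of 1 2] Z23 by (simp add: eval_nat_numeral)
  have Z14: "Z 1 4" using S[of 1 3] Z23 by (simp add: eval_nat_numeral)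
  have Z12: "Z 1 2" using L[of 2 1] Z14 by (simp add: eval_nat_numeral)
  have Z10: "Z 1 0" using L[of 0 1] Z12 by (simp add: eval_nat_numeral)
  have Z03: "Z 0 3" using S[of 0 2] Z12 by (simp add: eval_nat_numeral)
  have Z01: "Z 0 1" using L[of 1 0] Z03 by (simp add: eval_nat_numeral)
  show ?thesis
    using odd_cases[OF ab] Z43 Z41 Z34 Z32 Z30 Z23 Z21 Z14 Z12 Z10 Z03 Z01 by auto
qed

lemma fW_xy_monom:
  "a < 4 \<Longrightarrow> b < 4 \<Longrightarrow> fW Short (xy_monom (Suc a) b) = fscale (of_nat (Suc a)) (xy_monom a (Suc b))"
  "b \<le> 2 \<Longrightarrow> fW Long (xy_monom a (Suc (Suc b))) = fscale (2 * (of_nat (Suc b) * of_nat (Suc (Suc b)))) (xy_monom a b)"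
  by (auto simp: fun_eq_iff weyl_defs xy_monom_def)

lemma odd_trunc_expand:
  fixes u :: "('k::field) bipoly"
  assumes "u \<in> odd_trunc"
  shows "u = (\<Sum>a\<le>4. \<Sum>b\<le>4. fscale (u a b) (xy_monom a b))"
proof (intro ext)
  fix x y
  have app: "sum g I x y = (\<Sum>i\<in>I. g i x y)" for g :: "nat \<Rightarrow> 'k bipoly" and I
    by (induction I rule: infinite_finite_induct) simp_all
  have "(\<Sum>a\<le>4. \<Sum>b\<le>4. fscale (u a b) (xy_monom a b)) x y
      = (\<Sum>a\<le>4. \<Sum>b\<le>4. if x = a \<and> y = b then u a b else 0)"
    unfolding app by (intro sum.cong refl) (simp add: xy_monom_def)
  also have "\<dots> = (\<Sum>a\<le>4. if x = a then (\<Sum>b\<le>4. if y = b then u a b else 0) else 0)"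
    by (intro sum.cong refl) simp
  also have "\<dots> = u x y" using assms by (auto simp: odd_trunc_def)
  finally show "u x y = (\<Sum>a\<le>4. \<Sum>b\<le>4. fscale (u a b) (xy_monom a b)) x y" ..
qed

lemma odd_trunc_span:
  fixes U :: "('k::field) bipoly set"
  assumes mono: "\<And>a b. a \<le> 4 \<Longrightarrow> b \<le> 4 \<Longrightarrow> odd (a + b) \<Longrightarrow> xy_monom a b \<in> U"
    and add: "\<And>w w'. w \<in> U \<Longrightarrow> w' \<in> U \<Longrightarrow> w + w' \<in> U" and scale: "\<And>c w. w \<in> U \<Longrightarrow> fscale c w \<in> U"
    and u: "u \<in> odd_trunc"
  shows "u \<in> U"
proof -
  have zero: "0 \<in> U" using scale[OF mono[of 0 1], of 0] by (simp add: fscale_def zero_fun_def)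
  have sum: "sum g I \<in> U" if "\<And>i. i \<in> I \<Longrightarrow> g i \<in> U" for g :: "nat \<Rightarrow> _" and I
    using that by (induction I rule: infinite_finite_induct) (auto intro: zero add)
  have "fscale (u a b) (xy_monom a b) \<in> U" if "a \<le> 4" "b \<le> 4" for a b
  proof (cases "even (a + b)")
    case True
    then have "u a b = 0" using u unfolding odd_trunc_def by blast
    then have "fscale (u a b) (xy_monom a b) = 0" by (simp add: fun_eq_iff)
    then show ?thesis using zero by simp
  qed (use mono scale that in blast)
  then show ?thesis
    by (subst odd_trunc_expand[OF u]) (intro sum; simp)
qed

lemma weyl_commute:
  "mX (mY u) = mY (mX u)" "dX (dY u) = dY (dX u)" "mX (dY u) = dY (mX u)" "mY (dX u) = dX (mY u)"
  by (auto simp: fun_eq_iff weyl_defs)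

lemma trunc_closed:
  "u \<in> trunc \<Longrightarrow> mX u \<in> trunc" "u \<in> trunc \<Longrightarrow> mY u \<in> trunc" "u \<in> trunc \<Longrightarrow> dX u \<in> trunc"
  "u \<in> trunc \<Longrightarrow> dY u \<in> trunc" "u \<in> odd_trunc \<Longrightarrow> u \<in> trunc"
  by (auto simp: weyl_defs trunc_def odd_trunc_def)

context
  assumes char5: "CHAR('k::field) = 5"
begin

lemma of_nat_neq_0_mod_5: "0 < n \<Longrightarrow> n < 5 \<Longrightarrow> (of_nat n :: 'k) \<noteq> 0"
  unfolding of_nat_eq_0_iff_char_dvd char5 by (auto dest: dvd_imp_le)

text \<open>
  At the top exponent \<open>4\<close> multiplication by \<open>x\<close> gives zero, and the relation survives because
  \<open>\<partial>\<^sub>x x\<^sup>5 = 5 x\<^sup>4 = 0\<close>.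
\<close>

lemma weyl_relations:
  fixes u :: "'k bipoly"
  assumes "u \<in> trunc"
  shows "dX (mX u) = mX (dX u) + u" "dY (mY u) = mY (dY u) + u"
  using assms char_5_simps[OF char5]
  by (auto simp: fun_eq_iff weyl_defs trunc_def algebra_simps not_less le_Suc_eq eval_nat_numeral)

lemma eW_fW:
  fixes u :: "'k bipoly"
  assumes "u \<in> odd_trunc"
  shows "eW i (fW j u) = fW j (eW i u) + (if i = j then hW i u else 0)"
proof -
  note t = trunc_closed(5)[OF assms]
  have add: "mX (v + w) = mX v + mX w" "mY (v + w) = mY v + mY w" for v w :: "'k bipoly"
    by (auto simp: fun_eq_iff weyl_defs)
  have number: "mX (dX u) a b = of_nat a * u a b" "mY (dY u) a b = of_nat b * u a b" for a b
    using t by (auto simp: weyl_defs trunc_def not_le)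
  have "(10 :: 'k) = 5 * 2" "(35 :: 'k) = 5 * 7" "(12 :: 'k) = 2 + 5 * 2" "(72 :: 'k) = 2 + 5 * 14"
    "(36 :: 'k) = 1 + 5 * 7" "(6 :: 'k) = 1 + 5" by simp_all
  then have mod_5: "(10 :: 'k) = 0" "(35 :: 'k) = 0" "(12 :: 'k) = 2" "(72 :: 'k) = 2" "(36 :: 'k) = 1" "(6 :: 'k) = 1"
    by (simp_all only: char_5_simps(1)[OF char5] mult_zero_left add_0_right)
  show ?thesis
  proof (cases i; cases j)
    assume "i = Short" "j = Short"
    moreover have "mX (dY (mY (dX u))) = mX (mY (dX (dY u))) + mX (dX u)"
      by (simp add: weyl_relations(2) trunc_closed t add weyl_commute(2))
    moreover have "mY (dX (mX (dY u))) = mX (mY (dX (dY u))) + mY (dY u)"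
      by (simp add: weyl_relations(1) trunc_closed t add weyl_commute(1))
    ultimately show ?thesis by (simp add: fun_eq_iff number algebra_simps)
  next
    assume ij: "i = Long" "j = Long"
    have "eW Long (fW Long u) a b = fW Long (eW Long u) a b + hW Long u a b" for a b
    proof (cases "b > 4")
      case True
      then show ?thesis using t by (simp add: weyl_defs trunc_def)
    next
      case False
      then have "b = 0 \<or> b = 1 \<or> b = 2 \<or> b = 3 \<or> b = 4" by auto
      then consider "b = 0" | "b = 1" | "b = 2" | "b = 3" | "b = 4" by blast
      then show ?thesis
        by cases (simp_all add: weyl_defs mod_5 eval_nat_numeral)
    qed
    then show ?thesis using ij by (simp add: fun_eq_iff)
  next
    assume "i = Short" "j = Long"
    then show ?thesis by (auto simp: fun_eq_iff weyl_defs)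
  next
    assume "i = Long" "j = Short"
    then show ?thesis by (auto simp: fun_eq_iff weyl_defs)
  qed
qed

lemma hW_fW:
  fixes u :: "'k bipoly"
  assumes "u \<in> odd_trunc"
  shows "hW i (fW j u) = fW j (hW i u) - fscale (of_int (pairing (alpha j) i)) (fW j u)"
  using char_5_simps[OF char5]
  by (cases i; cases j; auto simp: fun_eq_iff weyl_defs algebra_simps of_nat_diff)

lemma odd_trunc_cyclic:
  fixes U :: "'k bipoly set"
  assumes "xy_monom 4 3 \<in> U" and add: "\<And>w w'. w \<in> U \<Longrightarrow> w' \<in> U \<Longrightarrow> w + w' \<in> U"
    and scale: "\<And>c w. w \<in> U \<Longrightarrow> fscale c w \<in> U" and f: "\<And>i w. w \<in> U \<Longrightarrow> fW i w \<in> U"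
  shows "odd_trunc \<subseteq> U"
proof
  fix u :: "'k bipoly" assume u: "u \<in> odd_trunc"
  have cancel: "w \<in> U" if "fscale c w \<in> U" "c \<noteq> 0" for c w
    using scale[OF that(1), of "inverse c"] that(2) by (simp add: fscale_def mult.assoc[symmetric])
  have mem: "xy_monom a b \<in> U" if "\<not> (a > 4 \<or> b > 4 \<or> even (a + b))" for a b
  proof (rule odd_exponent_induct[where Z = "\<lambda>a b. xy_monom a b \<in> U", OF assms(1) _ _ that])
    fix a b :: nat assume *: "a < 4" "b < 4" "xy_monom (Suc a) b \<in> U"
    show "xy_monom a (Suc b) \<in> U"
      using f[OF *(3), of Short] unfolding fW_xy_monom(1)[OF *(1,2)]
      by (rule cancel) (use of_nat_neq_0_mod_5[of "Suc a"] *(1) in simp)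
  next
    fix a b :: nat assume *: "b \<le> 2" "xy_monom a (Suc (Suc b)) \<in> U"
    show "xy_monom a b \<in> U"
      using f[OF *(2), of Long] unfolding fW_xy_monom(2)[OF *(1)]
      by (rule cancel) (use of_nat_neq_0_mod_5[of "Suc b"] of_nat_neq_0_mod_5[of "Suc (Suc b)"] *(1) char_5_simps[OF char5] in simp)
  qed
  show "u \<in> U"
    by (rule odd_trunc_span[OF mem add scale u]) auto
qed

text \<open>
  A nonzero submodule meets the highest weight space: the coefficient of \<open>x\<^sup>4 y\<^sup>3\<close> in a suitable word of
  raising operators applied to \<open>w\<close> is a nonzero multiple of any prescribed coefficient of \<open>w\<close>.
\<close>

lemma odd_trunc_simple:
  fixes N :: "'k bipoly set"
  assumes N: "N \<subseteq> odd_trunc" "\<And>i w. w \<in> N \<Longrightarrow> eW i w \<in> N" "\<And>w. w \<in> N \<Longrightarrow> w 4 3 = 0"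
    and u: "u \<in> N"
  shows "u = 0"
proof (intro ext)
  fix a b
  show "u a b = (0 :: 'k bipoly) a b"
  proof (cases "a > 4 \<or> b > 4 \<or> even (a + b)")
    case True then show ?thesis using N(1) u by (auto simp: odd_trunc_def)
  next
    case False
    have "\<forall>u\<in>N. u a b = 0"
    proof (rule odd_exponent_induct[where Z = "\<lambda>a b. \<forall>u\<in>N. u a b = 0", OF _ _ _ False])
      show "\<forall>u\<in>N. u 4 3 = 0" using N(3) by blast
    next
      fix a b :: nat assume *: "a < 4" "b < 4" "\<forall>u\<in>N. u (Suc a) b = 0"
      show "\<forall>u\<in>N. u a (Suc b) = 0"
      proof
        fix u assume "u \<in> N"
        with N(2) *(3) have "eW Short u (Suc a) b = 0" by blast
        then show "u a (Suc b) = 0" using * of_nat_neq_0_mod_5[of "Suc b"] by (simp add: weyl_defs)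
      qed
    next
      fix a b :: nat assume *: "b \<le> 2" "\<forall>u\<in>N. u a (Suc (Suc b)) = 0"
      show "\<forall>u\<in>N. u a b = 0"
      proof
        fix u assume "u \<in> N"
        with N(2) *(2) have "eW Long u a (Suc (Suc b)) = 0" by blast
        then show "u a b = 0" using * char_5_simps[OF char5] by (simp add: weyl_defs)
      qed
    qed
    then show ?thesis using u by simp
  qed
qed

end

section \<open>The symplectic form and the moment map\<close>

text \<open>
  The coefficient of \<open>x\<^sup>4 y\<^sup>4\<close> in \<open>p(x, y) q(2x, 2y)\<close>. The substitution by a square root of \<open>- 1\<close> modulo \<open>5\<close> makes
  each of \<open>x, y, \<partial>\<^sub>x, \<partial>\<^sub>y\<close> adjoint to \<open>- 2\<close> times itself, and then every quadratic expression in them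
  is skew up to reversing the order of its factors.
\<close>

definition bform :: "('k::field) bipoly \<Rightarrow> 'k bipoly \<Rightarrow> 'k" where
  "bform p q = (\<Sum>a\<le>4. \<Sum>b\<le>4. p a b * (2 ^ (4 - a) * (2 ^ (4 - b) * q (4 - a) (4 - b))))"

text \<open>
  The order \<open>\<partial>\<^sub>x, \<partial>\<^sub>y, x, y\<close> is chosen so that commutators with a root vector \<open>X\<close> are given by the matrix
  \<open>- X\<close> itself.
\<close>

definition zop :: "2 + 2 \<Rightarrow> ('k::field) bipoly \<Rightarrow> 'k bipoly" where
  "zop i = (case i of Inl k \<Rightarrow> if k = 1 then dX else dY | Inr k \<Rightarrow> if k = 1 then mX else mY)"

lemma zop_simps:
  "zop (Inl 1) = dX" "zop (Inl 2) = dY" "zop (Inr 1) = mX" "zop (Inr 2) = mY"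
  by (simp_all add: zop_def)

lemma zop_cases: "zop i p = dX p \<or> zop i p = dY p \<or> zop i p = mX p \<or> zop i p = mY p"
  by (auto simp: zop_def split: sum.splits)

lemma bform_add: "bform (p + p') q = bform p q + bform p' q" "bform p (q + q') = bform p q + bform p q'"
  by (simp_all add: bform_def sum.distrib algebra_simps)

lemma bform_scale: "bform (fscale c p) q = c * bform p q" "bform p (fscale c q) = c * bform p q"
  by (simp_all add: bform_def sum_distrib_left mult_ac)

lemma zop_add: "zop i (p + q) = zop i p + zop i q" and zop_scale: "zop i (fscale c p) = fscale c (zop i p)"
  for p q :: "('k::field) bipoly"
  by (auto simp: zop_def fun_eq_iff weyl_defs algebra_simps split: sum.splits)

context
  assumes char5: "CHAR('k::field) = 5"
begin

lemma multiples_of_5: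
  "(5 :: 'k) = 0" "(10 :: 'k) = 0" "(15 :: 'k) = 0" "(20 :: 'k) = 0" "(30 :: 'k) = 0" "(40 :: 'k) = 0"
  "(80 :: 'k) = 0" "(130 :: 'k) = 0"
proof -
  have z: "(of_nat n :: 'k) = 0" if "5 dvd n" for n
    using that by (simp add: of_nat_eq_0_iff_char_dvd char5)
  show "(5 :: 'k) = 0" "(10 :: 'k) = 0" "(15 :: 'k) = 0" "(20 :: 'k) = 0" "(30 :: 'k) = 0" "(40 :: 'k) = 0"
    "(80 :: 'k) = 0" "(130 :: 'k) = 0"
    using z[of 5] z[of 10] z[of 15] z[of 20] z[of 30] z[of 40] z[of 80] z[of 130] by simp_all
qed

lemma residues_mod_5: "(4 :: 'k) = - 1" "(6 :: 'k) = 1" "(12 :: 'k) = - 3" "(8 :: 'k) = - 2"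
proof -
  have "(4 :: 'k) = 5 - 1" "(6 :: 'k) = 5 + 1" "(12 :: 'k) = 15 - 3" "(8 :: 'k) = 10 - 2" by simp_all
  then show "(4 :: 'k) = - 1" "(6 :: 'k) = 1" "(12 :: 'k) = - 3" "(8 :: 'k) = - 2"
    by (simp_all only: multiples_of_5 diff_0 add_0_left)
qed

lemma bform_zop:
  fixes p q :: "'k bipoly"
  shows "bform (zop i p) q = -2 * bform p (zop i q)"
proof -
  \<comment> \<open>The form is a product of two copies of \<open>L\<close>, one for each variable, so one variable suffices.\<close>
  define L where "L f g = (\<Sum>a\<le>4. f a * (2 ^ (4 - a) * g (4 - a)))" for f g :: "nat \<Rightarrow> 'k"
  define m where "m f a = (if 1 \<le> a \<and> a \<le> 4 then f (a - 1) else 0)" for f :: "nat \<Rightarrow> 'k" and a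
  define d where "d f a = (if a < 4 then of_nat (a + 1) * f (a + 1) else 0)" for f :: "nat \<Rightarrow> 'k" and a
  have Lm: "L (m f) g = -2 * L f (m g)" for f g
    unfolding L_def m_def by (simp add: eval_nat_numeral) (simp add: multiples_of_5)
  have Ld: "L (d f) g = -2 * L f (d g)" for f g
    unfolding L_def d_def by (simp add: eval_nat_numeral) (simp add: multiples_of_5)
  have 1: "bform p q = (\<Sum>b\<le>4. 2 ^ (4 - b) * L (\<lambda>a. p a b) (\<lambda>a. q a (4 - b)))" for p q
    unfolding bform_def L_def sum_distrib_left by (subst sum.swap) (simp add: mult_ac)
  have 2: "bform p q = (\<Sum>a\<le>4. 2 ^ (4 - a) * L (p a) (q (4 - a)))" for p q
    unfolding bform_def L_def sum_distrib_left by (simp add: mult_ac)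
  have X: "(\<lambda>a. mX p a b) = m (\<lambda>a. p a b)" "(\<lambda>a. dX p a b) = d (\<lambda>a. p a b)" for p :: "'k bipoly" and b
    by (auto simp: weyl_defs m_def d_def)
  have Y: "mY p a = m (p a)" "dY p a = d (p a)" for p :: "'k bipoly" and a
    by (auto simp: weyl_defs m_def d_def fun_eq_iff)
  have "bform (mX p) q = -2 * bform p (mX q)" "bform (dX p) q = -2 * bform p (dX q)"
    unfolding 1 X Lm Ld sum_distrib_left by (simp_all add: mult_ac)
  moreover have "bform (mY p) q = -2 * bform p (mY q)" "bform (dY p) q = -2 * bform p (dY q)"
    unfolding 2 Y Lm Ld sum_distrib_left by (simp_all add: mult_ac)
  ultimately show ?thesis by (auto simp: zop_def split: sum.splits)
qed

text \<open>
  Exchanging the arguments replaces \<open>2\<^bsup>8 - a - b\<^esup>\<close> by \<open>2\<^bsup>a + b\<^esup>\<close>. The quotient is \<open>4\<^bsup>a + b - 4\<^esup> = (- 1)\<^bsup>a + b\<^esup>\<close>.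
\<close>

lemma bform_skew:
  fixes p q :: "'k bipoly"
  assumes p: "p \<in> odd_trunc"
  shows "bform q p = - bform p q"
proof -
  have rev: "(\<Sum>a\<le>4. g a) = (\<Sum>a\<le>4. g (4 - a))" for g :: "nat \<Rightarrow> 'k"
    by (simp add: eval_nat_numeral add_ac)
  have "bform q p = (\<Sum>a\<le>4. \<Sum>b\<le>4. q (4 - a) (4 - b) * (2 ^ a * (2 ^ b * p a b)))"
    unfolding bform_def by (subst rev, subst (2) rev) simp
  also have "\<dots> = (\<Sum>a\<le>4. \<Sum>b\<le>4. - (p a b * (2 ^ (4 - a) * (2 ^ (4 - b) * q (4 - a) (4 - b)))))"
  proof (intro sum.cong refl)
    fix a b :: nat assume ab: "a \<in> {..4}" "b \<in> {..4}"
    show "q (4 - a) (4 - b) * (2 ^ a * (2 ^ b * p a b))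
        = - (p a b * (2 ^ (4 - a) * (2 ^ (4 - b) * q (4 - a) (4 - b))))"
    proof (cases "even (a + b)")
      case True
      then have "p a b = 0" using p unfolding odd_trunc_def by blast
      then show ?thesis by simp
    next
      case False
      have "(2 :: 'k) ^ a * 2 ^ b = - (2 ^ (4 - a) * 2 ^ (4 - b))"
      proof -
        have "(a, b) \<in> {(4,3), (4,1), (3,4), (3,2), (3,0), (2,3), (2,1), (1,4), (1,2), (1,0), (0,3), (0,1)}"
          by (rule odd_cases) (use ab False in auto)
        then show ?thesis
          by (elim insertE emptyE) (simp_all add: eq_neg_iff_add_eq_0 multiples_of_5)
      qed
      then have "(2 ^ a * 2 ^ b) * (p a b * q (4 - a) (4 - b))
          = - (2 ^ (4 - a) * 2 ^ (4 - b)) * (p a b * q (4 - a) (4 - b))" by (rule arg_cong)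
      then show ?thesis by (simp only: mult_ac mult_minus_left mult_minus_right)
    qed
  qed
  finally show ?thesis by (simp add: bform_def sum_negf)
qed

lemma zop_trunc: "p \<in> trunc \<Longrightarrow> zop i p \<in> trunc" for p :: "'k bipoly"
  using zop_cases[of i p] trunc_closed(1-4)[of p] by auto

definition moment :: "'k bipoly \<Rightarrow> 'k bipoly \<Rightarrow> 'k sqmat" where
  "moment p q i j = bform (zop i (zop j p)) q + bform (zop j (zop i p)) q"

lemma moment_commute:
  assumes "p \<in> odd_trunc" "q \<in> odd_trunc"
  shows "moment p q = moment q p"
proof -
  have "bform (zop i (zop j p)) q = bform (zop j (zop i q)) p" for i j
  proof -
    have "bform (zop i (zop j p)) q = -2 * (-2 * bform p (zop j (zop i q)))"
      by (simp only: bform_zop)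
    also have "\<dots> = - bform p (zop j (zop i q))"
      by (simp add: residues_mod_5)
    finally show ?thesis by (simp add: bform_skew[OF assms(1)])
  qed
  then show ?thesis by (auto simp: moment_def fun_eq_iff add.commute)
qed

text \<open>
  The operator \<open>T\<close> represents the matrix \<open>X\<close> as a quadratic element of the Weyl algebra: it is skew for the form
  and its commutator with the vector of the \<open>z\<^sub>i\<close> is \<open>- X\<close> applied to that vector.
\<close>

definition quadratic :: "('k bipoly \<Rightarrow> 'k bipoly) \<Rightarrow> 'k mat4 \<Rightarrow> bool" where
  "quadratic T X \<longleftrightarrow> (\<forall>p\<in>trunc. T p \<in> trunc) \<and> (\<forall>p q. bform (T p) q = - bform p (T q))
     \<and> (\<forall>p q. T (p + q) = T p + T q) \<and> (\<forall>i. \<forall>p\<in>trunc. zop i (T p) = T (zop i p) + (\<Sum>j\<in>UNIV. fscale (X $ i $ j) (zop j p)))"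

lemma bform_sum: "bform (\<Sum>j\<in>UNIV. fscale (c j) (g j)) q = (\<Sum>j\<in>UNIV. c j * bform (g j) q)"
  for c :: "2 + 2 \<Rightarrow> 'k"
  by (simp add: sum_22 bform_add bform_scale)

lemma zop_sum: "zop i (\<Sum>j\<in>UNIV. fscale (c j) (g j)) = (\<Sum>j\<in>UNIV. fscale (c j) (zop i (g j)))"
  for c :: "2 + 2 \<Rightarrow> 'k"
  by (simp add: sum_22 zop_add zop_scale)

text \<open>
  Since \<open>T\<close> is skew, the left hand side is \<open>B([z\<^sub>i z\<^sub>j + z\<^sub>j z\<^sub>i, T] p, q)\<close>, and the commutator is computed
  factor by factor.
\<close>

lemma moment_equivariant:
  assumes T: "quadratic T X" and p: "p \<in> trunc"
  shows "moment (T p) q i j + moment p (T q) i j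
    = (\<Sum>k\<in>UNIV. X $ i $ k * moment p q k j) + (\<Sum>k\<in>UNIV. X $ j $ k * moment p q i k)"
proof -
  have br: "zop i (T r) = T (zop i r) + (\<Sum>k\<in>UNIV. fscale (X $ i $ k) (zop k r))" if "r \<in> trunc" for i r
    using T that unfolding quadratic_def by blast
  have adj: "bform (T r) q = - bform r (T q)" for r using T unfolding quadratic_def by blast
  have half: "bform (zop i (zop j (T p))) q + bform (zop i (zop j p)) (T q)
      = (\<Sum>k\<in>UNIV. X $ i $ k * bform (zop k (zop j p)) q) + (\<Sum>k\<in>UNIV. X $ j $ k * bform (zop i (zop k p)) q)"
    for i j
    by (simp add: br p zop_trunc zop_add zop_sum bform_add bform_sum adj)
  show ?thesis
    using half[of i j] half[of j i] by (simp add: moment_def distrib_left sum.distrib algebra_simps)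
qed

text \<open>
  Normal ordering in the Weyl algebra: operators in \<open>y\<close> to the left of operators in \<open>x\<close>, and multiplications
  to the left of derivatives.
\<close>

lemma quadratic_eW: "quadratic (eW r) (e_mat r :: 'k mat4)"
  and quadratic_fW: "quadratic (fW r) (f_mat r :: 'k mat4)"
proof -
  note adj = bform_zop[where i = "Inl 1", unfolded zop_simps] bform_zop[where i = "Inl 2", unfolded zop_simps]
    bform_zop[where i = "Inr 1", unfolded zop_simps] bform_zop[where i = "Inr 2", unfolded zop_simps]
  note add = zop_add[where i = "Inl 1", unfolded zop_simps] zop_add[where i = "Inl 2", unfolded zop_simps]
    zop_add[where i = "Inr 1", unfolded zop_simps] zop_add[where i = "Inr 2", unfolded zop_simps]
  note scale = zop_scale[where i = "Inl 1", unfolded zop_simps] zop_scale[where i = "Inl 2", unfolded zop_simps]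
    zop_scale[where i = "Inr 1", unfolded zop_simps] zop_scale[where i = "Inr 2", unfolded zop_simps]
  have fs: "fscale 1 p = p" "fscale 0 p = 0" "fscale (-1) p = - p" "fscale c (p + q) = fscale c p + fscale c q"
    for c and p q :: "'k bipoly"
    by (auto simp: fun_eq_iff algebra_simps)
  have tr: "p \<in> trunc \<Longrightarrow> fscale c p \<in> trunc" for c and p :: "'k bipoly"
    by (auto simp: trunc_def)
  note rw = weyl_commute(1-3) weyl_commute(4)[symmetric] weyl_relations[OF char5] add scale trunc_closed(1-4) tr fs
  show "quadratic (eW r) (e_mat r :: 'k mat4)"
  proof (cases r)
    case Short
    show ?thesis
      unfolding Short quadratic_def forall_22 sum_22 zop_simps
      by (intro conjI ballI allI) (simp_all add: rw adj root_mats_nth residues_mod_5)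
  next
    case Long
    show ?thesis
      unfolding Long quadratic_def forall_22 sum_22 zop_simps
      by (intro conjI ballI allI, simp_all add: rw adj root_mats_nth residues_mod_5 bform_scale,
          simp_all add: fun_eq_iff residues_mod_5 algebra_simps)
  qed
  show "quadratic (fW r) (f_mat r :: 'k mat4)"
  proof (cases r)
    case Short
    show ?thesis
      unfolding Short quadratic_def forall_22 sum_22 zop_simps
      by (intro conjI ballI allI) (simp_all add: rw adj root_mats_nth residues_mod_5)
  next
    case Long
    show ?thesis
      unfolding Long quadratic_def forall_22 sum_22 zop_simps
      by (intro conjI ballI allI, simp_all add: rw adj root_mats_nth residues_mod_5 bform_scale,
          simp_all add: fun_eq_iff residues_mod_5 algebra_simps)
  qed
qed

end

section \<open>The adjoint module as symmetric matrices\<close>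

text \<open>
  The differential of \<open>N \<mapsto> g N g\<^sup>T\<close>. Thus symmetric matrices are the symmetric tensors over the natural module, and
  the matrix unit at the first diagonal place has weight \<open>2\<omega>\<^sub>1\<close>.
\<close>

definition act :: "'k::field mat4 \<Rightarrow> 'k sqmat \<Rightarrow> 'k sqmat" where
  "act X N i j = (\<Sum>k\<in>UNIV. X $ i $ k * N k j) + (\<Sum>k\<in>UNIV. X $ j $ k * N i k)"

fun cartan :: "simple_root \<Rightarrow> 2 + 2 \<Rightarrow> int" where
  "cartan Short i = (case i of Inl k \<Rightarrow> if k = 1 then 1 else -1 | Inr k \<Rightarrow> if k = 1 then -1 else 1)"
| "cartan Long i = (case i of Inl k \<Rightarrow> if k = 1 then 0 else 1 | Inr k \<Rightarrow> if k = 1 then 0 else -1)"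

definition hA :: "simple_root \<Rightarrow> ('k::field) sqmat \<Rightarrow> 'k sqmat" where
  "hA r N i j = of_int (cartan r i + cartan r j) * N i j"

definition sym_mats :: "('k::field) sqmat set" where
  "sym_mats = {N. \<forall>i j. N i j = N j i}"

definition unit_mat :: "2 + 2 \<Rightarrow> 2 + 2 \<Rightarrow> ('k::field) sqmat" where
  "unit_mat a b = (\<lambda>i j. if i = a \<and> j = b then 1 else 0)"

abbreviation sunit :: "2 + 2 \<Rightarrow> 2 + 2 \<Rightarrow> ('k::field) sqmat" where
  "sunit a b \<equiv> unit_mat a b + unit_mat b a"

lemma fun22_eq_iff: "M = N \<longleftrightarrow> (\<forall>i j :: 2 + 2. M i j = N i j)"
  by (auto simp: fun_eq_iff)

lemmas act_simps = act_def sum_22 e_mat.simps f_mat_simps E4_nth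

lemma linear_act: "Vector_Spaces.linear fscale fscale (act X)"
  unfolding linear_fscale_iff
  by (auto simp: fun_eq_iff act_def algebra_simps sum.distrib sum_distrib_left)

lemma linear_hA: "Vector_Spaces.linear fscale fscale (hA r)"
  unfolding linear_fscale_iff by (auto simp: fun_eq_iff hA_def algebra_simps)

lemma act_sym: "N \<in> sym_mats \<Longrightarrow> act X N \<in> sym_mats"
  unfolding sym_mats_def act_def by (auto simp: add.commute)

lemma act_e_f:
  "act (e_mat i) (act (f_mat j) N) = act (f_mat j) (act (e_mat i) N) + (if i = j then hA i N else 0)"
  unfolding fun22_eq_iff forall_22
  by (cases i; cases j; simp add: act_simps hA_def algebra_simps)

lemma hA_f:
  "hA i (act (f_mat j) N) = act (f_mat j) (hA i N) - fscale (of_int (pairing (alpha j) i)) (act (f_mat j) N)"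
  unfolding fun22_eq_iff forall_22
  by (cases i; cases j; simp add: act_simps hA_def algebra_simps)

text \<open>
  A chain of lowering operators that starts at the highest weight vector and reaches a basis of the ten
  dimensional space of symmetric matrices.
\<close>

lemma f_sunit:
  "act (f_mat Short) (unit_mat (Inl 1) (Inl 1)) = sunit (Inl 1) (Inl 2)"
  "act (f_mat Short) (sunit (Inl 1) (Inl 2)) = fscale 2 (unit_mat (Inl 2) (Inl 2))"
  "act (f_mat Long) (sunit (Inl 1) (Inl 2)) = sunit (Inl 1) (Inr 2)"
  "act (f_mat Long) (unit_mat (Inl 2) (Inl 2)) = sunit (Inl 2) (Inr 2)"
  "act (f_mat Long) (sunit (Inl 2) (Inr 2)) = fscale 2 (unit_mat (Inr 2) (Inr 2))"
  "act (f_mat Short) (sunit (Inl 2) (Inr 2)) = fscale (-1) (sunit (Inl 2) (Inr 1))"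
  "act (f_mat Short) (sunit (Inl 1) (Inr 2)) = sunit (Inl 2) (Inr 2) + fscale (-1) (sunit (Inl 1) (Inr 1))"
  "act (f_mat Short) (unit_mat (Inr 2) (Inr 2)) = fscale (-1) (sunit (Inr 1) (Inr 2))"
  "act (f_mat Short) (sunit (Inr 1) (Inr 2)) = fscale (-2) (unit_mat (Inr 1) (Inr 1))"
  unfolding fun22_eq_iff forall_22
  by (simp_all add: act_simps unit_mat_def)

lemma sym_expand:
  fixes N :: "('k::field) sqmat"
  assumes "N \<in> sym_mats"
  shows "N = fscale (N (Inl 1) (Inl 1)) (unit_mat (Inl 1) (Inl 1)) + fscale (N (Inl 2) (Inl 2)) (unit_mat (Inl 2) (Inl 2))
    + fscale (N (Inr 1) (Inr 1)) (unit_mat (Inr 1) (Inr 1)) + fscale (N (Inr 2) (Inr 2)) (unit_mat (Inr 2) (Inr 2))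
    + fscale (N (Inl 1) (Inl 2)) (sunit (Inl 1) (Inl 2)) + fscale (N (Inl 1) (Inr 1)) (sunit (Inl 1) (Inr 1))
    + fscale (N (Inl 1) (Inr 2)) (sunit (Inl 1) (Inr 2)) + fscale (N (Inl 2) (Inr 1)) (sunit (Inl 2) (Inr 1))
    + fscale (N (Inl 2) (Inr 2)) (sunit (Inl 2) (Inr 2)) + fscale (N (Inr 1) (Inr 2)) (sunit (Inr 1) (Inr 2))"
proof -
  have s: "N (Inl 2) (Inl 1) = N (Inl 1) (Inl 2)" "N (Inr 1) (Inl 1) = N (Inl 1) (Inr 1)"
    "N (Inr 2) (Inl 1) = N (Inl 1) (Inr 2)" "N (Inr 1) (Inl 2) = N (Inl 2) (Inr 1)"
    "N (Inr 2) (Inl 2) = N (Inl 2) (Inr 2)" "N (Inr 2) (Inr 1) = N (Inr 1) (Inr 2)"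
    using assms unfolding sym_mats_def by blast+
  show ?thesis unfolding fun22_eq_iff forall_22 by (simp add: unit_mat_def s)
qed

lemma sym_cyclic:
  fixes U :: "('k::field) sqmat set"
  assumes two: "(2 :: 'k) \<noteq> 0" and u11: "unit_mat (Inl 1) (Inl 1) \<in> U" and add: "\<And>w w'. w \<in> U \<Longrightarrow> w' \<in> U \<Longrightarrow> w + w' \<in> U"
    and scale: "\<And>c w. w \<in> U \<Longrightarrow> fscale c w \<in> U" and f: "\<And>i w. w \<in> U \<Longrightarrow> act (f_mat i) w \<in> U"
  shows "sym_mats \<subseteq> U"
proof
  fix N :: "'k sqmat" assume N: "N \<in> sym_mats"
  have cancel: "w \<in> U" if "fscale c w \<in> U" "c \<noteq> 0" for c w
    using scale[OF that(1), of "inverse c"] that(2) by (simp add: fscale_def mult.assoc[symmetric])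
  have s12: "sunit (Inl 1) (Inl 2) \<in> U" using f[OF u11, of Short] by (simp only: f_sunit)
  have u22: "unit_mat (Inl 2) (Inl 2) \<in> U"
    using f[OF s12, of Short] two unfolding f_sunit by (rule cancel)
  have s14: "sunit (Inl 1) (Inr 2) \<in> U" using f[OF s12, of Long] by (simp only: f_sunit)
  have s24: "sunit (Inl 2) (Inr 2) \<in> U" using f[OF u22, of Long] by (simp only: f_sunit)
  have u44: "unit_mat (Inr 2) (Inr 2) \<in> U"
    using f[OF s24, of Long] two unfolding f_sunit by (rule cancel)
  have s23: "sunit (Inl 2) (Inr 1) \<in> U"
    using f[OF s24, of Short] unfolding f_sunit by (rule cancel) simp
  have s34: "sunit (Inr 1) (Inr 2) \<in> U"
    using f[OF u44, of Short] unfolding f_sunit by (rule cancel) simp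
  have u33: "unit_mat (Inr 1) (Inr 1) \<in> U"
    using f[OF s34, of Short] unfolding f_sunit by (rule cancel) (use two in simp)
  have "fscale (-1) (sunit (Inl 1) (Inr 1)) \<in> U"
  proof -
    have cancel_left: "(M + K) + fscale (-1) M = K" for M K :: "'k sqmat"
      by (simp add: fun_eq_iff)
    show ?thesis
      using add[OF f[OF s14, of Short] scale[OF s24, of "-1"]] unfolding f_sunit cancel_left .
  qed
  then have s13: "sunit (Inl 1) (Inr 1) \<in> U" by (rule cancel) simp
  show "N \<in> U"
    by (subst sym_expand[OF N]) (intro add scale u11 u22 u33 u44 s12 s13 s14 s23 s24 s34)
qed

lemma unit_highest: "act (e_mat i) (unit_mat (Inl 1) (Inl 1)) = 0"
  unfolding fun22_eq_iff forall_22 by (cases i) (simp_all add: act_simps unit_mat_def)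

lemma act_f_11: "act (f_mat i) N (Inl 1) (Inl 1) = 0"
  by (cases i) (simp_all add: act_simps)

section \<open>Lie algebra homomorphisms on the symmetric square\<close>

lemma sum_square_antidiagonals:
  fixes g :: "nat \<Rightarrow> nat \<Rightarrow> 'b::comm_monoid_add"
  assumes "\<And>i j. i > 4 \<or> j > 4 \<Longrightarrow> g i j = 0"
  shows "(\<Sum>n\<le>8. \<Sum>i\<le>n. g i (n - i)) = (\<Sum>i\<le>4. \<Sum>j\<le>4. g i j)"
proof -
  have fin: "finite {(i, j). i + j \<le> (8::nat)}"
    by (rule finite_subset[of _ "{..8} \<times> {..8}"]) auto
  have "(\<Sum>n\<le>8. \<Sum>i\<le>n. g i (n - i)) = (\<Sum>(i, j)\<in>{(i, j). i + j \<le> 8}. g i j)"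
    by (rule sum.triangle_reindex_eq[symmetric])
  also have "\<dots> = (\<Sum>(i, j)\<in>{..4} \<times> {..4}. g i j)"
    by (rule sum.mono_neutral_right[OF fin]) (auto intro!: assms)
  finally show ?thesis by (simp add: sum.cartesian_product)
qed

context small_rep
begin

lemma differential_simple: "X \<in> simple_mats \<Longrightarrow> differential (*s) \<rho> X v = dp X 1 v"
  by (rule differential_curve[OF rational _ _ unip_expand]) simp_all

text \<open>
  The Leibniz rule for divided powers.
\<close>

lemma sym2_unip_expand:
  assumes X: "X \<in> simple_mats"
  shows "sym2_map (\<rho> (unip X t)) (sp v w)
    = (\<Sum>n\<le>8. sym2_scale (t ^ n) (\<Sum>i\<le>n. sp (dp X i v) (dp X (n - i) w)))"
proof -
  interpret S: vector_space "sym2_scale :: 'k \<Rightarrow> ('k, 'n) sym2 \<Rightarrow> _" by (rule vector_space_sym2)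
  have z: "sp 0 y = 0" "sp y 0 = 0" for y :: "'k ^ 'n"
    using sp_scale(1)[of 0 y y] sp_scale(2)[of y 0 y] by simp_all
  have "sym2_map (\<rho> (unip X t)) (sp v w) = sp (\<Sum>i\<le>4. t ^ i *s dp X i v) (\<Sum>j\<le>4. t ^ j *s dp X j w)"
    unfolding sym2_map_tensor[OF linear_rho[OF unip_Sp4[OF X]]] unip_expand[OF X] ..
  also have "\<dots> = (\<Sum>i\<le>4. \<Sum>j\<le>4. sym2_scale (t ^ (i + j)) (sp (dp X i v) (dp X j w)))"
    unfolding sp_sum sp_scale by (subst sum.swap) (simp add: S.scale_sum_right power_add mult.commute)
  also have "\<dots> = (\<Sum>n\<le>8. \<Sum>i\<le>n. sym2_scale (t ^ (i + (n - i))) (sp (dp X i v) (dp X (n - i) w)))"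
    by (rule sum_square_antidiagonals[symmetric]) (auto simp: dp_eq_0[OF X] z)
  also have "\<dots> = (\<Sum>n\<le>8. sym2_scale (t ^ n) (\<Sum>i\<le>n. sp (dp X i v) (dp X (n - i) w)))"
    by (intro sum.cong refl) (simp add: S.scale_sum_right)
  finally show ?thesis .
qed

lemma differential_sym2:
  assumes X: "X \<in> simple_mats"
  shows "differential sym2_scale (\<lambda>g. sym2_map (\<rho> g)) X (sp v w) = sp (dp X 1 v) w + sp v (dp X 1 w)"
proof -
  have "differential sym2_scale (\<lambda>g. sym2_map (\<rho> g)) X (sp v w) = (\<Sum>i\<le>1. sp (dp X i v) (dp X (1 - i) w))"
    by (rule differential_curve[OF rational_sym2[OF rational] X _ sym2_unip_expand[OF X]]) simp
  then show ?thesis by (simp add: dp_0[OF X] add.commute)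
qed

text \<open>
  If \<open>c\<close> is not an eigenvalue of the coroot on a weight space, then \<open>hh r - c\<close> is onto, as every weight vector is in its
  range; in finite dimension it is then injective.
\<close>

lemma hh_eigenvector_zero:
  assumes c: "\<And>\<mu> v. v \<in> wt \<mu> \<Longrightarrow> v \<noteq> 0 \<Longrightarrow> of_int (pairing \<mu> r) \<noteq> c" and s: "hh r s = c *s s"
  shows "s = 0"
proof -
  define T where "T v = hh r v - c *s v" for v
  interpret H: Vector_Spaces.linear "(*s)" "(*s)" "hh r" by (rule linear_hh)
  have T: "Vector_Spaces.linear (*s) (*s) T"
    by unfold_locales (simp_all add: T_def H.add H.scale vec.scale_right_distrib vec.scale_right_diff_distrib mult.commute)
  interpret T: Vector_Spaces.linear "(*s)" "(*s)" T by (rule T)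
  have "v \<in> range T" for v
  proof (rule weight_induct[where P = "\<lambda>v. v \<in> range T"])
    show "vec.subspace {v. v \<in> range T}"
      using T.subspace_image[OF vec.subspace_UNIV] by simp
  next
    fix \<mu> v assume v: "v \<in> wt \<mu>"
    show "v \<in> range T"
    proof (cases "v = 0")
      case False
      define d where "d = of_int (pairing \<mu> r) - c"
      have "T v = d *s v"
        by (simp add: T_def d_def hh_wt[OF v] vec.scale_left_diff_distrib)
      moreover have "d \<noteq> 0" using c[OF v False] by (simp add: d_def)
      ultimately have "T ((1 / d) *s v) = v" by (simp add: T.scale)
      then show ?thesis by (metis rangeI)
    qed (use T.zero in \<open>metis rangeI\<close>)
  qed
  then have "surj T" by blast
  then have "inj T" using vec.linear_surj_imp_inj[OF T] by simp
  moreover have "T s = T 0" using s by (simp add: T_def H.zero)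
  ultimately show ?thesis by (rule injD)
qed

lemma functional_hh:
  assumes phi: "Vector_Spaces.linear (*s) (*) \<phi>" "\<And>\<mu> v. v \<in> wt \<mu> \<Longrightarrow> \<mu> \<noteq> lam \<Longrightarrow> \<phi> v = 0"
  shows "\<phi> (hh r s) = of_int (pairing lam r) * \<phi> s"
proof -
  interpret phi: Vector_Spaces.linear "(*s)" "(*)" \<phi> by (fact phi)
  interpret H: Vector_Spaces.linear "(*s)" "(*s)" "hh r" by (rule linear_hh)
  show ?thesis
  proof (rule weight_induct[where P = "\<lambda>s. \<phi> (hh r s) = of_int (pairing lam r) * \<phi> s"])
    show "vec.subspace {s. \<phi> (hh r s) = of_int (pairing lam r) * \<phi> s}"
      by (auto simp: vec.subspace_def H.zero H.add H.scale phi.zero phi.add phi.scale algebra_simps)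
  next
    fix \<mu> v assume v: "v \<in> wt \<mu>"
    then show "\<phi> (hh r v) = of_int (pairing lam r) * \<phi> v"
      using phi(2)[OF v] by (cases "\<mu> = lam") (simp_all add: hh_wt phi.scale)
  qed
qed

end

lemma weight_values:
  "(omega1 + omega2) $ 1 = 2" "(omega1 + omega2) $ 2 = 1" "(2 *s omega1) $ 1 = 2" "(2 *s omega1) $ 2 = 0"
  by (simp_all add: omega1_def omega2_def eps1_def eps2_def axis_def)

locale sym2_setting =
  V: small_rep \<rho> "omega1 + omega2" + S: small_rep \<sigma> "2 *s omega1"
  for \<rho> :: "('k::alg_closed_field) mat4 \<Rightarrow> 'k ^ 'n \<Rightarrow> 'k ^ 'n::finite"
    and \<sigma> :: "'k mat4 \<Rightarrow> 'k ^ 'm \<Rightarrow> 'k ^ 'm::finite"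
begin

text \<open>
  Maps that commute with the four root vectors. This space is squeezed between the other two:
  \<open>Hom_Lie \<subseteq> HomE \<subseteq> Hom_G \<subseteq> Hom_Lie\<close>.
\<close>

definition HomE :: "(('k, 'n) sym2 \<Rightarrow> 'k ^ 'm) set" where
  "HomE = {F. Vector_Spaces.linear sym2_scale (*s) F \<and>
     (\<forall>X\<in>simple_mats. \<forall>v w. F (sp (V.dp X 1 v) w) + F (sp v (V.dp X 1 w)) = S.dp X 1 (F (sp v w)))}"

lemma Hom_Lie_subset_HomE: "Hom_Lie sym2_scale (\<lambda>g. sym2_map (\<rho> g)) (*s) \<sigma> \<subseteq> HomE"
proof
  fix F assume F: "F \<in> Hom_Lie sym2_scale (\<lambda>g. sym2_map (\<rho> g)) (*s) \<sigma>"
  then have lin: "Vector_Spaces.linear sym2_scale (*s) F" by (simp add: Hom_Lie_def)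
  interpret F: Vector_Spaces.linear sym2_scale "(*s)" F by (fact lin)
  have "F (sp (V.dp X 1 v) w) + F (sp v (V.dp X 1 w)) = S.dp X 1 (F (sp v w))"
    if X: "X \<in> simple_mats" for X v w
  proof -
    have "F (differential sym2_scale (\<lambda>g. sym2_map (\<rho> g)) X (sp v w)) = differential (*s) \<sigma> X (F (sp v w))"
      using F simple_mats_lie[OF X] by (simp add: Hom_Lie_def)
    then show ?thesis by (simp only: V.differential_sym2[OF X] S.differential_simple[OF X] F.add)
  qed
  then show "F \<in> HomE" using lin by (simp add: HomE_def)
qed

context
  fixes F assumes F: "F \<in> HomE"
begin

interpretation F: Vector_Spaces.linear sym2_scale "(*s)" F
  using F by (simp add: HomE_def)

lemma HomE_derivation:
  "X \<in> simple_mats \<Longrightarrow> S.dp X 1 (F (sp v w)) = F (sp (V.dp X 1 v) w) + F (sp v (V.dp X 1 w))"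
  using F by (simp add: HomE_def)

lemma HomE_ee: "S.ee r (F (sp v w)) = F (sp (V.ee r v) w) + F (sp v (V.ee r w))"
  unfolding S.ee_def V.ee_def by (rule HomE_derivation) simp

lemma HomE_ff: "S.ff r (F (sp v w)) = F (sp (V.ff r v) w) + F (sp v (V.ff r w))"
  unfolding S.ff_def V.ff_def by (rule HomE_derivation) simp

lemma HomE_hh: "S.hh r (F (sp v w)) = F (sp (V.hh r v) w) + F (sp v (V.hh r w))"
proof -
  interpret E: Vector_Spaces.linear "(*s)" "(*s)" "S.ee r" by (rule S.linear_ee)
  interpret G: Vector_Spaces.linear "(*s)" "(*s)" "S.ff r" by (rule S.linear_ff)
  have d: "sp (a - b) y = sp a y - sp b y" "sp y (a - b) = sp y a - sp y b" for a b y :: "'k ^ 'n"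
    using sp_add(1)[of "a - b" b y] sp_add(2)[of y "a - b" b] by simp_all
  show ?thesis
    unfolding S.hh_def V.hh_def d F.diff HomE_ee HomE_ff E.add G.add by simp
qed

lemma HomE_bilinear:
  "F (sp (v + v') w) = F (sp v w) + F (sp v' w)" "F (sp v (w + w')) = F (sp v w) + F (sp v w')"
  "F (sp (c *s v) w) = c *s F (sp v w)" "F (sp v (c *s w)) = c *s F (sp v w)"
  "F (sp 0 w) = 0" "F (sp v 0) = 0"
proof -
  show "F (sp (c *s v) w) = c *s F (sp v w)" "F (sp v (c *s w)) = c *s F (sp v w)" for c v w
    by (simp_all add: sp_scale F.scale)
  from this(1)[of 0] this(2)[of _ 0] show "F (sp 0 w) = 0" "F (sp v 0) = 0" by simp_all
qed (simp_all add: sp_add F.add)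

text \<open>
  Along the long root the factors vanish already, because \<^const>\<open>box\<close> allows divided powers of order at
  most two. Along the short root let \<open>m\<close> and \<open>m'\<close> be the pairings of \<open>\<mu>\<close> and \<open>\<nu>\<close> with the coroot; they are odd
  and of absolute value at most \<open>3\<close>. For the positive root the vector in question has eigenvalue
  \<open>k = m + m' + 2(i + j)\<close>, an even number at least \<open>- 6 + 10 = 4\<close>, and at most \<open>6\<close> because both factors have weights
  of \<open>V\<close>. On \<open>S\<close> the eigenvalues are \<open>0\<close> and \<open>\<plusminus>2\<close>, none of them congruent to \<open>4\<close> or \<open>6\<close> modulo \<open>5\<close>.
\<close>

lemma high_terms_vanish_weights:
  assumes X: "X \<in> simple_mats" and v: "v \<in> V.wt \<mu>" and w: "w \<in> V.wt \<nu>" and ij: "i + j > 4"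
  shows "F (sp (V.dp X i v) (V.dp X j w)) = 0"
proof (rule ccontr)
  assume nz: "F (sp (V.dp X i v) (V.dp X j w)) \<noteq> 0"
  interpret Di: Vector_Spaces.linear "(*s)" "(*s)" "V.dp X i" by (rule V.linear_dp[OF X])
  interpret Dj: Vector_Spaces.linear "(*s)" "(*s)" "V.dp X j" by (rule V.linear_dp[OF X])
  have nz': "V.dp X i v \<noteq> 0" "V.dp X j w \<noteq> 0" "v \<noteq> 0" "w \<noteq> 0"
    using nz HomE_bilinear(5,6) Di.zero Dj.zero by auto
  obtain r \<alpha> where \<alpha>: "root_vector X \<alpha>" "\<alpha> = alpha r \<or> \<alpha> = - alpha r"
    using V.root_vectorE[OF X] by metis
  note iv = V.dp_wt[OF \<alpha>(1) v, of i] and jw = V.dp_wt[OF \<alpha>(1) w, of j]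
  have b: "\<bar>\<mu> $ 2\<bar> \<le> 2" "\<bar>\<mu> $ 2 + int i * \<alpha> $ 2\<bar> \<le> 2" "\<bar>\<nu> $ 2\<bar> \<le> 2" "\<bar>\<nu> $ 2 + int j * \<alpha> $ 2\<bar> \<le> 2"
    "\<bar>\<mu> $ 1\<bar> + \<bar>\<mu> $ 2\<bar> \<le> 3" "\<bar>\<mu> $ 1 + int i * \<alpha> $ 1\<bar> + \<bar>\<mu> $ 2 + int i * \<alpha> $ 2\<bar> \<le> 3"
    "\<bar>\<nu> $ 1\<bar> + \<bar>\<nu> $ 2\<bar> \<le> 3" "\<bar>\<nu> $ 1 + int j * \<alpha> $ 1\<bar> + \<bar>\<nu> $ 2 + int j * \<alpha> $ 2\<bar> \<le> 3"
    "even (3 - (\<mu> $ 1 + \<mu> $ 2))" "even (3 - (\<nu> $ 1 + \<nu> $ 2))"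
    using V.weights(2-4)[OF v nz'(3), unfolded weight_values] V.weights(2-4)[OF w nz'(4), unfolded weight_values]
      V.weights(2,3)[OF iv nz'(1), unfolded weight_values] V.weights(2,3)[OF jw nz'(2), unfolded weight_values]
    by simp_all
  define k where "k = pairing (\<mu> + int i *s \<alpha>) Short + pairing (\<nu> + int j *s \<alpha>) Short"
  have k_eq: "k = \<mu> $ 1 - \<mu> $ 2 + (\<nu> $ 1 - \<nu> $ 2) + (int i + int j) * (\<alpha> $ 1 - \<alpha> $ 2)"
    unfolding k_def by (simp add: algebra_simps)
  show False
  proof (cases r)
    case Long
    then have "\<alpha> $ 2 = 2 \<or> \<alpha> $ 2 = -2" using \<alpha>(2) by auto
    then show False
    proof
      assume a: "\<alpha> $ 2 = 2"
      show False using b(1-4) ij unfolding a by linarith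
    next
      assume a: "\<alpha> $ 2 = -2"
      show False using b(1-4) ij unfolding a by linarith
    qed
  next
    case Short
    then have "\<alpha> $ 1 = 1 \<and> \<alpha> $ 2 = -1 \<or> \<alpha> $ 1 = -1 \<and> \<alpha> $ 2 = 1" using \<alpha>(2) by auto
    then have "(4 \<le> k \<and> k \<le> 6 \<or> -6 \<le> k \<and> k \<le> -4) \<and> even k"
    proof (elim disjE conjE, goal_cases)
      case 1
      have k: "k = \<mu> $ 1 - \<mu> $ 2 + (\<nu> $ 1 - \<nu> $ 2) + 2 * int i + 2 * int j"
        unfolding k_eq 1 by simp
      have b': "\<bar>\<mu> $ 1 + int i\<bar> + \<bar>\<mu> $ 2 - int i\<bar> \<le> 3" "\<bar>\<nu> $ 1 + int j\<bar> + \<bar>\<nu> $ 2 - int j\<bar> \<le> 3"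
        using b(6,8) unfolding 1 by simp_all
      have "4 \<le> k" "k \<le> 6" using b(5,7) b' ij unfolding k by linarith+
      moreover have "even k" using b(9,10) unfolding k by presburger
      ultimately show ?case by simp
    next
      case 2
      have k: "k = \<mu> $ 1 - \<mu> $ 2 + (\<nu> $ 1 - \<nu> $ 2) - 2 * int i - 2 * int j"
        unfolding k_eq 2 by simp
      have b': "\<bar>\<mu> $ 1 - int i\<bar> + \<bar>\<mu> $ 2 + int i\<bar> \<le> 3" "\<bar>\<nu> $ 1 - int j\<bar> + \<bar>\<nu> $ 2 + int j\<bar> \<le> 3"
        using b(6,8) unfolding 2 by simp_all
      have "-6 \<le> k" "k \<le> -4" using b(5,7) b' ij unfolding k by linarith+
      moreover have "even k" using b(9,10) unfolding k by presburger
      ultimately show ?case by simp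
    qed
    then have k: "k \<in> {4, 6, -4, -6}"
      unfolding insert_iff empty_iff by presburger
    have "F (sp (V.dp X i v) (V.dp X j w)) = 0"
    proof (rule S.hh_eigenvector_zero)
      show "S.hh Short (F (sp (V.dp X i v) (V.dp X j w))) = of_int k *s F (sp (V.dp X i v) (V.dp X j w))"
        by (simp add: HomE_hh V.hh_wt[OF iv] V.hh_wt[OF jw] HomE_bilinear k_def vec.scale_left_distrib
            del: pairing.simps)
      fix \<kappa> s assume s: "s \<in> S.wt \<kappa>" "s \<noteq> 0"
      have "\<bar>\<kappa> $ 1\<bar> + \<bar>\<kappa> $ 2\<bar> \<le> 2" "even (2 - (\<kappa> $ 1 + \<kappa> $ 2))"
        using S.weights(3,4)[OF s, unfolded weight_values] by simp_all
      then have "\<bar>\<kappa> $ 1 - \<kappa> $ 2\<bar> \<le> 2" "even (\<kappa> $ 1 - \<kappa> $ 2)" by presburger+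
      then have "\<kappa> $ 1 - \<kappa> $ 2 \<in> {0, 2, -2}" unfolding insert_iff empty_iff by presburger
      then have "\<not> 5 dvd (pairing \<kappa> Short - k)" using k by auto
      then have "(of_int (pairing \<kappa> Short - k) :: 'k) \<noteq> 0"
        unfolding of_int_eq_0_iff_char_dvd V.char_5 by simp
      then show "of_int (pairing \<kappa> Short) \<noteq> (of_int k :: 'k)" by (simp del: pairing.simps)
    qed
    with nz show False by simp
  qed
qed

lemma high_terms_vanish:
  assumes X: "X \<in> simple_mats" and ij: "i + j > 4"
  shows "F (sp (V.dp X i v) (V.dp X j w)) = 0"
proof -
  interpret Di: Vector_Spaces.linear "(*s)" "(*s)" "V.dp X i" by (rule V.linear_dp[OF X])
  interpret Dj: Vector_Spaces.linear "(*s)" "(*s)" "V.dp X j" by (rule V.linear_dp[OF X])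
  have "\<forall>w. F (sp (V.dp X i v) (V.dp X j w)) = 0"
  proof (rule V.weight_induct[where P = "\<lambda>v. \<forall>w. F (sp (V.dp X i v) (V.dp X j w)) = 0"])
    show "vec.subspace {v. \<forall>w. F (sp (V.dp X i v) (V.dp X j w)) = 0}"
      by (simp add: vec.subspace_def Di.zero Di.add Di.scale HomE_bilinear)
  next
    fix \<mu> v assume v: "v \<in> V.wt \<mu>"
    show "\<forall>w. F (sp (V.dp X i v) (V.dp X j w)) = 0"
    proof
      fix w show "F (sp (V.dp X i v) (V.dp X j w)) = 0"
      proof (rule V.weight_induct[where P = "\<lambda>w. F (sp (V.dp X i v) (V.dp X j w)) = 0"])
        show "vec.subspace {w. F (sp (V.dp X i v) (V.dp X j w)) = 0}"
          by (simp add: vec.subspace_def Dj.zero Dj.add Dj.scale HomE_bilinear)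
      qed (rule high_terms_vanish_weights[OF X v _ ij])
    qed
  qed
  then show ?thesis by blast
qed

text \<open>
  Both sides satisfy \<open>X c\<^sub>n = (n + 1) c\<^bsub>n+1\<^esub>\<close>, and \<open>n + 1\<close> can be cancelled as long as it is less than \<open>5\<close>.
\<close>

lemma low_terms:
  assumes X: "X \<in> simple_mats" and n: "n \<le> 4"
  shows "(\<Sum>i\<le>n. F (sp (V.dp X i v) (V.dp X (n - i) w))) = S.dp X n (F (sp v w))"
  using n
proof (induction n)
  case 0 show ?case by (simp add: V.dp_0[OF X] S.dp_0[OF X])
next
  case (Suc n)
  interpret D: Vector_Spaces.linear "(*s)" "(*s)" "S.dp X 1" by (rule S.linear_dp[OF X])
  define c where "c i = F (sp (V.dp X i v) (V.dp X (Suc n - i) w))" for i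
  have "of_nat (Suc n) *s S.dp X (Suc n) (F (sp v w)) = S.dp X 1 (S.dp X n (F (sp v w)))"
    by (simp only: S.dp_1_dp[OF X])
  also have "\<dots> = (\<Sum>i\<le>n. S.dp X 1 (F (sp (V.dp X i v) (V.dp X (n - i) w))))"
    using Suc by (simp add: D.sum[symmetric] del: One_nat_def)
  also have "\<dots> = (\<Sum>i\<le>n. of_nat (Suc i) *s c (Suc i) + of_nat (Suc n - i) *s c i)"
  proof (rule sum.cong[OF refl])
    fix i assume "i \<in> {..n}"
    then have "Suc (n - i) = Suc n - i" by auto
    then show "S.dp X 1 (F (sp (V.dp X i v) (V.dp X (n - i) w)))
        = of_nat (Suc i) *s c (Suc i) + of_nat (Suc n - i) *s c i"
      by (simp only: HomE_derivation[OF X] V.dp_1_dp[OF X] HomE_bilinear c_def diff_Suc_Suc)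
  qed
  also have "\<dots> = (\<Sum>i\<le>n. of_nat (Suc i) *s c (Suc i)) + (\<Sum>i\<le>n. of_nat (Suc n - i) *s c i)"
    by (rule sum.distrib)
  also have "(\<Sum>i\<le>n. of_nat (Suc i) *s c (Suc i)) = (\<Sum>i\<le>Suc n. of_nat i *s c i)"
    by (simp add: sum.atMost_Suc_shift del: sum.atMost_Suc)
  also have "(\<Sum>i\<le>n. of_nat (Suc n - i) *s c i) = (\<Sum>i\<le>Suc n. of_nat (Suc n - i) *s c i)"
    by simp
  also have "(\<Sum>i\<le>Suc n. of_nat i *s c i) + (\<Sum>i\<le>Suc n. of_nat (Suc n - i) *s c i)
      = (\<Sum>i\<le>Suc n. of_nat (Suc n) *s c i)"
    unfolding sum.distrib[symmetric]
  proof (rule sum.cong[OF refl])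
    fix i assume "i \<in> {..Suc n}"
    then have "of_nat i + of_nat (Suc n - i) = (of_nat (Suc n) :: 'k)"
      by (simp only: of_nat_add[symmetric] atMost_iff le_add_diff_inverse)
    then show "of_nat i *s c i + of_nat (Suc n - i) *s c i = of_nat (Suc n) *s c i"
      by (simp only: vec.scale_left_distrib[symmetric])
  qed
  also have "\<dots> = of_nat (Suc n) *s (\<Sum>i\<le>Suc n. c i)" by (simp only: vec.scale_sum_right)
  finally have "of_nat (Suc n) *s S.dp X (Suc n) (F (sp v w)) = of_nat (Suc n) *s (\<Sum>i\<le>Suc n. c i)" .
  moreover have "(of_nat (Suc n) :: 'k) \<noteq> 0" using V.of_nat_neq_0[of "Suc n"] Suc.prems by simp
  ultimately have "S.dp X (Suc n) (F (sp v w)) = (\<Sum>i\<le>Suc n. c i)"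
    by (simp only: vec.scale_left_imp_eq)
  then show ?case unfolding c_def by (rule sym)
qed

lemma HomE_unip:
  assumes X: "X \<in> simple_mats"
  shows "F (sym2_map (\<rho> (unip X t)) z) = \<sigma> (unip X t) (F z)"
proof (induction z rule: sym2_induct)
  case (1 v w)
  let ?Z = "\<lambda>n. \<Sum>i\<le>n. F (sp (V.dp X i v) (V.dp X (n - i) w))"
  have "F (sym2_map (\<rho> (unip X t)) (sp v w)) = (\<Sum>n\<le>8. t ^ n *s ?Z n)"
    unfolding V.sym2_unip_expand[OF X] by (simp only: F.sum F.scale)
  also have "\<dots> = (\<Sum>n\<le>4. t ^ n *s ?Z n)"
    by (rule sum.mono_neutral_right) (auto simp: high_terms_vanish[OF X])
  also have "\<dots> = (\<Sum>n\<le>4. t ^ n *s S.dp X n (F (sp v w)))"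
    by (intro sum.cong refl) (simp add: low_terms[OF X])
  finally show ?case by (simp add: S.unip_expand[OF X])
next
  case (2 x y)
  interpret M: Vector_Spaces.linear sym2_scale sym2_scale "sym2_map (\<rho> (unip X t))"
    by (rule linear_sym2_map)
  show ?case using 2 by (simp add: M.add F.add S.rho_add unip_Sp4[OF X])
qed

lemma HomE_in_Hom_G: "F \<in> Hom_G sym2_scale (\<lambda>g. sym2_map (\<rho> g)) (*s) \<sigma>"
proof -
  have rat: "rational_module sym2_scale (\<lambda>g. sym2_map (\<rho> g))" by (rule rational_sym2[OF V.rational])
  have "\<forall>z. F (sym2_map (\<rho> g) z) = \<sigma> g (F z)" if "g \<in> gen" for g
    using that
  proof (induction rule: gen.induct)
    case one
    have "sym2_map (\<rho> (mat 1)) = id" using rat unfolding rational_module_def by blast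
    then show ?case by (simp add: S.rho_one)
  next
    case (step X g t)
    then have "g \<in> Sp4" by (simp add: gen_subset_Sp4)
    then have "sym2_map (\<rho> (unip X t ** g)) = sym2_map (\<rho> (unip X t)) \<circ> sym2_map (\<rho> g)"
      using rat unip_Sp4[OF step(1), of t] unfolding rational_module_def by blast
    with step \<open>g \<in> Sp4\<close> show ?case by (simp add: HomE_unip S.rho_mult unip_Sp4)
  qed
  then show ?thesis
    using Sp4_generated[OF V.two_neq_0] F by (simp add: Hom_G_def HomE_def)
qed

end

lemma Hom_eq: "Hom_G sym2_scale (\<lambda>g. sym2_map (\<rho> g)) (*s) \<sigma> = HomE"
  "Hom_Lie sym2_scale (\<lambda>g. sym2_map (\<rho> g)) (*s) \<sigma> = HomE"
  using Hom_Lie_subset_HomE HomE_in_Hom_G Hom_G_subset_Hom_Lie[OF rational_sym2[OF V.rational] S.rational]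
  by blast+

end

section \<open>The homomorphism space is one dimensional\<close>

lemma hW_xy_monom:
  "hW Short (xy_monom a b) = fscale (of_nat a - of_nat b) (xy_monom a b)"
  "hW Long (xy_monom a b) = fscale (of_nat b - 2) (xy_monom a b)"
  by (auto simp: fun_eq_iff xy_monom_def)

lemma xy_monom_odd: "a \<le> 4 \<Longrightarrow> b \<le> 4 \<Longrightarrow> odd (a + b) \<Longrightarrow> xy_monom a b \<in> odd_trunc"
  by (auto simp: odd_trunc_def xy_monom_def)

context sym2_setting
begin

text \<open>
  The surjection from the Weil module is injective: by \<open>odd_trunc_simple\<close> a nonzero kernel would contain an
  element whose coefficient at \<open>x\<^sup>4 y\<^sup>3\<close> is not zero.
\<close>

lemma weil_model:
  obtains \<pi> :: "'k bipoly \<Rightarrow> 'k ^ 'n"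
  where "\<And>p q. p \<in> odd_trunc \<Longrightarrow> q \<in> odd_trunc \<Longrightarrow> \<pi> (p + q) = \<pi> p + \<pi> q"
    "\<And>c p. p \<in> odd_trunc \<Longrightarrow> \<pi> (fscale c p) = c *s \<pi> p"
    "\<And>p. p \<in> odd_trunc \<Longrightarrow> \<pi> p = 0 \<Longrightarrow> p = 0"
    "\<And>i p. p \<in> odd_trunc \<Longrightarrow> \<pi> (eW i p) = V.ee i (\<pi> p)"
    "\<And>i p. p \<in> odd_trunc \<Longrightarrow> \<pi> (fW i p) = V.ff i (\<pi> p)" "\<And>v. \<exists>p\<in>odd_trunc. \<pi> p = v"
proof -
  note c5 = V.char_5
  have base: "(xy_monom 4 3 :: 'k bipoly) \<in> odd_trunc" by (rule xy_monom_odd) simp_all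
  have e0: "eW i (xy_monom 4 3) = (0 :: 'k bipoly)" for i
    by (cases i) (auto simp: fun_eq_iff weyl_defs xy_monom_def)
  have h0: "hW i (xy_monom 4 3) = (fscale (of_int (pairing (omega1 + omega2) i)) (xy_monom 4 3) :: 'k bipoly)" for i
    by (cases i) (simp_all only: hW_xy_monom pairing.simps weight_values, simp_all add: fscale_def)
  have psi: "Vector_Spaces.linear fscale (*) (\<lambda>u :: 'k bipoly. u 4 3)"
    by (simp add: Vector_Spaces.linear_iff vector_space_fscale vector_space_over_itself.vector_space_axioms)
  have psif: "fW i u 4 3 = (0 :: 'k)" for i u
    by (cases i) (simp_all add: weyl_defs)
  obtain \<pi> :: "'k bipoly \<Rightarrow> 'k ^ 'n" where
    1: "\<And>p q. p \<in> odd_trunc \<Longrightarrow> q \<in> odd_trunc \<Longrightarrow> \<pi> (p + q) = \<pi> p + \<pi> q" and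
    2: "\<And>c p. p \<in> odd_trunc \<Longrightarrow> \<pi> (fscale c p) = c *s \<pi> p" and
    3: "\<And>p. p \<in> odd_trunc \<Longrightarrow> \<pi> p = 0 \<Longrightarrow> p 4 3 = 0" and
    4: "\<And>i p. p \<in> odd_trunc \<Longrightarrow> eW i p \<in> odd_trunc \<and> \<pi> (eW i p) = V.ee i (\<pi> p)" and
    5: "\<And>i p. p \<in> odd_trunc \<Longrightarrow> \<pi> (fW i p) = V.ff i (\<pi> p)" and 6: "\<And>v. \<exists>p\<in>odd_trunc. \<pi> p = v"
    by (rule V.hom_from_highest_weight_module[OF vector_space_fscale linear_W base odd_trunc_closed(1-3)
          eW_fW[OF c5] hW_fW[OF c5] e0 h0 psi]; (rule that; assumption)?)
       (auto simp: psif xy_monom_def intro: odd_trunc_cyclic[OF c5, THEN subsetD])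
  have inj: "p = 0" if "p \<in> odd_trunc" "\<pi> p = 0" for p
  proof (rule odd_trunc_simple[OF c5, of "{p \<in> odd_trunc. \<pi> p = 0}"])
    fix i w assume w: "w \<in> {p \<in> odd_trunc. \<pi> p = 0}"
    interpret E: Vector_Spaces.linear "(*s)" "(*s)" "V.ee i" by (rule V.linear_ee)
    show "eW i w \<in> {p \<in> odd_trunc. \<pi> p = 0}" using w 4[of w i] by (simp add: E.zero)
  qed (use 3 that in auto)
  show thesis by (rule that[of \<pi>]) (rule 6 | rule 1 2 inj 4[THEN conjunct2] 5, assumption+)+
qed

lemma adjoint_model:
  obtains \<pi> :: "'k sqmat \<Rightarrow> 'k ^ 'm"
  where "\<And>p q. p \<in> sym_mats \<Longrightarrow> q \<in> sym_mats \<Longrightarrow> \<pi> (p + q) = \<pi> p + \<pi> q"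
    "\<And>c p. p \<in> sym_mats \<Longrightarrow> \<pi> (fscale c p) = c *s \<pi> p"
    "\<And>p. p \<in> sym_mats \<Longrightarrow> \<pi> p = 0 \<Longrightarrow> p (Inl 1) (Inl 1) = 0"
    "\<And>i p. p \<in> sym_mats \<Longrightarrow> \<pi> (act (e_mat i) p) = S.ee i (\<pi> p)"
    "\<And>i p. p \<in> sym_mats \<Longrightarrow> \<pi> (act (f_mat i) p) = S.ff i (\<pi> p)"
proof -
  have base: "(unit_mat (Inl 1) (Inl 1) :: _ \<Rightarrow> _ \<Rightarrow> 'k) \<in> sym_mats"
    by (auto simp: sym_mats_def unit_mat_def)
  have closed: "N \<in> sym_mats \<Longrightarrow> N' \<in> sym_mats \<Longrightarrow> N + N' \<in> sym_mats"
    "N \<in> sym_mats \<Longrightarrow> fscale c N \<in> sym_mats" for N N' :: "'k sqmat" and c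
    by (simp_all add: sym_mats_def)
  have h0: "hA i (unit_mat (Inl 1) (Inl 1))
      = (fscale (of_int (pairing (2 *s omega1) i)) (unit_mat (Inl 1) (Inl 1)) :: _ \<Rightarrow> _ \<Rightarrow> 'k)" for i
    by (cases i) (simp_all only: pairing.simps weight_values, simp_all add: fun_eq_iff hA_def unit_mat_def)
  have psi: "Vector_Spaces.linear fscale (*) (\<lambda>u :: 'k sqmat. u (Inl 1) (Inl 1))"
    by (simp add: Vector_Spaces.linear_iff vector_space_fscale vector_space_over_itself.vector_space_axioms)
  obtain \<pi> :: "'k sqmat \<Rightarrow> 'k ^ 'm" where
    1: "\<And>p q. p \<in> sym_mats \<Longrightarrow> q \<in> sym_mats \<Longrightarrow> \<pi> (p + q) = \<pi> p + \<pi> q" and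
    2: "\<And>c p. p \<in> sym_mats \<Longrightarrow> \<pi> (fscale c p) = c *s \<pi> p" and
    3: "\<And>p. p \<in> sym_mats \<Longrightarrow> \<pi> p = 0 \<Longrightarrow> p (Inl 1) (Inl 1) = 0" and
    4: "\<And>i p. p \<in> sym_mats \<Longrightarrow> act (e_mat i) p \<in> sym_mats \<and> \<pi> (act (e_mat i) p) = S.ee i (\<pi> p)" and
    5: "\<And>i p. p \<in> sym_mats \<Longrightarrow> \<pi> (act (f_mat i) p) = S.ff i (\<pi> p)" and 6: "\<And>v. \<exists>p\<in>sym_mats. \<pi> p = v"
    by (rule S.hom_from_highest_weight_module[OF vector_space_fscale linear_act linear_act linear_hA base closed act_sym
          act_e_f hA_f unit_highest h0 psi]; (rule that; assumption)?)
       (auto simp: act_f_11 unit_mat_def intro: sym_cyclic[OF V.two_neq_0, THEN subsetD])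
  show thesis by (rule that[of \<pi>]) (rule 1 2 3 4[THEN conjunct2] 5, assumption+)+
qed

text \<open>
  The image of \<open>F\<close> is a submodule inside the kernel of \<open>\<phi>\<close>, so it is not all of the irreducible module.
\<close>

lemma HomE_zero:
  assumes F: "F \<in> HomE" and phi: "Vector_Spaces.linear (*s) (*) \<phi>" "\<phi> \<noteq> (\<lambda>_. 0)"
    and 0: "\<And>v w. \<phi> (F (sp v w)) = 0"
  shows "F = (\<lambda>_. 0)"
proof -
  interpret F: Vector_Spaces.linear sym2_scale "(*s)" F using F by (simp add: HomE_def)
  interpret phi: Vector_Spaces.linear "(*s)" "(*)" \<phi> by (fact phi)
  interpret E: Vector_Spaces.linear "(*s)" "(*s)" "S.ee r" for r by (rule S.linear_ee)
  interpret G: Vector_Spaces.linear "(*s)" "(*s)" "S.ff r" for r by (rule S.linear_ff)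
  have ker: "\<phi> (F z) = 0" for z
    by (induction z rule: sym2_induct) (simp_all add: 0 F.add phi.add)
  have "S.ee r (F z) \<in> range F \<and> S.ff r (F z) \<in> range F" for r z
  proof (induction z rule: sym2_induct)
    case (1 v w)
    show ?case unfolding HomE_ee[OF F] HomE_ff[OF F] F.add[symmetric] by blast
  next
    case (2 x y)
    then obtain a b c d where "S.ee r (F x) = F a" "S.ff r (F x) = F b" "S.ee r (F y) = F c" "S.ff r (F y) = F d"
      by blast
    then have "S.ee r (F (x + y)) = F (a + c)" "S.ff r (F (x + y)) = F (b + d)"
      by (simp_all add: F.add E.add G.add)
    then show ?case by simp
  qed
  moreover have "vec.subspace (range F)"
    using F.subspace_image[OF F.vs1.subspace_UNIV] by simp
  ultimately have "range F = {0} \<or> range F = UNIV"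
    by (intro S.irreducible_ef) blast+
  moreover have "range F \<noteq> UNIV"
    using phi(2) ker by (metis UNIV_I ext imageE)
  ultimately show ?thesis by (auto simp: fun_eq_iff)
qed

text \<open>
  The weight condition leaves the pairs with \<open>a + c = 6\<close> and \<open>b + d = 4\<close>: the congruences modulo \<open>5\<close> also allow
  \<open>a + c = 1\<close>, which parity excludes. By symmetry the values at
  \<open>(x\<^sup>4 y\<^sup>3, x\<^sup>2 y)\<close>, \<open>(x\<^sup>4 y, x\<^sup>2 y\<^sup>3)\<close>, \<open>(x\<^sup>3 y\<^sup>2, x\<^sup>3 y\<^sup>2)\<close> and \<open>(x\<^sup>3 y\<^sup>4, x\<^sup>3)\<close> remain, and invariance
  under the two lowering operators links each of the last three to one before it.
\<close>

lemma invariant_form_on_monomials: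
  fixes \<beta> :: "'k bipoly \<Rightarrow> 'k bipoly \<Rightarrow> 'k"
  assumes commute: "\<And>p q. \<beta> p q = \<beta> q p"
    and scale: "\<And>c p q. p \<in> odd_trunc \<Longrightarrow> q \<in> odd_trunc \<Longrightarrow> \<beta> (fscale c p) q = c * \<beta> p q"
    and f: "\<And>i p q. p \<in> odd_trunc \<Longrightarrow> q \<in> odd_trunc \<Longrightarrow> \<beta> (fW i p) q + \<beta> p (fW i q) = 0"
    and h: "\<And>i p q. p \<in> odd_trunc \<Longrightarrow> q \<in> odd_trunc \<Longrightarrow>
      \<beta> (hW i p) q + \<beta> p (hW i q) = of_int (pairing (2 *s omega1) i) * \<beta> p q"
    and start: "\<beta> (xy_monom 4 3) (xy_monom 2 1) = 0"
    and ab: "a \<le> 4" "b \<le> 4" "odd (a + b)" and cd: "c \<le> 4" "d \<le> 4" "odd (c + d)"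
  shows "\<beta> (xy_monom a b) (xy_monom c d) = 0"
proof (rule ccontr)
  let ?b = "\<lambda>a b c d. \<beta> (xy_monom a b) (xy_monom c d)"
  assume nz: "?b a b c d \<noteq> 0"
  have odd: "xy_monom a b \<in> odd_trunc" if "a \<le> 4" "b \<le> 4" "odd (a + b)" for a b
    using that by (rule xy_monom_odd)
  have scale': "p \<in> odd_trunc \<Longrightarrow> q \<in> odd_trunc \<Longrightarrow> \<beta> p (fscale c q) = c * \<beta> p q" for c p q
    using scale[of q p c] commute by metis
  note o = odd[OF ab] odd[OF cd]
  have "(of_nat b - 2 + (of_nat d - 2)) * ?b a b c d = 0"
    using h[OF o, of Long] unfolding hW_xy_monom scale[OF o] scale'[OF o] pairing.simps weight_values
    by (simp add: algebra_simps)
  moreover have "(of_int (int b + int d - 4) :: 'k) = of_nat b - 2 + (of_nat d - 2)" by simp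
  ultimately have "(of_int (int b + int d - 4) :: 'k) = 0" using nz by (metis mult_eq_0_iff)
  then have b5: "5 dvd int b + int d - 4" unfolding of_int_eq_0_iff_char_dvd V.char_5 by simp
  have "(of_nat a - of_nat b + (of_nat c - of_nat d) - 2) * ?b a b c d = 0"
    using h[OF o, of Short] unfolding hW_xy_monom scale[OF o] scale'[OF o] pairing.simps weight_values
    by (simp add: algebra_simps)
  moreover have "(of_int (int a - int b + (int c - int d) - 2) :: 'k)
      = of_nat a - of_nat b + (of_nat c - of_nat d) - 2" by simp
  ultimately have "(of_int (int a - int b + (int c - int d) - 2) :: 'k) = 0" using nz by (metis mult_eq_0_iff)
  then have a5: "5 dvd int a - int b + (int c - int d) - 2" unfolding of_int_eq_0_iff_char_dvd V.char_5 by simp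
  obtain k where k: "int b + int d - 4 = 5 * k" using b5 by (elim dvdE)
  then have "k = 0" using ab(2) cd(2) by linarith
  with k have bd: "b + d = 4" by linarith
  have "int a - int b + (int c - int d) - 2 = int a + int c - 6" using bd by linarith
  with a5 have "5 dvd int a + int c - 6" by (simp only:)
  then obtain l where l: "int a + int c - 6 = 5 * l" by (elim dvdE)
  then have "l = 0 \<or> l = -1" using ab(1) cd(1) by linarith
  moreover have "even (a + c)"
  proof -
    have "even (a + c + (b + d))" using ab(3) cd(3) by simp
    then show ?thesis by (simp add: bd)
  qed
  then have "a + c \<noteq> 1" by (metis odd_one)
  ultimately have ac: "a + c = 6" using l by presburger
  have L: "2 * (of_nat (b + 1) * of_nat (b + 2)) * ?b a b c (d + 2)
      + 2 * (of_nat (d + 1) * of_nat (d + 2)) * ?b a (b + 2) c d = 0"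
    if that: "a \<le> 4" "b \<le> 2" "odd (a + b)" "c \<le> 4" "d \<le> 2" "odd (c + d)" for a b c d
  proof -
    have o: "xy_monom a b \<in> odd_trunc" "xy_monom c d \<in> odd_trunc"
       "xy_monom a (Suc (Suc b)) \<in> odd_trunc" "xy_monom c (Suc (Suc d)) \<in> odd_trunc"
      using that by (auto intro!: odd)
    show ?thesis
      unfolding add_2_eq_Suc' Suc_eq_plus1[symmetric]
      using f[OF o(3,4), of Long]
      unfolding fW_xy_monom(2)[OF that(2)] fW_xy_monom(2)[OF that(5)] scale[OF o(1,4)] scale'[OF o(3,2)] .
  qed
  have S: "of_nat (a + 1) * ?b a (b + 1) (c + 1) d + of_nat (c + 1) * ?b (a + 1) b c (d + 1) = 0"
    if that: "a < 4" "b < 4" "odd (Suc a + b)" "c < 4" "d < 4" "odd (Suc c + d)" for a b c d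
  proof -
    have o: "xy_monom a (Suc b) \<in> odd_trunc" "xy_monom c (Suc d) \<in> odd_trunc"
       "xy_monom (Suc a) b \<in> odd_trunc" "xy_monom (Suc c) d \<in> odd_trunc"
      using that by (auto intro!: odd)
    show ?thesis
      unfolding add_2_eq_Suc' Suc_eq_plus1[symmetric]
      using f[OF o(3,4), of Short]
      unfolding fW_xy_monom(1)[OF that(1,2)] fW_xy_monom(1)[OF that(4,5)] scale[OF o(1,4)] scale'[OF o(3,2)] .
  qed
  have num: "(of_nat n :: 'k) \<noteq> 0" if "\<not> 5 dvd n" for n
    using that unfolding of_nat_eq_0_iff_char_dvd V.char_5 by simp
  have nz_num: "(12 :: 'k) \<noteq> 0" "(24 :: 'k) \<noteq> 0" "(4 :: 'k) \<noteq> 0"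
    using num[of 12] num[of 24] num[of 4] by simp_all
  have "2 * (of_nat (1 + 1) * of_nat (1 + 2)) * ?b 4 1 2 (1 + 2)
      + 2 * (of_nat (1 + 1) * of_nat (1 + 2)) * ?b 4 (1 + 2) 2 1 = 0"
    by (rule L) simp_all
  then have X41: "?b 4 1 2 3 = 0" using start nz_num by (simp add: eval_nat_numeral)
  have "of_nat (3 + 1) * ?b 3 (1 + 1) (2 + 1) 2 + of_nat (2 + 1) * ?b (3 + 1) 1 2 (2 + 1) = 0"
    by (rule S) simp_all
  then have X32: "?b 3 2 3 2 = 0" using X41 nz_num by (simp add: eval_nat_numeral)
  have "2 * (of_nat (2 + 1) * of_nat (2 + 2)) * ?b 3 2 3 (0 + 2)
      + 2 * (of_nat (0 + 1) * of_nat (0 + 2)) * ?b 3 (2 + 2) 3 0 = 0"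
    by (rule L) simp_all
  then have X34: "?b 3 4 3 0 = 0" using X32 nz_num by (simp add: eval_nat_numeral)
  have a: "a = 2 \<or> a = 3 \<or> a = 4" and b: "b = 0 \<or> b = 1 \<or> b = 2 \<or> b = 3 \<or> b = 4"
    using ac bd ab(1) cd(1) by linarith+
  have c: "c = 6 - a" and d: "d = 4 - b" using ac bd by simp_all
  have "?b a b c d = 0"
    unfolding c d using a b ab(3) start X41 X32 X34 commute[of "xy_monom 2 1" "xy_monom 4 3"]
      commute[of "xy_monom 2 3" "xy_monom 4 1"] commute[of "xy_monom 3 0" "xy_monom 3 4"]
    by (elim disjE) simp_all
  then show False using nz by simp
qed

lemma HomE_determined:
  assumes \<phi>: "Vector_Spaces.linear (*s) (*) \<phi>" "\<phi> \<noteq> (\<lambda>_. 0)"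
    "\<And>\<mu> v. v \<in> S.wt \<mu> \<Longrightarrow> \<mu> \<noteq> 2 *s omega1 \<Longrightarrow> \<phi> v = 0" "\<And>r v. \<phi> (S.ff r v) = 0"
  obtains v w where "\<And>F. F \<in> HomE \<Longrightarrow> \<phi> (F (sp v w)) = 0 \<Longrightarrow> F = (\<lambda>_. 0)"
proof -
  interpret phi: Vector_Spaces.linear "(*s)" "(*)" \<phi> by (fact \<phi>(1))
  obtain \<pi> :: "'k bipoly \<Rightarrow> 'k ^ 'n"
    where add: "\<And>p q. p \<in> odd_trunc \<Longrightarrow> q \<in> odd_trunc \<Longrightarrow> \<pi> (p + q) = \<pi> p + \<pi> q"
    and scale: "\<And>c p. p \<in> odd_trunc \<Longrightarrow> \<pi> (fscale c p) = c *s \<pi> p"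
    and e: "\<And>i p. p \<in> odd_trunc \<Longrightarrow> \<pi> (eW i p) = V.ee i (\<pi> p)"
    and f: "\<And>i p. p \<in> odd_trunc \<Longrightarrow> \<pi> (fW i p) = V.ff i (\<pi> p)"
    and onto: "\<And>v. \<exists>p\<in>odd_trunc. \<pi> p = v"
    by (rule weil_model) (rule that; assumption)
  have hW_odd: "hW i p \<in> odd_trunc" if "p \<in> odd_trunc" for i and p :: "'k bipoly"
    using that by (cases i) (auto simp: odd_trunc_def)
  have h: "\<pi> (hW i p) = V.hh i (\<pi> p)" if p: "p \<in> odd_trunc" for i p
  proof -
    have "\<pi> (eW i (fW i p)) = \<pi> (fW i (eW i p)) + \<pi> (hW i p)"
      using eW_fW[OF V.char_5 p, of i i] by (simp add: add odd_trunc_closed hW_odd p)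
    then show ?thesis by (simp add: V.hh_def e f odd_trunc_closed p)
  qed
  have zero: "F = (\<lambda>_. 0)"
    if F: "F \<in> HomE" and start: "\<phi> (F (sp (\<pi> (xy_monom 4 3)) (\<pi> (xy_monom 2 1)))) = 0" for F
  proof (rule HomE_zero[OF F \<phi>(1,2)])
    fix v w
    define \<beta> where "\<beta> p q = \<phi> (F (sp (\<pi> p) (\<pi> q)))" for p q
    note Fb = HomE_bilinear[OF F]
    have mono: "\<beta> (xy_monom a b) (xy_monom c d) = 0"
      if "a \<le> 4" "b \<le> 4" "odd (a + b)" "c \<le> 4" "d \<le> 4" "odd (c + d)" for a b c d
    proof (rule invariant_form_on_monomials[of \<beta>, OF _ _ _ _ _ that])
      show "\<beta> p q = \<beta> q p" for p q by (simp add: \<beta>_def sym2_tensor_commute[of "\<pi> p"])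
      show "\<beta> (fscale c p) q = c * \<beta> p q" if "p \<in> odd_trunc" "q \<in> odd_trunc" for c p q
        using that by (simp add: \<beta>_def scale Fb phi.scale)
      show "\<beta> (fW i p) q + \<beta> p (fW i q) = 0" if "p \<in> odd_trunc" "q \<in> odd_trunc" for i p q
        using that \<phi>(4)[of i "F (sp (\<pi> p) (\<pi> q))"] by (simp add: \<beta>_def f HomE_ff[OF F] phi.add)
      show "\<beta> (hW i p) q + \<beta> p (hW i q) = of_int (pairing (2 *s omega1) i) * \<beta> p q"
        if "p \<in> odd_trunc" "q \<in> odd_trunc" for i p q
        using that S.functional_hh[OF \<phi>(1,3), where r = i and s = "F (sp (\<pi> p) (\<pi> q))"]
        by (simp add: \<beta>_def h HomE_hh[OF F] phi.add)
      show "\<beta> (xy_monom 4 3) (xy_monom 2 1) = 0" using start by (simp add: \<beta>_def)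
    qed
    have add_l: "\<beta> (p + p') q = \<beta> p q + \<beta> p' q" and add_r: "\<beta> q (p + p') = \<beta> q p + \<beta> q p'"
      and scale_l: "\<beta> (fscale c p) q = c * \<beta> p q" and scale_r: "\<beta> q (fscale c p) = c * \<beta> q p"
      if "p \<in> odd_trunc" "p' \<in> odd_trunc" for p p' q c
      using that by (simp_all add: \<beta>_def add scale Fb phi.add phi.scale)
    have half: "q \<in> {q \<in> odd_trunc. \<beta> (xy_monom a b) q = 0}"
      if "a \<le> 4" "b \<le> 4" "odd (a + b)" "q \<in> odd_trunc" for a b q
      by (rule odd_trunc_span[OF _ _ _ that(4)])
         (auto simp: add_r scale_r odd_trunc_closed mono[OF that(1-3)] xy_monom_odd)
    have all: "p \<in> {p \<in> odd_trunc. \<beta> p q = 0}" if "p \<in> odd_trunc" "q \<in> odd_trunc" for p q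
      by (rule odd_trunc_span[OF _ _ _ that(1)])
         (use half that(2) in \<open>auto simp: add_l scale_l odd_trunc_closed xy_monom_odd\<close>)
    obtain p q where "p \<in> odd_trunc" "\<pi> p = v" "q \<in> odd_trunc" "\<pi> q = w" using onto by metis
    then show "\<phi> (F (sp v w)) = 0" using all[of p q] by (simp add: \<beta>_def)
  qed
  show thesis by (rule that[OF zero])
qed

text \<open>
  Transport the moment map along the models \<open>\<pi>\<close> of \<open>V\<close> and \<open>\<tau>\<close> of \<open>S\<close>. It is nonzero because the moment of
  \<open>x\<^sup>4 y\<close> and \<open>x\<^sup>2 y\<^sup>3\<close> has a nonzero entry at the place that \<open>\<tau>\<close> detects.
\<close>

lemma HomE_nonzero: obtains F where "F \<in> HomE" "F \<noteq> (\<lambda>_. 0)"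
proof -
  note c5 = V.char_5
  obtain \<pi> :: "'k bipoly \<Rightarrow> 'k ^ 'n"
    where add: "\<And>p q. p \<in> odd_trunc \<Longrightarrow> q \<in> odd_trunc \<Longrightarrow> \<pi> (p + q) = \<pi> p + \<pi> q"
    and scale: "\<And>c p. p \<in> odd_trunc \<Longrightarrow> \<pi> (fscale c p) = c *s \<pi> p"
    and inj: "\<And>p. p \<in> odd_trunc \<Longrightarrow> \<pi> p = 0 \<Longrightarrow> p = 0"
    and e: "\<And>i p. p \<in> odd_trunc \<Longrightarrow> \<pi> (eW i p) = V.ee i (\<pi> p)"
    and f: "\<And>i p. p \<in> odd_trunc \<Longrightarrow> \<pi> (fW i p) = V.ff i (\<pi> p)"
    and onto: "\<And>v. \<exists>p\<in>odd_trunc. \<pi> p = v"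
    by (rule weil_model) (rule that; assumption)
  obtain \<tau> :: "'k sqmat \<Rightarrow> 'k ^ 'm"
    where tadd: "\<And>p q. p \<in> sym_mats \<Longrightarrow> q \<in> sym_mats \<Longrightarrow> \<tau> (p + q) = \<tau> p + \<tau> q"
    and tscale: "\<And>c p. p \<in> sym_mats \<Longrightarrow> \<tau> (fscale c p) = c *s \<tau> p"
    and tker: "\<And>p. p \<in> sym_mats \<Longrightarrow> \<tau> p = 0 \<Longrightarrow> p (Inl 1) (Inl 1) = 0"
    and te: "\<And>i p. p \<in> sym_mats \<Longrightarrow> \<tau> (act (e_mat i) p) = S.ee i (\<tau> p)"
    and tf: "\<And>i p. p \<in> sym_mats \<Longrightarrow> \<tau> (act (f_mat i) p) = S.ff i (\<tau> p)"
    by (rule adjoint_model) (rule that; assumption)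
  obtain \<eta> where eta: "\<And>v. \<eta> v \<in> odd_trunc" "\<And>v. \<pi> (\<eta> v) = v" using onto by metis
  have eta_eq: "\<eta> v = p" if "p \<in> odd_trunc" "\<pi> p = v" for p v
  proof -
    have m: "fscale (-1) p \<in> odd_trunc" using that by (simp add: odd_trunc_closed)
    have "\<pi> (\<eta> v + fscale (-1) p) = 0" by (simp add: add eta m scale that)
    then have "\<eta> v + fscale (-1) p = 0" by (intro inj odd_trunc_closed eta m)
    then show ?thesis by (auto simp: fun_eq_iff)
  qed
  have eta_lin: "\<eta> (v + w) = \<eta> v + \<eta> w" "\<eta> (c *s v) = fscale c (\<eta> v)"
    "\<eta> (V.ee i v) = eW i (\<eta> v)" "\<eta> (V.ff i v) = fW i (\<eta> v)" for v w c i
    by (rule eta_eq; simp add: odd_trunc_closed eta add scale e f)+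
  have M: "moment p q \<in> sym_mats" for p q :: "'k bipoly"
    by (simp add: sym_mats_def moment_def[OF c5] add.commute)
  have zs: "zop i (fscale c p) = fscale c (zop i p)" "zop i (p + p') = zop i p + zop i p'" for i c and p p' :: "'k bipoly"
    by (rule zop_scale zop_add)+
  have Madd: "moment (p + p') q = moment p q + moment p' q" and Mscale: "moment (fscale c p) q = fscale c (moment p q)"
    for p p' q :: "'k bipoly" and c
    by (auto simp: fun_eq_iff moment_def[OF c5] zs bform_add bform_scale algebra_simps)
  define \<beta> where "\<beta> v w = \<tau> (moment (\<eta> v) (\<eta> w))" for v w
  obtain F where lin: "Vector_Spaces.linear sym2_scale (*s) F" and F: "\<And>v w :: 'k ^ 'n. F (sp v w) = \<beta> v w"
  proof (rule linear_sym2_lift[of \<beta>])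
    show "\<beta> (u + v) w = \<beta> u w + \<beta> v w" for u v w
      by (simp add: \<beta>_def eta_lin Madd tadd M)
    show "\<beta> (c *s v) w = c *s \<beta> v w" for c v w
      by (simp add: \<beta>_def eta_lin Mscale tscale M)
    show "\<beta> v w = \<beta> w v" for v w
      by (simp add: \<beta>_def moment_commute[OF c5 eta(1)[of v] eta(1)[of w]])
  qed (rule that; assumption)
  have equi: "\<tau> (moment (T (\<eta> v)) (\<eta> w)) + \<tau> (moment (\<eta> v) (T (\<eta> w))) = \<tau> (act X (moment (\<eta> v) (\<eta> w)))"
    if "quadratic T X" for T X v w
  proof -
    have "moment (T (\<eta> v)) (\<eta> w) + moment (\<eta> v) (T (\<eta> w)) = act X (moment (\<eta> v) (\<eta> w))"
      using moment_equivariant[OF c5 that trunc_closed(5)[OF eta(1)]]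
      by (auto simp: fun_eq_iff act_def)
    then show ?thesis by (simp add: tadd[symmetric] M)
  qed
  have "F (sp (V.dp X 1 v) w) + F (sp v (V.dp X 1 w)) = S.dp X 1 (F (sp v w))" if "X \<in> simple_mats" for X v w
  proof -
    from that consider r where "X = e_mat r" | r where "X = f_mat r"
      unfolding simple_mats_def by blast
    then show ?thesis
    proof cases
      case (1 r)
      then show ?thesis
        using equi[OF quadratic_eW[OF c5], of r v w]
        by (simp only: V.ee_def[symmetric] S.ee_def[symmetric] F \<beta>_def eta_lin te[OF M])
    next
      case (2 r)
      then show ?thesis
        using equi[OF quadratic_fW[OF c5], of r v w]
        by (simp only: V.ff_def[symmetric] S.ff_def[symmetric] F \<beta>_def eta_lin tf[OF M])
    qed
  qed
  with lin have "F \<in> HomE" by (simp add: HomE_def)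
  moreover have "F \<noteq> (\<lambda>_. 0)"
  proof
    assume 0: "F = (\<lambda>_. 0)"
    define p q :: "'k bipoly" where "p = xy_monom 4 1" and "q = xy_monom 2 3"
    have pq: "p \<in> odd_trunc" "q \<in> odd_trunc" by (simp_all add: p_def q_def xy_monom_odd)
    have "\<tau> (moment p q) = F (sp (\<pi> p) (\<pi> q))"
      unfolding F \<beta>_def using eta_eq[OF pq(1) refl] eta_eq[OF pq(2) refl] by simp
    then have "moment p q (Inl 1) (Inl 1) = 0" using 0 tker[OF M] by simp
    moreover have "moment p q (Inl 1) (Inl 1) = 768"
      by (simp add: moment_def[OF c5] zop_simps bform_def weyl_defs p_def q_def xy_monom_def eval_nat_numeral)
    moreover have "(of_nat 768 :: 'k) \<noteq> 0" unfolding of_nat_eq_0_iff_char_dvd c5 by simp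
    ultimately show False by simp
  qed
  ultimately show thesis using that by blast
qed

lemma HomE_line: obtains F0 where "F0 \<noteq> (\<lambda>_. 0)" "HomE = range (\<lambda>c z. c *s F0 z)"
proof -
  obtain v0 \<phi> where phi: "Vector_Spaces.linear (*s) (*) \<phi>" "\<phi> v0 = 1" "v0 \<noteq> 0"
    "\<And>\<mu> v. v \<in> S.wt \<mu> \<Longrightarrow> \<mu> \<noteq> 2 *s omega1 \<Longrightarrow> \<phi> v = 0" "\<And>r v. \<phi> (S.ff r v) = 0"
    by (rule S.highest_functional) (rule that; assumption)
  interpret phi: Vector_Spaces.linear "(*s)" "(*)" \<phi> by (fact phi(1))
  have ne: "\<phi> \<noteq> (\<lambda>_. 0)" using phi(2) by auto
  obtain v w where det: "\<And>F. F \<in> HomE \<Longrightarrow> \<phi> (F (sp v w)) = 0 \<Longrightarrow> F = (\<lambda>_. 0)"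
    by (rule HomE_determined[OF phi(1) ne phi(4,5)]) (assumption | rule that)+
  obtain F0 where F0: "F0 \<in> HomE" "F0 \<noteq> (\<lambda>_. 0)" by (rule HomE_nonzero)
  have comb: "(\<lambda>z. a *s F z + b *s G z) \<in> HomE" if "F \<in> HomE" "G \<in> HomE" for F G a b
  proof -
    interpret F: Vector_Spaces.linear sym2_scale "(*s)" F using that by (simp add: HomE_def)
    interpret G: Vector_Spaces.linear sym2_scale "(*s)" G using that by (simp add: HomE_def)
    have "Vector_Spaces.linear sym2_scale (*s) (\<lambda>z. a *s F z + b *s G z)"
      by unfold_locales (simp_all add: F.add G.add F.scale G.scale vec.scale_right_distrib mult.commute)
    moreover have "S.dp X 1 (a *s F (sp x y) + b *s G (sp x y))
        = (a *s F (sp (V.dp X 1 x) y) + b *s G (sp (V.dp X 1 x) y))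
          + (a *s F (sp x (V.dp X 1 y)) + b *s G (sp x (V.dp X 1 y)))" if X: "X \<in> simple_mats" for X x y
    proof -
      interpret D: Vector_Spaces.linear "(*s)" "(*s)" "S.dp X 1" by (rule S.linear_dp[OF X])
      show ?thesis
        unfolding D.add D.scale HomE_derivation[OF \<open>F \<in> HomE\<close> X] HomE_derivation[OF \<open>G \<in> HomE\<close> X]
        by (simp only: vec.scale_right_distrib add_ac)
    qed
    ultimately show ?thesis by (simp add: HomE_def)
  qed
  have c0: "\<phi> (F0 (sp v w)) \<noteq> 0" using det F0 by blast
  have "\<exists>c. F = (\<lambda>z. c *s F0 z)" if F: "F \<in> HomE" for F
  proof
    define c where "c = \<phi> (F (sp v w)) / \<phi> (F0 (sp v w))"
    \<comment> \<open>With this choice of \<open>c\<close> the functional that determines homomorphisms vanishes on \<open>F - c F0\<close>.\<close>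
    have "(\<lambda>z. 1 *s F z + (- c) *s F0 z) = (\<lambda>_. 0)"
      by (rule det[OF comb[OF F F0(1)]]) (use c0 in \<open>simp add: phi.add phi.diff phi.neg phi.scale c_def\<close>)
    then show "F = (\<lambda>z. c *s F0 z)" by (simp add: fun_eq_iff)
  qed
  moreover have "(\<lambda>z. c *s F0 z) \<in> HomE" for c
    using comb[OF F0(1) F0(1), of c 0] by simp
  ultimately have "HomE = range (\<lambda>c z. c *s F0 z)" by blast
  then show thesis using that F0(2) by blast
qed

lemma dim_HomE: "dim_maps (*s) HomE = 1"
proof -
  obtain F0 where F0: "F0 \<noteq> (\<lambda>_. 0)" "HomE = range (\<lambda>c z. c *s F0 z)" by (rule HomE_line)
  interpret P: vector_space "\<lambda>(c :: 'k) (f :: ('k, 'n) sym2 \<Rightarrow> 'k ^ 'm) v. c *s f v"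
    by unfold_locales (simp_all add: fun_eq_iff vec.scale_right_distrib vec.scale_left_distrib)
  have ind: "P.independent {F0}" using F0(1) by (simp add: P.dependent_single zero_fun_def)
  have "HomE = P.span {F0}" unfolding F0(2) by (simp add: P.span_singleton)
  then have "P.dim HomE = card {F0}" using P.dim_span_eq_card_independent[OF ind] by simp
  then show ?thesis by (simp add: dim_maps_def)
qed

end

theorem lemma4p2:
  fixes \<rho> :: "('k::alg_closed_field) mat4 \<Rightarrow> 'k ^ 'n \<Rightarrow> 'k ^ 'n::finite"
    and \<sigma> :: "'k mat4 \<Rightarrow> 'k ^ 'm \<Rightarrow> 'k ^ 'm::finite"
  assumes "CHAR('k) = 5"
    and "is_L (*s) \<rho> (omega1 + omega2)"
    and "is_L (*s) \<sigma> (2 *s omega1)"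
  shows "dim_maps (*s) (Hom_G sym2_scale (\<lambda>g. sym2_map (\<rho> g)) (*s) \<sigma>) = 1
       \<and> dim_maps (*s) (Hom_Lie sym2_scale (\<lambda>g. sym2_map (\<rho> g)) (*s) \<sigma>) = 1
       \<and> Hom_G sym2_scale (\<lambda>g. sym2_map (\<rho> g)) (*s) \<sigma>
         = Hom_Lie sym2_scale (\<lambda>g. sym2_map (\<rho> g)) (*s) \<sigma>"
proof -
  have "(omega1 + omega2) $ 1 \<le> 2" "(2 *s omega1) $ 1 \<le> 2"
    by (simp_all only: weight_values)
  then interpret sym2_setting \<rho> \<sigma>
    by unfold_locales (use assms in \<open>simp_all add: is_L_def irreducible_module_def weight_values\<close>)
  show ?thesis by (simp add: Hom_eq dim_HomE)
qed

end
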